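(* There exists $\varepsilon_0>0$ such that for every $\varepsilon\in(0,\varepsilon_0)$ and every $z\in\mathbb C$ with $|z|\le 1-\varepsilon$ the following holds. Let $d=d(n)$ be positive integers with $d(n)\le Dn$ for a fixed constant $D$, and let $(\varpi_n)$ be any sequence of reals with $\varpi_n\to\infty$. Then there exist a constant $\tilde C$ depending only on $\varepsilon$ (and $D$), constants $c,\bar C,C>0$ (absolute, up to dependence on $D$), and events $\Omega_n$ with $$\mathbb P(\Omega_n^c)\le C\exp(-c(\log n)^2)+\exp(-cd),$$ such that for all large $n$, on $\Omega_n$, $$|\tilde m_n(\xi)-\tilde m_\infty(\xi)|\le \tilde C\max\Big\{\frac1{d^{1/2}},\frac{\log n}{n^{1/4}}\Big\}(\operatorname{Im}\xi)^{-3}$$ for all $\xi\in\mathcal S_{\varepsilon,\varpi}:=\{\xi=\mathrm i\eta:\ \eta\in(0,\bar C],\ \eta^3\min\{d^{1/2},n^{1/4}(\log n)^{-1}\}\ge\varpi_n\}$.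
   Context: $S_n^d=\sum_{\ell=1}^d P_n^\ell$, where $P_n^\ell(i,j)=\mathbf 1(\pi_n^\ell(i)=j)$ for independent uniformly random permutations $\pi_n^1,\dots,\pi_n^d$ of $[n]$. For $\xi\in\mathbb C^+=\{\operatorname{Im}\xi>0\}$, $$\tilde m_n(\xi)=\frac1{2n}\operatorname{Tr}\Big[\xi I_{2n}-\begin{pmatrix}0& zI_n-S_n^d/\sqrt d\\ (zI_n-S_n^d/\sqrt d)^*&0\end{pmatrix}\Big]^{-1}.$$ $\tilde m_\infty(\xi)=\int\frac{d\nu(x)}{\xi-x}$ is the Stieltjes transform of the unique symmetric probability measure $\nu$ on $\mathbb R$ (depending on $z$) such that $\tilde m_\infty(\xi)(\xi-\tilde m_\infty(\xi))^2+\tilde m_\infty(\xi)(1-|z|^2)-\xi=0$ for all $\xi\in\mathbb C^+$. *)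

theory Defs
  imports "HOL-Probability.Probability" "Jordan_Normal_Form.Gauss_Jordan_Elimination"
begin

text \<open>Sample space: d-tuples (indexed by 0..d-1) of permutations of [n] = {0..n-1},
  with the uniform distribution (= d independent uniform permutations).\<close>
definition perm_space :: "nat \<Rightarrow> nat \<Rightarrow> (nat \<Rightarrow> nat \<Rightarrow> nat) set" where
  "perm_space n d = PiE {..<d} (\<lambda>_. {p. p permutes {..<n}})"

definition perm_pmf :: "nat \<Rightarrow> nat \<Rightarrow> (nat \<Rightarrow> nat \<Rightarrow> nat) pmf" where
  "perm_pmf n d = pmf_of_set (perm_space n d)"

definition S_mat :: "nat \<Rightarrow> nat \<Rightarrow> (nat \<Rightarrow> nat \<Rightarrow> nat) \<Rightarrow> complex mat" where
  "S_mat n d \<omega> = mat n n (\<lambda>(i,j). of_nat (card {l \<in> {..<d}. \<omega> l i = j}))"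

definition A_mat :: "nat \<Rightarrow> nat \<Rightarrow> complex \<Rightarrow> (nat \<Rightarrow> nat \<Rightarrow> nat) \<Rightarrow> complex mat" where
  "A_mat n d z \<omega> = z \<cdot>\<^sub>m 1\<^sub>m n - (1 / complex_of_real (sqrt (real d))) \<cdot>\<^sub>m S_mat n d \<omega>"

definition herm_mat :: "nat \<Rightarrow> nat \<Rightarrow> complex \<Rightarrow> (nat \<Rightarrow> nat \<Rightarrow> nat) \<Rightarrow> complex mat" where
  "herm_mat n d z \<omega> = mat (2*n) (2*n) (\<lambda>(i,j).
     if i < n \<and> n \<le> j then A_mat n d z \<omega> $$ (i, j - n)
     else if n \<le> i \<and> j < n then cnj (A_mat n d z \<omega> $$ (j, i - n))
     else 0)"

definition mat_trace :: "complex mat \<Rightarrow> complex" where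
  "mat_trace M = (\<Sum>i<dim_row M. M $$ (i,i))"

definition m_n :: "nat \<Rightarrow> nat \<Rightarrow> complex \<Rightarrow> (nat \<Rightarrow> nat \<Rightarrow> nat) \<Rightarrow> complex \<Rightarrow> complex" where
  "m_n n d z \<omega> \<xi> = mat_trace (the (mat_inverse (\<xi> \<cdot>\<^sub>m 1\<^sub>m (2*n) - herm_mat n d z \<omega>)))
                     / of_nat (2*n)"

definition stieltjes :: "real measure \<Rightarrow> complex \<Rightarrow> complex" where
  "stieltjes \<nu> \<xi> = integral\<^sup>L \<nu> (\<lambda>x. 1 / (\<xi> - complex_of_real x))"

definition m_inf :: "complex \<Rightarrow> complex \<Rightarrow> complex" where
  "m_inf z = (THE m. \<exists>\<nu>. prob_space \<nu> \<and> sets \<nu> = sets borel \<and> distr \<nu> borel uminus = \<nu> \<and>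
       m = stieltjes \<nu> \<and>
       (\<forall>\<xi>. Im \<xi> > 0 \<longrightarrow> m \<xi> * (\<xi> - m \<xi>)^2 + m \<xi> * (1 - complex_of_real ((cmod z)^2)) - \<xi> = 0))"

end

theory Submission
  imports Defs "HOL-Probability.Hoeffding" "Jordan_Normal_Form.Schur_Decomposition"
    "HOL-Complex_Analysis.Conformal_Mappings"
begin

text \<open>On the imaginary axis \<open>\<xi> = \<i>\<eta>\<close> the normalized trace of the resolvent is \<open>-\<i>g\<close> with \<open>g \<ge> 0\<close>.

  A transposition in one of the permutations changes \<open>g\<close> by \<open>O(1 / (n sqrt d \<eta>\<^sup>2))\<close>, so exposing the \<open>nd\<close> values of
  the permutations one by one and applying Hoeffding's lemma shows that \<open>g\<close> is sub-Gaussian with deviations of order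
  \<open>1 / (sqrt n \<eta>\<^sup>2)\<close> from its mean.

  For the mean, expand the resolvent to second order in each single permutation. The resolvent without that
  permutation is independent of it, and averaging over a uniform permutation replaces the quadratic term by a product of
  normalized traces up to \<open>O(1 / sqrt n)\<close>; the third-order remainder contributes \<open>O(1 / (sqrt d \<eta>\<^sup>3))\<close>. Hence
  the mean satisfies the cubic \<open>x (\<eta> + x)\<^sup>2 - (1 - |z|\<^sup>2) x - \<eta> = 0\<close> up to a small error, and for \<open>|z| \<le> 1 - \<epsilon>\<close> this
  cubic is stable near its positive root.

  The measure defining the limit is obtained as a weak limit of the averaged spectral laws with \<open>d = n\<close>; it is unique
  because its Poisson integrals at \<open>x = 0\<close> determine all moments of \<open>1 / (1 + x\<^sup>2)\<close>, hence a symmetric law.\<close>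

section \<open>Averages over finite sets\<close>

definition avg :: "'a set \<Rightarrow> ('a \<Rightarrow> 'b::real_normed_field) \<Rightarrow> 'b" where
  "avg S f = sum f S / of_nat (card S)"

lemma avg_cong: "(\<And>x. x \<in> S \<Longrightarrow> f x = g x) \<Longrightarrow> avg S f = avg S g"
  by (simp add: avg_def)

lemma avg_add: "avg S (\<lambda>x. f x + g x) = avg S f + avg S g"
  by (simp add: avg_def sum.distrib add_divide_distrib)

lemma avg_diff: "avg S (\<lambda>x. f x - g x) = avg S f - avg S g"
  by (simp add: avg_def sum_subtractf diff_divide_distrib)

lemma avg_minus: "avg S (\<lambda>x. - f x) = - avg S f"
  by (simp add: avg_def sum_negf)

lemma avg_mult_left: "avg S (\<lambda>x. c * f x) = c * avg S f"
  by (simp add: avg_def sum_distrib_left)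

lemma avg_mult_right: "avg S (\<lambda>x. f x * c) = avg S f * c"
  by (simp add: avg_def sum_distrib_right)

lemma avg_sum: "avg S (\<lambda>x. \<Sum>i\<in>I. f i x) = (\<Sum>i\<in>I. avg S (f i))"
  unfolding avg_def by (subst sum.swap) (simp add: sum_divide_distrib)

lemma avg_swap: "avg S (\<lambda>x. avg T (f x)) = avg T (\<lambda>y. avg S (\<lambda>x. f x y))"
  unfolding avg_def sum_divide_distrib by (subst sum.swap) (simp add: mult.commute)

lemma avg_const: "finite S \<Longrightarrow> S \<noteq> {} \<Longrightarrow> avg S (\<lambda>_. c) = c"
  by (simp add: avg_def)

lemma avg_of_real: "avg S (\<lambda>x. of_real (f x)) = of_real (avg S f)"
  by (simp add: avg_def)

lemma Im_avg: "Im (avg S f) = avg S (\<lambda>x. Im (f x))"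
  by (simp add: avg_def Im_divide_of_nat)

lemma avg_mono:
  fixes f g :: "'a \<Rightarrow> real"
  shows "(\<And>x. x \<in> S \<Longrightarrow> f x \<le> g x) \<Longrightarrow> avg S f \<le> avg S g"
  by (simp add: avg_def divide_right_mono sum_mono)

lemma norm_avg: "norm (avg S f) \<le> avg S (\<lambda>x. norm (f x))"
  by (simp add: avg_def norm_divide divide_right_mono norm_sum)

lemma norm_avg_le:
  assumes "finite S" "S \<noteq> {}" "\<And>x. x \<in> S \<Longrightarrow> norm (f x) \<le> c"
  shows "norm (avg S f) \<le> c"
proof -
  have "norm (avg S f) \<le> avg S (\<lambda>x. norm (f x))" by (rule norm_avg)
  also have "\<dots> \<le> avg S (\<lambda>_. c)" by (intro avg_mono assms)
  finally show ?thesis using assms by (simp add: avg_const)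
qed

lemma avg_reindex: "bij_betw h S T \<Longrightarrow> avg T f = avg S (\<lambda>x. f (h x))"
  unfolding avg_def by (metis bij_betw_same_card sum.reindex_bij_betw)

lemma avg_Times: "avg (S \<times> T) f = avg S (\<lambda>x. avg T (\<lambda>y. f (x, y)))"
  by (simp add: avg_def sum_divide_distrib [symmetric] sum.cartesian_product card_cartesian_product field_simps)

lemma exp_avg_le:
  fixes f :: "'a \<Rightarrow> real"
  assumes "finite S" "S \<noteq> {}"
  shows "exp (avg S f) \<le> avg S (\<lambda>x. exp (f x))"
proof -
  have "exp (avg S f) = avg S (\<lambda>x. exp (avg S f) * (1 + (f x - avg S f)))"
    using assms by (simp add: avg_mult_left avg_add avg_diff avg_const)
  also have "\<dots> \<le> avg S (\<lambda>x. exp (avg S f) * exp (f x - avg S f))"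
    by (intro avg_mono mult_left_mono exp_ge_add_one_self) simp
  also have "\<dots> = avg S (\<lambda>x. exp (f x))" by (simp flip: exp_add)
  finally show ?thesis .
qed

lemma expectation_pmf_of_set:
  fixes f :: "'a \<Rightarrow> real"
  shows "finite S \<Longrightarrow> S \<noteq> {} \<Longrightarrow> measure_pmf.expectation (pmf_of_set S) f = avg S f"
  by (simp add: integral_pmf_of_set avg_def)

lemma prob_pmf_of_set:
  "finite S \<Longrightarrow> S \<noteq> {} \<Longrightarrow> measure_pmf.prob (pmf_of_set S) A = avg S (\<lambda>x. of_bool (x \<in> A))"
  by (simp add: measure_pmf_of_set avg_def)

lemma bij_betw_PiE_insert:
  assumes "x \<notin> I"
  shows "bij_betw (\<lambda>(p, w). w(x := p)) (T x \<times> PiE I T) (PiE (insert x I) T)"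
  unfolding bij_betw_def using inj_combinator[OF assms, of T] PiE_insert_eq[of x I T] by auto

lemma fun_upd_PiE: "w \<in> PiE I T \<Longrightarrow> l \<in> I \<Longrightarrow> p \<in> T l \<Longrightarrow> w(l := p) \<in> PiE I T"
  by (auto simp: PiE_iff extensional_def)

lemma avg_PiE_resample:
  fixes f :: "('i \<Rightarrow> 'a) \<Rightarrow> 'b::real_normed_field"
  assumes l: "l \<in> I" and fin: "finite (T l)" "T l \<noteq> {}"
  shows "avg (PiE I T) f = avg (PiE I T) (\<lambda>w. avg (T l) (\<lambda>p. f (w(l := p))))"
proof -
  define h where "h = (\<lambda>(w :: 'i \<Rightarrow> 'a, p). (w(l := p), w l))"
  have h_in: "h x \<in> PiE I T \<times> T l" if "x \<in> PiE I T \<times> T l" for x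
    using that l by (auto simp: h_def PiE_iff extensional_def)
  have h_h: "h (h x) = x" for x by (cases x) (simp add: h_def)
  have bij: "bij_betw h (PiE I T \<times> T l) (PiE I T \<times> T l)"
    by (rule bij_betwI[where g = h]) (use h_in h_h in auto)
  have "avg (PiE I T) f = avg (PiE I T \<times> T l) (\<lambda>x. f (fst x))"
    using fin by (simp add: avg_Times avg_const)
  also have "\<dots> = avg (PiE I T \<times> T l) (\<lambda>x. f (fst (h x)))" by (rule avg_reindex[OF bij])
  also have "\<dots> = avg (PiE I T) (\<lambda>w. avg (T l) (\<lambda>p. f (w(l := p))))" by (simp add: avg_Times h_def)
  finally show ?thesis .
qed

section \<open>Sub-Gaussian functions\<close>

definition subgaussian :: "'a set \<Rightarrow> ('a \<Rightarrow> real) \<Rightarrow> real \<Rightarrow> bool" where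
  "subgaussian S f v \<longleftrightarrow> (\<forall>t. avg S (\<lambda>x. exp (t * (f x - avg S f))) \<le> exp (v * t\<^sup>2 / 2))"

lemma subgaussianD: "subgaussian S f v \<Longrightarrow> avg S (\<lambda>x. exp (t * (f x - avg S f))) \<le> exp (v * t\<^sup>2 / 2)"
  by (simp add: subgaussian_def)

lemma subgaussian_reindex:
  "bij_betw h S T \<Longrightarrow> subgaussian T f v \<longleftrightarrow> subgaussian S (\<lambda>x. f (h x)) v"
  by (simp add: subgaussian_def avg_reindex)

lemma subgaussian_singleton: "subgaussian {a} f 0"
  by (simp add: subgaussian_def avg_def)

lemma avg_exp_le_Hoeffding:
  fixes f :: "'a \<Rightarrow> real"
  assumes S: "finite S" "S \<noteq> {}" and bounds: "\<And>x. x \<in> S \<Longrightarrow> f x \<in> {a..b}" and t: "t > 0"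
  shows "avg S (\<lambda>x. exp (t * (f x - avg S f))) \<le> exp (t\<^sup>2 * (b - a)\<^sup>2 / 8)"
proof -
  let ?M = "measure_pmf (pmf_of_set S)"
  interpret interval_bounded_random_variable ?M f a b
    by unfold_locales (use S bounds in \<open>auto simp: AE_measure_pmf_iff\<close>)
  have "ennreal (avg S (\<lambda>x. exp (t * (f x - avg S f)))) = nn_integral ?M (\<lambda>x. exp (t * (f x - avg S f)))"
    unfolding expectation_pmf_of_set[OF S, symmetric]
    by (rule nn_integral_eq_integral[symmetric]) (auto intro!: integrable_measure_pmf_finite simp: S)
  also have "\<dots> \<le> ennreal (exp (t\<^sup>2 * (b - a)\<^sup>2 / 8))"
    using Hoeffdings_lemma_nn_integral[OF t] S by (simp add: expectation_pmf_of_set)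
  finally show ?thesis by simp
qed

lemma subgaussian_bounded:
  assumes S: "finite S" "S \<noteq> {}" and bounds: "\<And>x. x \<in> S \<Longrightarrow> f x \<in> {a..b}"
  shows "subgaussian S f ((b - a)\<^sup>2 / 4)"
  unfolding subgaussian_def
proof
  fix t :: real
  consider "t > 0" | "t = 0" | "t < 0" by linarith
  then show "avg S (\<lambda>x. exp (t * (f x - avg S f))) \<le> exp ((b - a)\<^sup>2 / 4 * t\<^sup>2 / 2)"
  proof cases
    assume "t > 0"
    then show ?thesis using avg_exp_le_Hoeffding[OF S bounds] by (simp add: mult.commute)
  next
    assume "t = 0"
    then show ?thesis using S by (simp add: avg_const)
  next
    assume "t < 0"
    then have "avg S (\<lambda>x. exp (- t * (- f x - avg S (\<lambda>x. - f x)))) \<le> exp ((- t)\<^sup>2 * (- a - (- b))\<^sup>2 / 8)"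
      using bounds by (intro avg_exp_le_Hoeffding[OF S]) auto
    then show ?thesis by (simp add: avg_minus algebra_simps)
  qed
qed

lemma subgaussian_Times:
  assumes fibre: "\<And>x. x \<in> S \<Longrightarrow> subgaussian T (\<lambda>y. f (x, y)) v"
    and mean: "subgaussian S (\<lambda>x. avg T (\<lambda>y. f (x, y))) u"
  shows "subgaussian (S \<times> T) f (u + v)"
  unfolding subgaussian_def
proof
  fix t :: real
  define h where "h x = avg T (\<lambda>y. f (x, y))" for x
  have "avg (S \<times> T) (\<lambda>p. exp (t * (f p - avg (S \<times> T) f)))
      = avg S (\<lambda>x. avg T (\<lambda>y. exp (t * (f (x, y) - h x))) * exp (t * (h x - avg S h)))"
    unfolding h_def avg_Times[symmetric] unfolding avg_mult_right[symmetric] exp_add[symmetric] avg_Times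
    by (simp add: algebra_simps)
  also have "\<dots> \<le> avg S (\<lambda>x. exp (v * t\<^sup>2 / 2) * exp (t * (h x - avg S h)))"
    using subgaussianD[OF fibre] by (intro avg_mono mult_right_mono) (auto simp: h_def)
  also have "\<dots> = exp (v * t\<^sup>2 / 2) * avg S (\<lambda>x. exp (t * (h x - avg S h)))" by (rule avg_mult_left)
  also have "\<dots> \<le> exp (v * t\<^sup>2 / 2) * exp (u * t\<^sup>2 / 2)"
    using subgaussianD[OF mean, folded h_def] by (intro mult_left_mono) auto
  also have "\<dots> = exp ((u + v) * t\<^sup>2 / 2)"
    by (simp add: algebra_simps add_divide_distrib flip: exp_add)
  finally show "avg (S \<times> T) (\<lambda>p. exp (t * (f p - avg (S \<times> T) f))) \<le> exp ((u + v) * t\<^sup>2 / 2)" .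
qed

lemma subgaussian_avg:
  assumes T: "finite T" "T \<noteq> {}" and f: "\<And>y. y \<in> T \<Longrightarrow> subgaussian S (\<lambda>x. f x y) v"
  shows "subgaussian S (\<lambda>x. avg T (f x)) v"
  unfolding subgaussian_def
proof
  fix t :: real
  have "t * (avg T (f x) - avg S (\<lambda>x. avg T (f x))) = avg T (\<lambda>y. t * (f x y - avg S (\<lambda>x. f x y)))" for x
    by (simp add: avg_mult_left avg_diff avg_swap[of S])
  then have "avg S (\<lambda>x. exp (t * (avg T (f x) - avg S (\<lambda>x. avg T (f x)))))
      \<le> avg S (\<lambda>x. avg T (\<lambda>y. exp (t * (f x y - avg S (\<lambda>x. f x y)))))"
    by (intro avg_mono) (simp add: exp_avg_le[OF T])
  also have "\<dots> = avg T (\<lambda>y. avg S (\<lambda>x. exp (t * (f x y - avg S (\<lambda>x. f x y)))))" by (rule avg_swap)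
  also have "\<dots> \<le> avg T (\<lambda>_. exp (v * t\<^sup>2 / 2))" by (intro avg_mono subgaussianD[OF f])
  finally show "avg S (\<lambda>x. exp (t * (avg T (f x) - avg S (\<lambda>x. avg T (f x))))) \<le> exp (v * t\<^sup>2 / 2)"
    by (simp add: avg_const[OF T])
qed

lemma subgaussian_PiE:
  assumes "finite I" and T: "\<And>l. l \<in> I \<Longrightarrow> finite (T l) \<and> T l \<noteq> {}"
    and "\<And>w l. w \<in> PiE I T \<Longrightarrow> l \<in> I \<Longrightarrow> subgaussian (T l) (\<lambda>p. f (w(l := p))) v"
  shows "subgaussian (PiE I T) f (of_nat (card I) * v)"
  using assms
proof (induction I arbitrary: f rule: finite_induct)
  case empty
  then show ?case by (simp add: subgaussian_singleton)
next
  case (insert x I)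
  have W: "finite (PiE I T)" "PiE I T \<noteq> {}"
    using insert.prems(1) insert.hyps(1) by (auto intro: finite_PiE simp: PiE_eq_empty_iff)
  have w_in: "w(x := p) \<in> PiE (insert x I) T" if "w \<in> PiE I T" "p \<in> T x" for w p
    using that by (auto simp: PiE_iff extensional_def)
  have rest: "subgaussian (PiE I T) (\<lambda>w. f (w(x := p))) (of_nat (card I) * v)" if p: "p \<in> T x" for p
  proof (rule insert.IH)
    fix w l assume w: "w \<in> PiE I T" "l \<in> I"
    have "(w(x := p))(l := q) = (w(l := q))(x := p)" for q
      using w(2) insert.hyps(2) by (intro fun_upd_twist) auto
    then show "subgaussian (T l) (\<lambda>q. f ((w(l := q))(x := p))) v"
      using insert.prems(2)[OF w_in[OF w(1) p] insertI2[OF w(2)]] by (simp only:)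
  qed (use insert.prems(1) in blast)
  have new: "subgaussian (T x) (\<lambda>p. avg (PiE I T) (\<lambda>w. f (w(x := p)))) v"
  proof (rule subgaussian_avg[OF W])
    fix w assume w: "w \<in> PiE I T"
    obtain p where "p \<in> T x" using insert.prems(1) by blast
    from insert.prems(2)[OF w_in[OF w this] insertI1]
    show "subgaussian (T x) (\<lambda>p. f (w(x := p))) v" by (simp only: fun_upd_upd)
  qed
  have "subgaussian (T x \<times> PiE I T) (\<lambda>(p, w). f (w(x := p))) (v + of_nat (card I) * v)"
    by (rule subgaussian_Times) (use rest new in simp_all)
  then show ?case
    using insert.hyps by (simp add: subgaussian_reindex[OF bij_betw_PiE_insert] case_prod_unfold algebra_simps)
qed

lemma avg_abs_dev_le:
  assumes f: "subgaussian S f v" and v: "v > 0"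
  shows "avg S (\<lambda>x. \<bar>f x - avg S f\<bar>) \<le> 4 * sqrt v"
proof -
  define t where "t = 1 / sqrt v"
  have t: "t > 0" "v * t\<^sup>2 = 1" using v by (auto simp: t_def power_divide)
  have abs_le_exp: "\<bar>u\<bar> \<le> exp u + exp (- u)" for u :: real
    using exp_ge_add_one_self[of u] exp_ge_add_one_self[of "-u"] exp_gt_zero[of u] exp_gt_zero[of "-u"]
    by linarith
  have "t * avg S (\<lambda>x. \<bar>f x - avg S f\<bar>) = avg S (\<lambda>x. \<bar>t * (f x - avg S f)\<bar>)"
    using t by (simp add: abs_mult flip: avg_mult_left)
  also have "\<dots> \<le> avg S (\<lambda>x. exp (t * (f x - avg S f)) + exp (- t * (f x - avg S f)))"
    using abs_le_exp[of "t * _"] by (intro avg_mono) simp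
  also have "\<dots> \<le> 2 * exp (1 / 2)"
    using subgaussianD[OF f, of t] subgaussianD[OF f, of "-t"] t(2) by (simp add: avg_add)
  also have "\<dots> \<le> 2 * 2"
  proof -
    have "(exp (1 / 2))\<^sup>2 \<le> (2::real)\<^sup>2" using exp_le by (simp flip: exp_of_nat_mult)
    then show ?thesis using power2_le_imp_le[of "exp (1 / 2)" "2::real"] by simp
  qed
  finally show ?thesis using v by (simp add: t_def field_simps)
qed

lemma subgaussian_tail:
  assumes f: "subgaussian S f v" and v: "v > 0" and u: "u > 0"
  shows "avg S (\<lambda>x. of_bool (u \<le> \<bar>f x - avg S f\<bar>)) \<le> 2 * exp (- (u\<^sup>2 / (2 * v)))"
proof -
  define t where "t = u / v"
  define Y where "Y x = f x - avg S f" for x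
  have t: "t > 0" using u v by (simp add: t_def)
  have indicator_le: "of_bool (u \<le> \<bar>Y x\<bar>) \<le> exp (- (t * u)) * (exp (t * Y x) + exp (- t * Y x))" for x
  proof (cases "u \<le> \<bar>Y x\<bar>")
    case True
    then have "t * u \<le> \<bar>t * Y x\<bar>" using t by (simp add: abs_mult)
    then have "exp (t * u) \<le> exp \<bar>t * Y x\<bar>" by simp
    also have "\<dots> \<le> exp (t * Y x) + exp (- t * Y x)" by (cases "t * Y x \<ge> 0") auto
    finally show ?thesis using True by (simp add: exp_minus field_simps)
  qed auto
  have "avg S (\<lambda>x. of_bool (u \<le> \<bar>Y x\<bar>)) \<le> exp (- (t * u)) * (avg S (\<lambda>x. exp (t * Y x)) + avg S (\<lambda>x. exp (- t * Y x)))"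
    unfolding avg_add[symmetric] avg_mult_left[symmetric] by (intro avg_mono indicator_le)
  also have "\<dots> \<le> exp (- (t * u)) * (2 * exp (v * t\<^sup>2 / 2))"
    using subgaussianD[OF f, of t] subgaussianD[OF f, of "-t"] unfolding Y_def
    by (intro mult_left_mono) auto
  also have "\<dots> = 2 * exp (- (u\<^sup>2 / (2 * v)))"
    using v by (simp add: t_def power2_eq_square add_divide_distrib field_simps flip: exp_add)
  finally show ?thesis by (simp add: Y_def)
qed

section \<open>Uniformly random permutations\<close>

abbreviation perms :: "'a set \<Rightarrow> ('a \<Rightarrow> 'a) set" where
  "perms S \<equiv> {p. p permutes S}"

abbreviation swap :: "'a \<Rightarrow> 'a \<Rightarrow> 'a \<Rightarrow> 'a" where
  "swap \<equiv> Transposition.transpose"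

lemma perms_nonempty: "perms S \<noteq> {}"
  using permutes_id by blast

lemma permutes_swap: "p permutes S \<Longrightarrow> i \<in> S \<Longrightarrow> j \<in> S \<Longrightarrow> p \<circ> swap i j permutes S"
  by (intro permutes_compose permutes_swap_id)

lemma bij_betw_perms_insert:
  assumes "finite S" "a \<notin> S"
  shows "bij_betw (\<lambda>(b, q). swap a b \<circ> q) (insert a S \<times> perms S) (perms (insert a S))"
proof -
  have image: "(\<lambda>(b, q). swap a b \<circ> q) ` (insert a S \<times> perms S) = perms (insert a S)"
    unfolding permutes_insert by (rule arg_cong2[of _ _ _ _ "(`)"]) auto
  have "card (insert a S \<times> perms S) = card (perms (insert a S))"
    using assms by (simp add: card_cartesian_product card_permutations)
  then have "inj_on (\<lambda>(b, q). swap a b \<circ> q) (insert a S \<times> perms S)"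
    using assms by (intro eq_card_imp_inj_on) (auto simp: image finite_permutations)
  with image show ?thesis by (simp add: bij_betw_def)
qed

lemma avg_perms_insert:
  assumes "finite S" "a \<in> S"
  shows "avg (perms S) f = avg S (\<lambda>b. avg (perms (S - {a})) (\<lambda>q. f (swap a b \<circ> q)))"
  using avg_reindex[OF bij_betw_perms_insert[of "S - {a}" a], of f] assms
  by (simp add: avg_Times insert_absorb)

lemma avg_perms_inv: "avg (perms S) (\<lambda>p. f (inv_into UNIV p)) = avg (perms S) f"
  unfolding avg_def by (simp flip: sum_permutations_inverse)

lemma avg_perms_apply:
  assumes S: "finite S" and i: "i \<in> S"
  shows "avg (perms S) (\<lambda>p. f (p i)) = avg S f"
proof -
  have "avg (perms S) (\<lambda>p. f (p i)) = avg S (\<lambda>b. avg (perms (S - {i})) (\<lambda>q. f b))"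
    unfolding avg_perms_insert[OF S i]
    by (intro avg_cong) (auto simp: permutes_not_in[of _ "S - {i}" i])
  then show ?thesis using S by (simp add: avg_const[OF finite_permutations perms_nonempty])
qed

lemma avg_perms_apply_pair:
  assumes S: "finite S" and ij: "i \<in> S" "j \<in> S" "i \<noteq> j"
  shows "avg (perms S) (\<lambda>p. f (p i) (p j)) = avg S (\<lambda>k. avg (S - {k}) (f k))"
proof -
  have "avg (perms S) (\<lambda>p. f (p i) (p j)) = avg S (\<lambda>b. avg (perms (S - {i})) (\<lambda>q. f b (swap i b (q j))))"
    unfolding avg_perms_insert[OF S ij(1)]
    by (intro avg_cong) (auto simp: permutes_not_in[of _ "S - {i}" i])
  also have "\<dots> = avg S (\<lambda>b. avg (S - {i}) (\<lambda>k. f b (swap i b k)))"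
    using S ij by (intro avg_cong avg_perms_apply[of "S - {i}" j "\<lambda>k. f _ (swap i _ k)"]) auto
  also have "\<dots> = avg S (\<lambda>b. avg (S - {b}) (f b))"
  proof (intro avg_cong avg_reindex[symmetric])
    fix b assume "b \<in> S"
    then show "bij_betw (swap i b) (S - {i}) (S - {b})"
      using ij(1) by (intro bij_betwI[where g = "swap i b"]) (auto simp: Transposition.transpose_def)
  qed
  finally show ?thesis .
qed

lemma avg_perms_apply_inv:
  assumes S: "finite S" and ij: "i \<in> S" "j \<in> S"
  shows "avg (perms S) (\<lambda>p. f (p i) (inv_into UNIV p j))
    = avg S (\<lambda>k. if k = j then f j i else avg (S - {i}) (f k))"
  unfolding avg_perms_insert[OF S ij(1)]
proof (intro avg_cong)
  fix b assume b: "b \<in> S"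
  define k where "k = swap i b j"
  have apply_eq: "f ((swap i b \<circ> q) i) (inv_into UNIV (swap i b \<circ> q) j) = f b (inv_into UNIV q k)"
    if "q \<in> perms (S - {i})" for q
  proof -
    have q: "q permutes S - {i}" using that by simp
    have "(swap i b \<circ> q) i = b" using permutes_not_in[OF q, of i] by simp
    moreover have "inv_into UNIV (swap i b \<circ> q) = inv_into UNIV q \<circ> swap i b"
      using permutes_bij[OF q] by (simp add: o_inv_distrib)
    ultimately show ?thesis by (simp add: k_def)
  qed
  have "avg (perms (S - {i})) (\<lambda>q. f ((swap i b \<circ> q) i) (inv_into UNIV (swap i b \<circ> q) j))
      = avg (perms (S - {i})) (\<lambda>q. f b (inv_into UNIV q k))"
    by (rule avg_cong[OF apply_eq])
  also have "\<dots> = avg (perms (S - {i})) (\<lambda>q. f b (q k))" by (rule avg_perms_inv)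
  also have "\<dots> = (if b = j then f j i else avg (S - {i}) (f b))"
  proof (cases "b = j")
    case True
    then have "avg (perms (S - {i})) (\<lambda>q. f b (q k)) = avg (perms (S - {i})) (\<lambda>q. f j i)"
      by (intro avg_cong) (auto simp: k_def permutes_not_in[of _ "S - {i}" i])
    then show ?thesis using True S by (simp add: avg_const[OF finite_permutations perms_nonempty])
  next
    case False
    then have "k \<in> S - {i}" using b ij by (auto simp: k_def Transposition.transpose_def)
    then show ?thesis using False S by (simp add: avg_perms_apply)
  qed
  finally show "avg (perms (S - {i})) (\<lambda>q. f ((swap i b \<circ> q) i) (inv_into UNIV (swap i b \<circ> q) j))
    = (if b = j then f j i else avg (S - {i}) (f b))" .
qed

lemma avg_perms_swap_left_dist_le:
  fixes f :: "('a \<Rightarrow> 'a) \<Rightarrow> real"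
  assumes S: "finite S" and b: "b \<in> insert a S"
    and diff: "\<And>p i j. p permutes insert a S \<Longrightarrow> i \<in> insert a S \<Longrightarrow> j \<in> insert a S
      \<Longrightarrow> \<bar>f (p \<circ> swap i j) - f p\<bar> \<le> s"
  shows "\<bar>avg (perms S) (\<lambda>q. f (swap a b \<circ> q)) - avg (perms S) f\<bar> \<le> s"
proof -
  have "\<bar>f (swap a b \<circ> q) - f q\<bar> \<le> s" if "q permutes S" for q
  proof -
    have q: "q permutes insert a S" using that permutes_subset by blast
    have "inv_into UNIV q a \<in> insert a S" "inv_into UNIV q b \<in> insert a S"
      using b permutes_in_image[OF permutes_inv[OF q]] by auto
    then show ?thesis
      using diff[OF q] unfolding transpose_comp_eq[OF permutes_bij[OF q]] by blast
  qed
  then have "norm (avg (perms S) (\<lambda>q. f (swap a b \<circ> q) - f q)) \<le> s"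
    using S perms_nonempty by (intro norm_avg_le) (auto simp: finite_permutations)
  then show ?thesis by (simp add: avg_diff)
qed

text \<open>A martingale-free form of the bounded-difference inequality: the image of one point is exposed
  at a time, and each step is Hoeffding's lemma for the conditional averages.\<close>

lemma subgaussian_perms:
  fixes f :: "('a \<Rightarrow> 'a) \<Rightarrow> real"
  assumes "finite S"
    and "\<And>p i j. p permutes S \<Longrightarrow> i \<in> S \<Longrightarrow> j \<in> S \<Longrightarrow> \<bar>f (p \<circ> swap i j) - f p\<bar> \<le> s"
  shows "subgaussian (perms S) f (of_nat (card S) * s\<^sup>2)"
  using assms
proof (induction S arbitrary: f rule: finite_induct)
  case empty
  then show ?case by (simp add: subgaussian_singleton)
next
  case (insert a S)
  let ?P = "perms S"
  define h where "h b = avg ?P (\<lambda>q. f (swap a b \<circ> q))" for b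
  have fibre: "subgaussian ?P (\<lambda>q. f (swap a b \<circ> q)) (of_nat (card S) * s\<^sup>2)" if b: "b \<in> insert a S" for b
  proof (rule insert.IH)
    fix q i j assume q: "q permutes S" "i \<in> S" "j \<in> S"
    have "swap a b \<circ> q permutes insert a S"
      using b permutes_subset[OF q(1) subset_insertI] by (intro permutes_compose permutes_swap_id) auto
    then show "\<bar>f (swap a b \<circ> (q \<circ> swap i j)) - f (swap a b \<circ> q)\<bar> \<le> s"
      using insert.prems[of "swap a b \<circ> q" i j] q unfolding comp_assoc by blast
  qed
  have "h b \<in> {avg ?P f - s..avg ?P f + s}" if "b \<in> insert a S" for b
    using avg_perms_swap_left_dist_le[OF insert.hyps(1) that insert.prems, folded h_def] by (auto simp: abs_le_iff)
  then have "subgaussian (insert a S) h ((avg ?P f + s - (avg ?P f - s))\<^sup>2 / 4)"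
    using insert.hyps by (intro subgaussian_bounded) auto
  then have "subgaussian (insert a S) (\<lambda>b. avg ?P (\<lambda>q. f (swap a b \<circ> q))) (s\<^sup>2)"
    by (simp add: power2_eq_square flip: h_def)
  then have "subgaussian (insert a S \<times> ?P) (\<lambda>(b, q). f (swap a b \<circ> q)) (s\<^sup>2 + of_nat (card S) * s\<^sup>2)"
    by (intro subgaussian_Times) (use fibre in simp_all)
  then show ?case
    using insert.hyps
    by (simp add: subgaussian_reindex[OF bij_betw_perms_insert] case_prod_unfold algebra_simps)
qed

section \<open>Resolvents of Hermitian matrices\<close>

text \<open>Matrices are functions on indices below \<open>N\<close>, with junk values outside.\<close>

abbreviation vec_norm :: "nat \<Rightarrow> (nat \<Rightarrow> complex) \<Rightarrow> real" where
  "vec_norm N x \<equiv> L2_set (\<lambda>a. cmod (x a)) {..<N}"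

definition op_norm_le :: "nat \<Rightarrow> (nat \<Rightarrow> nat \<Rightarrow> complex) \<Rightarrow> real \<Rightarrow> bool" where
  "op_norm_le N A c \<longleftrightarrow> 0 \<le> c \<and> (\<forall>x. vec_norm N (\<lambda>a. \<Sum>b<N. A a b * x b) \<le> c * vec_norm N x)"

lemma op_norm_le_nonneg: "op_norm_le N A c \<Longrightarrow> 0 \<le> c"
  by (simp add: op_norm_le_def)

lemma op_norm_leD: "op_norm_le N A c \<Longrightarrow> vec_norm N (\<lambda>a. \<Sum>b<N. A a b * x b) \<le> c * vec_norm N x"
  by (simp add: op_norm_le_def)

lemma vec_norm_indicator:
  assumes "B \<subseteq> {..<N}"
  shows "vec_norm N (\<lambda>b. of_bool (b \<in> B)) = sqrt (real (card B))"
proof -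
  have "(\<Sum>b<N. (cmod (of_bool (b \<in> B)))\<^sup>2) = (\<Sum>b\<in>B. 1)"
    using assms by (intro sum.mono_neutral_cong_right) auto
  then show ?thesis by (simp add: L2_set_def)
qed

lemma sum_cmod_le_vec_norm:
  assumes "C \<subseteq> {..<N}"
  shows "(\<Sum>a\<in>C. cmod (x a)) \<le> sqrt (real (card C)) * vec_norm N x"
proof -
  have "(\<Sum>a\<in>C. cmod (x a)) = (\<Sum>a\<in>C. \<bar>1\<bar> * \<bar>cmod (x a)\<bar>)" by simp
  also have "\<dots> \<le> L2_set (\<lambda>_. 1) C * L2_set (\<lambda>a. cmod (x a)) C" by (rule L2_set_mult_ineq)
  also have "\<dots> \<le> sqrt (real (card C)) * vec_norm N x"
    using assms by (intro mult_mono) (auto simp: L2_set_def sum_nonneg intro!: sum_mono2)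
  finally show ?thesis .
qed

lemma op_norm_le_partial_rows:
  assumes A: "op_norm_le N A c" and B: "B \<subseteq> {..<N}"
  shows "vec_norm N (\<lambda>a. \<Sum>b\<in>B. A a b) \<le> c * sqrt (real (card B))"
proof -
  have "(\<Sum>b\<in>B. A a b) = (\<Sum>b<N. A a b * of_bool (b \<in> B))" for a
    using B by (intro sum.mono_neutral_cong_left) auto
  then show ?thesis
    using op_norm_leD[OF A, of "\<lambda>b. of_bool (b \<in> B)"] by (simp only: vec_norm_indicator[OF B])
qed

lemma op_norm_le_block_sum:
  assumes A: "op_norm_le N A c" and C: "C \<subseteq> {..<N}" and B: "B \<subseteq> {..<N}"
  shows "cmod (\<Sum>a\<in>C. \<Sum>b\<in>B. A a b) \<le> c * (sqrt (real (card C)) * sqrt (real (card B)))"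
proof -
  have "cmod (\<Sum>a\<in>C. \<Sum>b\<in>B. A a b) \<le> (\<Sum>a\<in>C. cmod (\<Sum>b\<in>B. A a b))" by (rule norm_sum)
  also have "\<dots> \<le> sqrt (real (card C)) * vec_norm N (\<lambda>a. \<Sum>b\<in>B. A a b)"
    by (rule sum_cmod_le_vec_norm[OF C])
  also have "\<dots> \<le> sqrt (real (card C)) * (c * sqrt (real (card B)))"
    by (intro mult_left_mono op_norm_le_partial_rows[OF A B]) simp
  finally show ?thesis by (simp add: mult_ac)
qed

lemma op_norm_le_entry:
  assumes "op_norm_le N A c" "a < N" "b < N"
  shows "cmod (A a b) \<le> c"
  using op_norm_le_block_sum[OF assms(1), of "{a}" "{b}"] assms by simp

lemma op_norm_le_column_sum:
  assumes A: "op_norm_le N A c" and b: "b < N"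
  shows "(\<Sum>a<N. cmod (A a b)) \<le> c * sqrt (real N)"
proof -
  have "(\<Sum>a<N. cmod (A a b)) \<le> sqrt (real N) * vec_norm N (\<lambda>a. A a b)"
    using sum_cmod_le_vec_norm[of "{..<N}" N] by simp
  also have "\<dots> \<le> sqrt (real N) * c"
    using op_norm_le_partial_rows[OF A, of "{b}"] b by (intro mult_left_mono) auto
  finally show ?thesis by (simp add: mult.commute)
qed

lemma op_norm_le_weighted_column_sum:
  assumes A: "op_norm_le N A c" and b: "b < N" and S: "S \<subseteq> {..<N}"
    and x: "\<And>a. a \<in> S \<Longrightarrow> cmod (x a) \<le> M" and M: "M \<ge> 0"
  shows "cmod (\<Sum>a\<in>S. x a * A a b) \<le> M * (c * sqrt (real N))"
proof -
  have "cmod (\<Sum>a\<in>S. x a * A a b) \<le> (\<Sum>a\<in>S. M * cmod (A a b))"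
    by (intro sum_norm_le) (auto simp: norm_mult intro: mult_right_mono x)
  also have "\<dots> \<le> (\<Sum>a<N. M * cmod (A a b))" using S M by (intro sum_mono2) auto
  also have "\<dots> \<le> M * (c * sqrt (real N))"
    unfolding sum_distrib_left[symmetric] by (intro mult_left_mono op_norm_le_column_sum[OF A b] M)
  finally show ?thesis .
qed

lemma op_norm_le_mult:
  assumes A: "op_norm_le N A c" and B: "op_norm_le N B c'"
  shows "op_norm_le N (\<lambda>a b. \<Sum>k<N. A a k * B k b) (c * c')"
  unfolding op_norm_le_def
proof (intro conjI allI)
  show "0 \<le> c * c'" using A B by (simp add: op_norm_le_nonneg)
  fix x
  have "(\<Sum>b<N. (\<Sum>k<N. A a k * B k b) * x b) = (\<Sum>k<N. A a k * (\<Sum>b<N. B k b * x b))" for a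
    by (simp add: sum_distrib_left sum_distrib_right mult.assoc) (rule sum.swap)
  then have "vec_norm N (\<lambda>a. \<Sum>b<N. (\<Sum>k<N. A a k * B k b) * x b) \<le> c * vec_norm N (\<lambda>k. \<Sum>b<N. B k b * x b)"
    by (simp add: op_norm_leD[OF A])
  also have "\<dots> \<le> c * (c' * vec_norm N x)"
    by (intro mult_left_mono op_norm_leD[OF B] op_norm_le_nonneg[OF A])
  finally show "vec_norm N (\<lambda>a. \<Sum>b<N. (\<Sum>k<N. A a k * B k b) * x b) \<le> c * c' * vec_norm N x"
    by (simp add: mult.assoc)
qed

lemma vec_norm_reindex:
  "inj_on f {..<m} \<Longrightarrow> vec_norm m (\<lambda>k. x (f k)) = L2_set (\<lambda>a. cmod (x a)) (f ` {..<m})"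
  by (simp add: L2_set_def sum.reindex)

lemma op_norm_le_submatrix:
  assumes A: "op_norm_le N A c"
    and f: "inj_on f {..<m}" "f ` {..<m} \<subseteq> {..<N}" and g: "inj_on g {..<m}" "g ` {..<m} \<subseteq> {..<N}"
  shows "op_norm_le m (\<lambda>k l. A (f k) (g l)) c"
  unfolding op_norm_le_def
proof (intro conjI allI)
  show "0 \<le> c" using A by (rule op_norm_le_nonneg)
  fix x :: "nat \<Rightarrow> complex"
  define x' where "x' b = (if b \<in> g ` {..<m} then x (inv_into {..<m} g b) else 0)" for b
  have x'_g: "x' (g l) = x l" if "l < m" for l
    using that g by (simp add: x'_def)
  have norm_x': "vec_norm N x' = vec_norm m x"
  proof -
    have "vec_norm N x' = L2_set (\<lambda>b. cmod (x' b)) (g ` {..<m})"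
      unfolding L2_set_def using g(2)
      by (intro arg_cong[of _ _ sqrt] sum.mono_neutral_right) (auto simp: x'_def)
    also have "\<dots> = vec_norm m (\<lambda>l. x' (g l))" by (rule vec_norm_reindex[OF g(1), symmetric])
    finally show ?thesis by (simp add: x'_g L2_set_def)
  qed
  have A_x': "(\<Sum>b<N. A a b * x' b) = (\<Sum>l<m. A a (g l) * x l)" for a
  proof -
    have "(\<Sum>b<N. A a b * x' b) = (\<Sum>b\<in>g ` {..<m}. A a b * x' b)"
      using g(2) by (intro sum.mono_neutral_right) (auto simp: x'_def)
    then show ?thesis using g(1) by (simp add: sum.reindex x'_g)
  qed
  have "vec_norm m (\<lambda>k. \<Sum>l<m. A (f k) (g l) * x l) = L2_set (\<lambda>a. cmod (\<Sum>b<N. A a b * x' b)) (f ` {..<m})"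
    unfolding A_x' by (rule vec_norm_reindex[OF f(1)])
  also have "\<dots> \<le> vec_norm N (\<lambda>a. \<Sum>b<N. A a b * x' b)"
    unfolding L2_set_def using f(2) by (intro real_sqrt_le_mono sum_mono2) auto
  also have "\<dots> \<le> c * vec_norm m x" using op_norm_leD[OF A, of x'] by (simp only: norm_x')
  finally show "vec_norm m (\<lambda>k. \<Sum>l<m. A (f k) (g l) * x l) \<le> c * vec_norm m x" .
qed

definition hermitian :: "nat \<Rightarrow> (nat \<Rightarrow> nat \<Rightarrow> complex) \<Rightarrow> bool" where
  "hermitian N H \<longleftrightarrow> (\<forall>a<N. \<forall>b<N. H a b = cnj (H b a))"

lemma hermitianD: "hermitian N H \<Longrightarrow> a < N \<Longrightarrow> b < N \<Longrightarrow> cnj (H a b) = H b a"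
  by (metis hermitian_def)

definition shifted :: "(nat \<Rightarrow> nat \<Rightarrow> complex) \<Rightarrow> complex \<Rightarrow> nat \<Rightarrow> nat \<Rightarrow> complex" where
  "shifted H \<xi> a b = (if a = b then \<xi> else 0) - H a b"

definition resolvent :: "nat \<Rightarrow> (nat \<Rightarrow> nat \<Rightarrow> complex) \<Rightarrow> complex \<Rightarrow> nat \<Rightarrow> nat \<Rightarrow> complex" where
  "resolvent N H \<xi> a b = the (mat_inverse (mat N N (\<lambda>(a, b). shifted H \<xi> a b))) $$ (a, b)"

lemma sum_shifted_left: "a < N \<Longrightarrow> (\<Sum>c<N. shifted H \<xi> a c * x c) = \<xi> * x a - (\<Sum>c<N. H a c * x c)"
  by (simp add: shifted_def left_diff_distrib sum_subtractf if_distrib[of "\<lambda>u. u * _"] cong: if_cong)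

lemma sum_shifted_right: "b < N \<Longrightarrow> (\<Sum>c<N. x c * shifted H \<xi> c b) = \<xi> * x b - (\<Sum>c<N. x c * H c b)"
  by (simp add: shifted_def right_diff_distrib sum_subtractf if_distrib[of "\<lambda>u. _ * u"] mult.commute cong: if_cong)

lemma hermitian_form_real:
  assumes "hermitian N H"
  shows "Im (\<Sum>a<N. \<Sum>c<N. cnj (x a) * H a c * x c) = 0"
proof -
  let ?s = "\<Sum>a<N. \<Sum>c<N. cnj (x a) * H a c * x c"
  have "cnj ?s = (\<Sum>a<N. \<Sum>c<N. cnj (x c) * H c a * x a)"
    by (simp add: hermitianD[OF assms] mult_ac)
  also have "\<dots> = ?s" by (rule sum.swap)
  finally have "Im (cnj ?s) = Im ?s" by (rule arg_cong)
  then show ?thesis unfolding cnj.simps(2) by linarith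
qed

lemma Im_shifted_form:
  assumes H: "hermitian N H" and y: "\<And>a. a < N \<Longrightarrow> (\<Sum>c<N. shifted H \<xi> a c * x c) = y a"
  shows "Im (\<Sum>a<N. cnj (x a) * y a) = Im \<xi> * (\<Sum>a<N. (cmod (x a))\<^sup>2)"
proof -
  have "cnj (x a) * y a = \<xi> * of_real ((cmod (x a))\<^sup>2) - (\<Sum>c<N. cnj (x a) * H a c * x c)" if "a < N" for a
  proof -
    have "cnj (x a) * y a = \<xi> * (x a * cnj (x a)) - (\<Sum>c<N. cnj (x a) * H a c * x c)"
      using y[OF that] sum_shifted_left[OF that, of H \<xi> x]
      by (simp add: right_diff_distrib sum_distrib_left mult_ac)
    then show ?thesis by (simp only: complex_norm_square)
  qed
  then have "(\<Sum>a<N. cnj (x a) * y a)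
      = \<xi> * of_real (\<Sum>a<N. (cmod (x a))\<^sup>2) - (\<Sum>a<N. \<Sum>c<N. cnj (x a) * H a c * x c)"
    by (simp add: sum_subtractf sum_distrib_left)
  then show ?thesis using hermitian_form_real[OF H, of x] by simp
qed

lemma vec_norm_le_shifted:
  assumes H: "hermitian N H" and y: "\<And>a. a < N \<Longrightarrow> (\<Sum>c<N. shifted H \<xi> a c * x c) = y a"
  shows "Im \<xi> * vec_norm N x \<le> vec_norm N y"
proof (cases "vec_norm N x = 0")
  case False
  have "Im \<xi> * (vec_norm N x)\<^sup>2 = Im (\<Sum>a<N. cnj (x a) * y a)"
    using Im_shifted_form[OF H y] by (simp only: L2_set_def real_sqrt_pow2 sum_nonneg zero_le_power2)
  also have "\<dots> \<le> cmod (\<Sum>a<N. cnj (x a) * y a)" using abs_Im_le_cmod abs_le_D1 by blast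
  also have "\<dots> \<le> (\<Sum>a<N. \<bar>cmod (x a)\<bar> * \<bar>cmod (y a)\<bar>)"
    by (rule order_trans[OF norm_sum]) (simp add: norm_mult)
  also have "\<dots> \<le> vec_norm N x * vec_norm N y" by (rule L2_set_mult_ineq)
  finally have "Im \<xi> * vec_norm N x * vec_norm N x \<le> vec_norm N y * vec_norm N x"
    by (simp add: power2_eq_square mult_ac)
  moreover have "vec_norm N x > 0"
    using False L2_set_nonneg[of "\<lambda>a. cmod (x a)" "{..<N}"] by linarith
  ultimately show ?thesis by (rule mult_right_le_imp_le)
qed (simp add: L2_set_nonneg)

lemma shifted_kernel_trivial:
  assumes H: "hermitian N H" and \<xi>: "Im \<xi> \<noteq> 0"
    and x: "\<And>a. a < N \<Longrightarrow> (\<Sum>c<N. shifted H \<xi> a c * x c) = 0" and a: "a < N"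
  shows "x a = 0"
proof -
  have "(\<Sum>a<N. (cmod (x a))\<^sup>2) = 0" using Im_shifted_form[OF H x] \<xi> by simp
  then show ?thesis using a by (subst (asm) sum_nonneg_eq_0_iff) auto
qed

lemma det_shifted_nonzero:
  assumes H: "hermitian N H" and \<xi>: "Im \<xi> \<noteq> 0"
  shows "Determinant.det (mat N N (\<lambda>(a, b). shifted H \<xi> a b)) \<noteq> 0" (is "Determinant.det ?M \<noteq> 0")
proof
  assume "Determinant.det ?M = 0"
  then obtain v where v: "v \<in> carrier_vec N" "v \<noteq> 0\<^sub>v N" "?M *\<^sub>v v = 0\<^sub>v N"
    using det_0_iff_vec_prod_zero[of ?M N] by auto
  have "(\<Sum>c<N. shifted H \<xi> a c * v $ c) = 0" if "a < N" for a
  proof -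
    have "(?M *\<^sub>v v) $ a = 0" using v that by simp
    then show ?thesis using that v(1) by (simp add: scalar_prod_def atLeast0LessThan)
  qed
  then have "v $ a = 0" if "a < N" for a
    using that by (rule shifted_kernel_trivial[OF H \<xi>, of "($) v"])
  then have "v = 0\<^sub>v N" using v(1) by auto
  with v(2) show False by simp
qed

lemma mat_inverse_shifted:
  assumes "hermitian N H" "Im \<xi> > 0"
  defines "M \<equiv> mat N N (\<lambda>(a, b). shifted H \<xi> a b)"
  shows "the (mat_inverse M) \<in> carrier_mat N N"
    and "M * the (mat_inverse M) = 1\<^sub>m N" and "the (mat_inverse M) * M = 1\<^sub>m N"
proof -
  have M: "M \<in> carrier_mat N N" by (simp add: M_def)
  have "mat_inverse M \<noteq> None"
    using mat_inverse(1)[OF M, where b = "()"] det_non_zero_imp_unit[OF M, where b = "()"]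
      det_shifted_nonzero[OF assms(1), of \<xi>] assms(2) by (auto simp: M_def)
  then show "the (mat_inverse M) \<in> carrier_mat N N"
    and "M * the (mat_inverse M) = 1\<^sub>m N" and "the (mat_inverse M) * M = 1\<^sub>m N"
    using mat_inverse(2)[OF M] by auto
qed

lemma
  assumes "hermitian N H" "Im \<xi> > 0" "a < N" "b < N"
  shows shifted_resolvent: "(\<Sum>c<N. shifted H \<xi> a c * resolvent N H \<xi> c b) = of_bool (a = b)"
    and resolvent_shifted: "(\<Sum>c<N. resolvent N H \<xi> a c * shifted H \<xi> c b) = of_bool (a = b)"
proof -
  let ?M = "mat N N (\<lambda>(a, b). shifted H \<xi> a b)"
  let ?R = "the (mat_inverse ?M)"
  note inv = mat_inverse_shifted[OF assms(1,2)]
  have "(?M * ?R) $$ (a, b) = (\<Sum>c<N. shifted H \<xi> a c * resolvent N H \<xi> c b)"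
    and "(?R * ?M) $$ (a, b) = (\<Sum>c<N. resolvent N H \<xi> a c * shifted H \<xi> c b)"
    using inv(1) assms by (auto simp: scalar_prod_def resolvent_def atLeast0LessThan)
  then show "(\<Sum>c<N. shifted H \<xi> a c * resolvent N H \<xi> c b) = of_bool (a = b)"
    and "(\<Sum>c<N. resolvent N H \<xi> a c * shifted H \<xi> c b) = of_bool (a = b)"
    unfolding inv(2,3) using assms by auto
qed

lemma inverse_difference:
  fixes R R' M M' :: "nat \<Rightarrow> nat \<Rightarrow> complex"
  assumes R: "\<And>a b. a < N \<Longrightarrow> b < N \<Longrightarrow> (\<Sum>c<N. R a c * M c b) = of_bool (a = b)"
    and R': "\<And>a b. a < N \<Longrightarrow> b < N \<Longrightarrow> (\<Sum>c<N. M' a c * R' c b) = of_bool (a = b)"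
    and ab: "a < N" "b < N"
  shows "R a b - R' a b = (\<Sum>c<N. \<Sum>e<N. R a c * (M' c e - M c e) * R' e b)"
proof -
  have "(\<Sum>c<N. \<Sum>e<N. R a c * M' c e * R' e b) = (\<Sum>c<N. R a c * of_bool (c = b))"
    using R' ab by (intro sum.cong) (auto simp flip: sum_distrib_left simp: mult.assoc)
  moreover have "(\<Sum>c<N. \<Sum>e<N. R a c * M c e * R' e b) = (\<Sum>e<N. of_bool (a = e) * R' e b)"
    using R ab by (subst sum.swap, intro sum.cong) (auto simp flip: sum_distrib_right)
  moreover have "(\<Sum>c<N. \<Sum>e<N. R a c * (M' c e - M c e) * R' e b)
      = (\<Sum>c<N. \<Sum>e<N. R a c * M' c e * R' e b) - (\<Sum>c<N. \<Sum>e<N. R a c * M c e * R' e b)"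
    by (simp add: algebra_simps sum_subtractf)
  ultimately show ?thesis using ab by simp
qed

lemma resolvent_eqI:
  assumes "hermitian N H" "Im \<xi> > 0" "a < N" "b < N"
    and "\<And>a b. a < N \<Longrightarrow> b < N \<Longrightarrow> (\<Sum>c<N. Q a c * shifted H \<xi> c b) = of_bool (a = b)"
  shows "Q a b = resolvent N H \<xi> a b"
  using inverse_difference[of N Q "shifted H \<xi>" "shifted H \<xi>" "resolvent N H \<xi>"] assms shifted_resolvent by simp

lemma resolvent_difference:
  assumes "hermitian N H" "Im \<xi> > 0" "hermitian N H'" "Im \<xi>' > 0" "a < N" "b < N"
  shows "resolvent N H \<xi> a b - resolvent N H' \<xi>' a b
    = (\<Sum>c<N. \<Sum>e<N. resolvent N H \<xi> a c * (shifted H' \<xi>' c e - shifted H \<xi> c e) * resolvent N H' \<xi>' e b)"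
  by (rule inverse_difference) (use assms resolvent_shifted shifted_resolvent in auto)

lemma op_norm_le_resolvent:
  assumes H: "hermitian N H" and \<xi>: "Im \<xi> > 0"
  shows "op_norm_le N (resolvent N H \<xi>) (1 / Im \<xi>)"
  unfolding op_norm_le_def
proof (intro conjI allI)
  show "0 \<le> 1 / Im \<xi>" using \<xi> by simp
  fix y :: "nat \<Rightarrow> complex"
  let ?x = "\<lambda>a. \<Sum>b<N. resolvent N H \<xi> a b * y b"
  have "(\<Sum>c<N. shifted H \<xi> a c * ?x c) = y a" if a: "a < N" for a
  proof -
    have "(\<Sum>c<N. shifted H \<xi> a c * ?x c) = (\<Sum>b<N. (\<Sum>c<N. shifted H \<xi> a c * resolvent N H \<xi> c b) * y b)"
      by (simp add: sum_distrib_left sum_distrib_right mult.assoc) (rule sum.swap)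
    also have "\<dots> = (\<Sum>b<N. of_bool (a = b) * y b)"
      using shifted_resolvent[OF assms a] by (intro sum.cong) auto
    finally show ?thesis using a by simp
  qed
  from vec_norm_le_shifted[OF H this] show "vec_norm N ?x \<le> 1 / Im \<xi> * vec_norm N y"
    using \<xi> by (simp add: field_simps)
qed

lemma Im_resolvent_diag_nonpos:
  assumes "hermitian N H" "Im \<xi> > 0" "a < N"
  shows "Im (resolvent N H \<xi> a a) \<le> 0"
proof -
  have "Im (\<Sum>b<N. cnj (resolvent N H \<xi> b a) * of_bool (b = a)) = Im \<xi> * (\<Sum>b<N. (cmod (resolvent N H \<xi> b a))\<^sup>2)"
    by (rule Im_shifted_form[OF assms(1) shifted_resolvent[OF assms(1,2) _ assms(3)]])
  moreover have "0 \<le> Im \<xi> * (\<Sum>b<N. (cmod (resolvent N H \<xi> b a))\<^sup>2)" using assms by (simp add: sum_nonneg)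
  ultimately show ?thesis using assms by simp
qed

lemma resolvent_lipschitz:
  assumes H: "hermitian N H" and \<xi>: "Im \<xi> > 0" "Im \<xi>' > 0" and ab: "a < N" "b < N"
  shows "cmod (resolvent N H \<xi> a b - resolvent N H \<xi>' a b) \<le> cmod (\<xi> - \<xi>') / (Im \<xi> * Im \<xi>')"
proof -
  have "resolvent N H \<xi> a b - resolvent N H \<xi>' a b
      = (\<Sum>c<N. \<Sum>e<N. if c = e then (\<xi>' - \<xi>) * (resolvent N H \<xi> a c * resolvent N H \<xi>' c b) else 0)"
    unfolding resolvent_difference[OF H \<xi>(1) H \<xi>(2) ab]
    by (intro sum.cong) (auto simp: shifted_def algebra_simps)
  also have "\<dots> = (\<xi>' - \<xi>) * (\<Sum>c<N. resolvent N H \<xi> a c * resolvent N H \<xi>' c b)"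
    by (simp add: sum_distrib_left)
  also have "cmod \<dots> \<le> cmod (\<xi> - \<xi>') * (1 / Im \<xi> * (1 / Im \<xi>'))"
    unfolding norm_mult using H \<xi> ab
    by (intro mult_mono op_norm_le_entry[OF op_norm_le_mult[OF op_norm_le_resolvent op_norm_le_resolvent]])
       (auto simp: norm_minus_commute)
  finally show ?thesis by simp
qed

subsection \<open>Perturbation by involution matrices\<close>

definition involutive_on :: "'a set \<Rightarrow> ('a \<Rightarrow> 'a) \<Rightarrow> bool" where
  "involutive_on A \<sigma> \<longleftrightarrow> (\<forall>a\<in>A. \<sigma> a \<in> A \<and> \<sigma> (\<sigma> a) = a)"

lemma bij_betw_involutive_on: "involutive_on A \<sigma> \<Longrightarrow> bij_betw \<sigma> A A"
  by (rule bij_betwI[where g = \<sigma>]) (auto simp: involutive_on_def)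

lemma op_norm_le_permute_columns:
  assumes "op_norm_le N A c" "involutive_on {..<N} \<sigma>"
  shows "op_norm_le N (\<lambda>a b. A a (\<sigma> b)) c"
  using bij_betw_involutive_on[OF assms(2)]
  by (intro op_norm_le_submatrix[OF assms(1), where f = "\<lambda>k. k"]) (auto simp: bij_betw_def)

context
  fixes N :: nat and H H' :: "nat \<Rightarrow> nat \<Rightarrow> complex" and \<sigma> :: "nat \<Rightarrow> nat" and r :: real and \<xi> :: complex
  assumes H: "hermitian N H" and H': "hermitian N H'" and \<xi>: "Im \<xi> > 0"
    and \<sigma>: "involutive_on {..<N} \<sigma>"
    and H'_eq: "\<And>a b. a < N \<Longrightarrow> b < N \<Longrightarrow> H' a b = H a b - of_real r * of_bool (\<sigma> a = b)"
begin

lemma resolvent_perturb_eq: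
  assumes ab: "a < N" "b < N"
  shows "resolvent N H' \<xi> a b
    = resolvent N H \<xi> a b - r * (\<Sum>c<N. resolvent N H \<xi> a (\<sigma> c) * resolvent N H' \<xi> c b)"
proof -
  let ?R = "resolvent N H \<xi>" and ?R' = "resolvent N H' \<xi>"
  have "?R a b - ?R' a b = (\<Sum>c<N. \<Sum>e<N. ?R a c * (shifted H' \<xi> c e - shifted H \<xi> c e) * ?R' e b)"
    by (rule resolvent_difference[OF H \<xi> H' \<xi> ab])
  also have "\<dots> = (\<Sum>c<N. \<Sum>e<N. if e = \<sigma> c then r * (?R a c * ?R' (\<sigma> c) b) else 0)"
    by (intro sum.cong) (auto simp: shifted_def H'_eq)
  also have "\<dots> = r * (\<Sum>c<N. ?R a c * ?R' (\<sigma> c) b)"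
    using \<sigma> by (auto simp: involutive_on_def sum_distrib_left intro!: sum.cong)
  also have "(\<Sum>c<N. ?R a c * ?R' (\<sigma> c) b) = (\<Sum>c<N. ?R a (\<sigma> c) * ?R' c b)"
    using \<sigma> by (subst sum.reindex_bij_betw[OF bij_betw_involutive_on[OF \<sigma>], symmetric])
      (auto simp: involutive_on_def intro!: sum.cong)
  finally show ?thesis by (simp add: algebra_simps)
qed

lemma op_norm_le_permuted_resolvent: "op_norm_le N (\<lambda>a b. resolvent N H \<xi> a (\<sigma> b)) (1 / Im \<xi>)"
  by (rule op_norm_le_permute_columns[OF op_norm_le_resolvent[OF H \<xi>] \<sigma>])

lemma resolvent_perturb_dist:
  assumes "a < N" "b < N"
  shows "cmod (resolvent N H' \<xi> a b - resolvent N H \<xi> a b) \<le> \<bar>r\<bar> / (Im \<xi>)\<^sup>2"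
proof -
  have "cmod (\<Sum>c<N. resolvent N H \<xi> a (\<sigma> c) * resolvent N H' \<xi> c b) \<le> 1 / Im \<xi> * (1 / Im \<xi>)"
    by (rule op_norm_le_entry[OF op_norm_le_mult[OF op_norm_le_permuted_resolvent
            op_norm_le_resolvent[OF H' \<xi>]] assms])
  then have "\<bar>r\<bar> * cmod (\<Sum>c<N. resolvent N H \<xi> a (\<sigma> c) * resolvent N H' \<xi> c b) \<le> \<bar>r\<bar> * (1 / Im \<xi> * (1 / Im \<xi>))"
    by (rule mult_left_mono) simp
  then show ?thesis by (simp add: resolvent_perturb_eq[OF assms] norm_mult power2_eq_square)
qed

lemma resolvent_perturb_second_order:
  assumes ab: "a < N" "b < N"
  shows "cmod (resolvent N H' \<xi> a b
      - (resolvent N H \<xi> a b - r * (\<Sum>c<N. resolvent N H \<xi> a (\<sigma> c) * resolvent N H \<xi> c b))) \<le> r\<^sup>2 / (Im \<xi>)^3"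
proof -
  let ?R = "resolvent N H \<xi>" and ?R' = "resolvent N H' \<xi>"
  let ?rem = "\<Sum>c<N. ?R a (\<sigma> c) * (\<Sum>e<N. ?R c (\<sigma> e) * ?R' e b)"
  have "(\<Sum>c<N. ?R a (\<sigma> c) * ?R' c b) = (\<Sum>c<N. ?R a (\<sigma> c) * (?R c b - r * (\<Sum>e<N. ?R c (\<sigma> e) * ?R' e b)))"
    using ab by (intro sum.cong refl arg_cong2[of _ _ _ _ "(*)"] resolvent_perturb_eq) auto
  also have "\<dots> = (\<Sum>c<N. ?R a (\<sigma> c) * ?R c b) - r * ?rem"
    by (simp add: right_diff_distrib sum_subtractf sum_distrib_left mult_ac)
  finally have expand: "(\<Sum>c<N. ?R a (\<sigma> c) * ?R' c b) = (\<Sum>c<N. ?R a (\<sigma> c) * ?R c b) - r * ?rem" .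
  have "?R' a b - (?R a b - r * (\<Sum>c<N. ?R a (\<sigma> c) * ?R c b)) = r\<^sup>2 * ?rem"
    unfolding resolvent_perturb_eq[OF ab] expand by (simp add: algebra_simps power2_eq_square)
  then have "cmod (?R' a b - (?R a b - r * (\<Sum>c<N. ?R a (\<sigma> c) * ?R c b))) = r\<^sup>2 * cmod ?rem"
    by (simp add: norm_mult norm_power)
  also have "cmod ?rem \<le> 1 / Im \<xi> * (1 / Im \<xi> * (1 / Im \<xi>))"
    by (rule op_norm_le_entry[OF op_norm_le_mult[OF op_norm_le_permuted_resolvent
          op_norm_le_mult[OF op_norm_le_permuted_resolvent op_norm_le_resolvent[OF H' \<xi>]]] ab])
  finally show ?thesis by (simp add: power3_eq_cube mult_left_mono)
qed

end

lemma resolvent_trace_difference: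
  assumes "hermitian N H" "hermitian N H'" "Im \<xi> > 0"
  shows "(\<Sum>a<N. resolvent N H \<xi> a a) - (\<Sum>a<N. resolvent N H' \<xi> a a)
    = (\<Sum>c<N. \<Sum>e<N. (H c e - H' c e) * (\<Sum>a<N. resolvent N H' \<xi> e a * resolvent N H \<xi> a c))"
proof -
  let ?R = "resolvent N H \<xi>" and ?R' = "resolvent N H' \<xi>"
  have "(\<Sum>a<N. ?R a a) - (\<Sum>a<N. ?R' a a) = (\<Sum>a<N. \<Sum>c<N. \<Sum>e<N. ?R a c * (H c e - H' c e) * ?R' e a)"
    unfolding sum_subtractf[symmetric]
    by (intro sum.cong refl, subst resolvent_difference) (use assms in \<open>auto simp: shifted_def\<close>)
  also have "\<dots> = (\<Sum>c<N. \<Sum>a<N. \<Sum>e<N. ?R a c * (H c e - H' c e) * ?R' e a)" by (rule sum.swap)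
  also have "\<dots> = (\<Sum>c<N. \<Sum>e<N. \<Sum>a<N. ?R a c * (H c e - H' c e) * ?R' e a)"
    by (intro sum.cong refl sum.swap)
  finally show ?thesis by (simp add: sum_distrib_left mult_ac)
qed

lemma resolvent_trace_perturb:
  assumes H: "hermitian N H" "hermitian N H'" and \<xi>: "Im \<xi> > 0"
    and maps: "\<sigma> \<in> {..<N} \<rightarrow> {..<N}" "\<sigma>' \<in> {..<N} \<rightarrow> {..<N}"
    and D: "D \<subseteq> {..<N}" "\<And>a. a < N \<Longrightarrow> a \<notin> D \<Longrightarrow> \<sigma>' a = \<sigma> a"
    and diff: "\<And>a b. a < N \<Longrightarrow> b < N \<Longrightarrow>
      H a b - H' a b = of_real r * (of_bool (\<sigma>' a = b) - of_bool (\<sigma> a = b))"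
  shows "cmod ((\<Sum>a<N. resolvent N H \<xi> a a) - (\<Sum>a<N. resolvent N H' \<xi> a a)) \<le> card D * (2 * \<bar>r\<bar> / (Im \<xi>)\<^sup>2)"
proof -
  define C where "C e c = (\<Sum>a<N. resolvent N H' \<xi> e a * resolvent N H \<xi> a c)" for e c
  have C_le: "cmod (C e c) \<le> 1 / (Im \<xi>)\<^sup>2" if "e < N" "c < N" for e c
    using op_norm_le_entry[OF op_norm_le_mult[OF op_norm_le_resolvent[OF H(2) \<xi>]
          op_norm_le_resolvent[OF H(1) \<xi>]] that]
    by (simp add: C_def power2_eq_square)
  have row: "(\<Sum>e<N. (H c e - H' c e) * C e c) = r * (C (\<sigma>' c) c - C (\<sigma> c) c)" if c: "c < N" for c
  proof -
    have "(\<Sum>e<N. (H c e - H' c e) * C e c)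
        = r * ((\<Sum>e<N. of_bool (\<sigma>' c = e) * C e c) - (\<Sum>e<N. of_bool (\<sigma> c = e) * C e c))"
      unfolding sum_subtractf[symmetric] sum_distrib_left using c by (simp add: diff mult.assoc left_diff_distrib)
    moreover have "\<sigma> c < N" "\<sigma>' c < N" using maps c by auto
    ultimately show ?thesis by simp
  qed
  have "(\<Sum>a<N. resolvent N H \<xi> a a) - (\<Sum>a<N. resolvent N H' \<xi> a a)
      = (\<Sum>c<N. r * (C (\<sigma>' c) c - C (\<sigma> c) c))"
    unfolding resolvent_trace_difference[OF H \<xi>] C_def[symmetric] by (simp add: row)
  also have "\<dots> = (\<Sum>c\<in>D. r * (C (\<sigma>' c) c - C (\<sigma> c) c))"
    using D by (intro sum.mono_neutral_right) auto
  also have "cmod \<dots> \<le> (\<Sum>c\<in>D. \<bar>r\<bar> * (1 / (Im \<xi>)\<^sup>2 + 1 / (Im \<xi>)\<^sup>2))"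
  proof (rule sum_norm_le)
    fix c assume "c \<in> D"
    then have "c < N" "\<sigma> c < N" "\<sigma>' c < N" using D(1) maps by auto
    then have "cmod (C (\<sigma>' c) c - C (\<sigma> c) c) \<le> 1 / (Im \<xi>)\<^sup>2 + 1 / (Im \<xi>)\<^sup>2"
      by (intro order_trans[OF norm_triangle_ineq4] add_mono C_le)
    then show "cmod (r * (C (\<sigma>' c) c - C (\<sigma> c) c)) \<le> \<bar>r\<bar> * (1 / (Im \<xi>)\<^sup>2 + 1 / (Im \<xi>)\<^sup>2)"
      by (simp only: norm_mult norm_of_real) (rule mult_left_mono, auto)
  qed
  finally show ?thesis by (simp add: mult_ac)
qed

subsection \<open>Chiral matrices\<close>

definition chiral :: "nat \<Rightarrow> (nat \<Rightarrow> nat \<Rightarrow> complex) \<Rightarrow> bool" where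
  "chiral n H \<longleftrightarrow> (\<forall>a<2*n. \<forall>b<2*n. (a < n \<longleftrightarrow> b < n) \<longrightarrow> H a b = 0)"

lemma chiralD: "chiral n H \<Longrightarrow> a < 2*n \<Longrightarrow> b < 2*n \<Longrightarrow> a < n \<longleftrightarrow> b < n \<Longrightarrow> H a b = 0"
  by (simp add: chiral_def)

lemma sum_lessThan_double: "(\<Sum>a<2*n. f a) = (\<Sum>i<n. f i) + (\<Sum>i<n. f (n + i))" for n :: nat
proof -
  have "(\<Sum>a<2*n. f a) = (\<Sum>a<n. f a) + (\<Sum>a=n..<2*n. f a)"
    by (metis atLeast0LessThan le_add1 mult_2 sum.atLeastLessThan_concat zero_le)
  also have "(\<Sum>a=n..<2*n. f a) = (\<Sum>i<n. f (n + i))"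
    using sum.shift_bounds_nat_ivl[of f 0 n n] by (simp add: atLeast0LessThan mult_2 add.commute)
  finally show ?thesis .
qed

lemma resolvent_block_traces_eq:
  assumes H: "hermitian (2*n) H" "chiral n H" and \<xi>: "Im \<xi> > 0"
  shows "(\<Sum>i<n. resolvent (2*n) H \<xi> (n+i) (n+i)) = (\<Sum>i<n. resolvent (2*n) H \<xi> i i)"
proof -
  let ?R = "resolvent (2*n) H \<xi>"
  have upper: "\<xi> * ?R i i = 1 + (\<Sum>j<n. H i (n+j) * ?R (n+j) i)" if "i < n" for i
    using trans[OF sum_shifted_left[of i "2*n" H \<xi> "\<lambda>c. ?R c i", symmetric] shifted_resolvent[OF H(1) \<xi>, of i i]]
      that chiralD[OF H(2)] by (simp add: sum_lessThan_double diff_eq_eq)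
  have lower: "\<xi> * ?R (n+j) (n+j) = 1 + (\<Sum>i<n. ?R (n+j) i * H i (n+j))" if "j < n" for j
    using trans[OF sum_shifted_right[of "n+j" "2*n" "?R (n+j)" H \<xi>, symmetric]
        resolvent_shifted[OF H(1) \<xi>, of "n+j" "n+j"]]
      that chiralD[OF H(2)] by (simp add: sum_lessThan_double diff_eq_eq)
  have "\<xi> * (\<Sum>j<n. ?R (n+j) (n+j)) = of_nat n + (\<Sum>j<n. \<Sum>i<n. ?R (n+j) i * H i (n+j))"
    by (simp add: sum_distrib_left lower sum.distrib)
  also have "\<dots> = of_nat n + (\<Sum>i<n. \<Sum>j<n. H i (n+j) * ?R (n+j) i)" by (subst sum.swap) (simp add: mult.commute)
  also have "\<dots> = \<xi> * (\<Sum>i<n. ?R i i)" by (simp add: sum_distrib_left upper sum.distrib)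
  finally show ?thesis using \<xi> by auto
qed

text \<open>Conjugation by the signature \<open>diag(1, -1)\<close> turns \<open>H\<close> into \<open>-H\<close>, hence the resolvent at \<open>\<i>\<eta>\<close>
  into minus its own adjoint.\<close>

lemma Re_resolvent_diag:
  assumes H: "hermitian (2*n) H" "chiral n H" and \<eta>: "\<eta> > 0" and a: "a < 2*n"
  shows "Re (resolvent (2*n) H (\<i> * of_real \<eta>) a a) = 0"
proof -
  let ?\<xi> = "\<i> * complex_of_real \<eta>"
  let ?R = "resolvent (2*n) H ?\<xi>"
  have \<xi>: "Im ?\<xi> > 0" using \<eta> by simp
  define s :: "nat \<Rightarrow> complex" where "s a = (if a < n then 1 else -1)" for a
  have s_s: "s a * s a = 1" "cnj (s a) = s a" for a by (auto simp: s_def)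
  define Q where "Q a b = - s a * s b * cnj (?R b a)" for a b
  have entry: "Q a c * shifted H ?\<xi> c b = cnj (s a * s b * (shifted H ?\<xi> b c * ?R c a))"
    if bc: "b < 2*n" "c < 2*n" for a b c
  proof -
    have "s b * H b c = - s c * H b c"
      using chiralD[OF H(2) bc] by (auto simp: s_def)
    then have "- s c * cnj (shifted H ?\<xi> c b) = s b * shifted H ?\<xi> b c"
      using hermitianD[OF H(1) bc(2,1)] by (auto simp: shifted_def algebra_simps)
    then have "s a * (- s c * cnj (shifted H ?\<xi> c b)) * ?R c a = s a * (s b * shifted H ?\<xi> b c) * ?R c a" by simp
    then have "cnj (s a * (- s c * cnj (shifted H ?\<xi> c b)) * ?R c a) = cnj (s a * (s b * shifted H ?\<xi> b c) * ?R c a)"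
      by (rule arg_cong)
    then show ?thesis by (simp add: Q_def s_s mult_ac)
  qed
  have "(\<Sum>c<2*n. Q a c * shifted H ?\<xi> c b) = of_bool (a = b)" if ab: "a < 2*n" "b < 2*n" for a b
  proof -
    have "(\<Sum>c<2*n. Q a c * shifted H ?\<xi> c b) = cnj (s a * s b * (\<Sum>c<2*n. shifted H ?\<xi> b c * ?R c a))"
      using entry[OF ab(2)] by (simp only: cnj_sum sum_distrib_left) (intro sum.cong, auto)
    also have "\<dots> = cnj (s a * s b * of_bool (b = a))"
      by (simp only: shifted_resolvent[OF H(1) \<xi> ab(2,1)])
    finally show ?thesis by (auto simp: s_s)
  qed
  from resolvent_eqI[OF H(1) \<xi> a a this] have "?R a a = - cnj (?R a a)"
    by (simp add: Q_def s_s)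
  then have "Re (?R a a) = Re (- cnj (?R a a))" by (rule arg_cong)
  then show ?thesis by simp
qed

section \<open>The self-consistent cubic\<close>

definition self_consistent :: "complex \<Rightarrow> complex \<Rightarrow> complex \<Rightarrow> complex" where
  "self_consistent z \<xi> m = m * (\<xi> - m)\<^sup>2 + m * (1 - complex_of_real ((cmod z)\<^sup>2)) - \<xi>"

definition cubic :: "real \<Rightarrow> real \<Rightarrow> real \<Rightarrow> real" where
  "cubic a \<eta> x = x * (\<eta> + x)\<^sup>2 - a * x - \<eta>"

definition cubic_root :: "real \<Rightarrow> real \<Rightarrow> real" where
  "cubic_root a \<eta> = (SOME x. x > 0 \<and> cubic a \<eta> x = 0)"

lemma self_consistent_imaginary:
  "self_consistent z (\<i> * of_real \<eta>) (- (\<i> * of_real h)) = \<i> * of_real (cubic (1 - (cmod z)\<^sup>2) \<eta> h)"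
  by (simp add: self_consistent_def cubic_def complex_eq_iff power2_eq_square algebra_simps)

lemma cubic_root:
  assumes \<eta>: "\<eta> > 0"
  shows "cubic_root a \<eta> > 0" "cubic a \<eta> (cubic_root a \<eta>) = 0"
proof -
  define M where "M = 1 + \<bar>a\<bar> + \<eta>"
  have M: "M \<ge> 1" "M \<ge> 1 + a" "M \<ge> \<eta> + 1" using \<eta> by (auto simp: M_def)
  have "M \<le> M * M" using M(1) by (simp add: mult_le_cancel_left1)
  also have "\<dots> \<le> (\<eta> + M)\<^sup>2" using M \<eta> unfolding power2_eq_square by (intro mult_mono) auto
  finally have "1 \<le> (\<eta> + M)\<^sup>2 - a" using M by linarith
  then have "M * 1 \<le> M * ((\<eta> + M)\<^sup>2 - a)" using M(1) by (intro mult_left_mono) auto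
  then have "cubic a \<eta> M \<ge> 0" using M(3) by (simp add: cubic_def algebra_simps)
  moreover have "cubic a \<eta> 0 \<le> 0" using \<eta> by (simp add: cubic_def)
  moreover have "continuous_on {0..M} (cubic a \<eta>)"
    unfolding cubic_def by (intro continuous_intros)
  ultimately obtain x where x: "0 \<le> x" "cubic a \<eta> x = 0"
    using IVT'[of "cubic a \<eta>" 0 0 M] M(1) by auto
  moreover have "x \<noteq> 0" using x(2) \<eta> by (auto simp: cubic_def)
  ultimately have "\<exists>x. x > 0 \<and> cubic a \<eta> x = 0" by (intro exI[of _ x]) auto
  from someI_ex[OF this] show "cubic_root a \<eta> > 0" "cubic a \<eta> (cubic_root a \<eta>) = 0"
    by (simp_all add: cubic_root_def)
qed

lemma cubic_factor:
  assumes "h > 0" "cubic a \<eta> h = 0"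
  shows "cubic a \<eta> x = (x - h) * (x * (2 * \<eta> + x + h) + \<eta> / h)"
proof -
  have "a * h = h * (\<eta> + h)\<^sup>2 - \<eta>" using assms by (simp add: cubic_def)
  then have a: "a = (\<eta> + h)\<^sup>2 - \<eta> / h" using assms by (simp add: field_simps)
  show ?thesis using assms(1) unfolding cubic_def a
    by (simp add: field_simps power2_eq_square)
qed

lemma
  fixes a :: real
  assumes \<eta>: "\<eta> > 0" and x: "x \<ge> 0"
  defines "h \<equiv> cubic_root a \<eta>"
  shows dist_cubic_root_mult_square_le: "\<bar>x - h\<bar> * x\<^sup>2 \<le> \<bar>cubic a \<eta> x\<bar>"
    and dist_cubic_root_mult_ratio_le: "\<bar>x - h\<bar> * (\<eta> / h) \<le> \<bar>cubic a \<eta> x\<bar>"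
proof -
  have h: "h > 0" "cubic a \<eta> h = 0" unfolding h_def by (rule cubic_root[OF \<eta>])+
  have "0 \<le> x * (2 * \<eta> + h)" "0 \<le> \<eta> / h" "0 \<le> x\<^sup>2" using \<eta> x h(1) by auto
  moreover have "x * (2 * \<eta> + x + h) + \<eta> / h = x\<^sup>2 + x * (2 * \<eta> + h) + \<eta> / h"
    by (simp add: power2_eq_square algebra_simps)
  ultimately have "x\<^sup>2 \<le> \<bar>x * (2 * \<eta> + x + h) + \<eta> / h\<bar>" "\<eta> / h \<le> \<bar>x * (2 * \<eta> + x + h) + \<eta> / h\<bar>"
    by linarith+
  then show "\<bar>x - h\<bar> * x\<^sup>2 \<le> \<bar>cubic a \<eta> x\<bar>" "\<bar>x - h\<bar> * (\<eta> / h) \<le> \<bar>cubic a \<eta> x\<bar>"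
    unfolding cubic_factor[OF h] abs_mult by (simp_all only: mult_left_mono abs_ge_zero)
qed

lemma cubic_root_unique:
  assumes "\<eta> > 0" "x \<ge> 0" "cubic a \<eta> x = 0"
  shows "x = cubic_root a \<eta>"
  using dist_cubic_root_mult_ratio_le[OF assms(1,2), of a] cubic_root(1)[OF assms(1), of a] assms
  by (simp add: divide_le_0_iff mult_le_0_iff)

lemma cubic_at_threshold_le:
  assumes "0 \<le> s" "s \<le> 1" "0 < \<epsilon>" "\<epsilon> \<le> 1" "\<epsilon> \<le> a"
  shows "cubic a s (\<epsilon> / 4) \<le> - (3 / 16 * \<epsilon>\<^sup>2)"
proof -
  define t where "t = \<epsilon> / 4"
  have t: "0 < t" "t \<le> 1 / 4" "\<epsilon> = 4 * t" using assms by (auto simp: t_def)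
  have "s * s \<le> s" using assms by (simp add: mult_left_le)
  then have ts2: "t * (s * s) \<le> s / 4" using t mult_mono[of t "1/4" "s * s" s] assms by simp
  have "t * t \<le> 1 / 16" using mult_mono[of t "1/4" t "1/4"] t by simp
  then have st2: "2 * s * (t * t) \<le> s / 8" using mult_left_mono[of "t * t" "1/16" "2 * s"] assms by simp
  have t3: "t * (t * t) \<le> t * t / 4" using mult_right_mono[of t "1/4" "t * t"] t by simp
  have at: "t * (4 * t) \<le> a * t" using assms t by (simp add: mult.commute mult_right_mono)
  have "cubic a s t = t * (s * s) + 2 * s * (t * t) + t * (t * t) - a * t - s"
    by (simp add: cubic_def power2_eq_square algebra_simps)
  also have "\<dots> \<le> - (3 * (t * t))"
    using ts2 st2 t3 at assms(1) zero_le_square[of t] by linarith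
  finally show ?thesis by (simp add: t_def power2_eq_square)
qed

lemma cubic_at_one_le:
  assumes "0 \<le> x" "x \<le> 1 / 4" "0 \<le> a"
  shows "cubic a 1 x \<le> - 1 / 2"
proof -
  have "x * (1 + x)\<^sup>2 \<le> 1 / 4 * (1 + 1 / 4)\<^sup>2"
    using assms by (intro mult_mono power_mono) auto
  moreover have "0 \<le> a * x" using assms by simp
  ultimately show ?thesis by (simp add: cubic_def power2_eq_square)
qed

text \<open>Near \<open>\<eta> = 0\<close> the perturbed cubic could also have a solution close to \<open>0\<close>; continuity in \<open>\<eta>\<close>,
  starting from \<open>\<eta> = 1\<close> where there is no such solution, rules it out.\<close>

lemma approx_cubic_root_gt_threshold:
  fixes x e :: "real \<Rightarrow> real"
  assumes \<eta>: "0 < \<eta>" "\<eta> \<le> 1" and \<epsilon>: "0 < \<epsilon>" "\<epsilon> \<le> 1" "\<epsilon> \<le> a"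
    and cont: "continuous_on {\<eta>..1} x" and nonneg: "\<And>s. s \<in> {\<eta>..1} \<Longrightarrow> x s \<ge> 0"
    and approx: "\<And>s. s \<in> {\<eta>..1} \<Longrightarrow> \<bar>cubic a s (x s)\<bar> \<le> e s * (s + x s + 1)"
    and small: "\<And>s. s \<in> {\<eta>..1} \<Longrightarrow> 0 \<le> e s \<and> e s < \<epsilon>\<^sup>2 / 32"
  shows "x \<eta> > \<epsilon> / 4"
proof (rule ccontr)
  assume low: "\<not> x \<eta> > \<epsilon> / 4"
  have "x 1 > \<epsilon> / 4"
  proof (rule ccontr)
    assume "\<not> x 1 > \<epsilon> / 4"
    then have x1: "0 \<le> x 1" "x 1 \<le> 1 / 4" using nonneg[of 1] \<eta> \<epsilon> by auto
    then have "1 / 2 \<le> \<bar>cubic a 1 (x 1)\<bar>" using cubic_at_one_le[of "x 1" a] \<epsilon> by auto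
    also have "\<dots> \<le> e 1 * (1 + x 1 + 1)" using approx[of 1] \<eta> by auto
    also have "\<dots> \<le> 1 / 32 * 3"
      using small[of 1] power_le_one[of \<epsilon> 2] \<epsilon> x1 \<eta> by (intro mult_mono) auto
    finally show False by simp
  qed
  with low obtain s where s: "s \<in> {\<eta>..1}" "x s = \<epsilon> / 4"
    using IVT'[of x \<eta> "\<epsilon> / 4" 1] cont \<eta> by auto
  have "3 / 16 * \<epsilon>\<^sup>2 \<le> \<bar>cubic a s (x s)\<bar>"
    using cubic_at_threshold_le[of s \<epsilon> a] s \<eta> \<epsilon> by auto
  also have "\<dots> \<le> e s * (s + x s + 1)" by (rule approx[OF s(1)])
  also have "\<dots> \<le> e s * 3" using small[OF s(1)] s \<epsilon> by (intro mult_left_mono) auto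
  finally show False using small[OF s(1)] \<epsilon> by auto
qed

lemma approx_cubic_root_dist_le:
  assumes \<eta>: "0 < \<eta>" "\<eta> \<le> 1" and \<epsilon>: "0 < \<epsilon>" "\<epsilon> \<le> 1" and x: "x > \<epsilon> / 4" and e: "e \<ge> 0"
    and approx: "\<bar>cubic a \<eta> x\<bar> \<le> e * (\<eta> + x + 1)"
  shows "\<bar>x - cubic_root a \<eta>\<bar> \<le> e * (48 / \<epsilon>\<^sup>2)"
proof -
  define t where "t = \<epsilon> / 4"
  have t: "0 < t" "t \<le> 1" "t < x" using \<epsilon> x by (auto simp: t_def)
  have "\<bar>x - cubic_root a \<eta>\<bar> * x\<^sup>2 \<le> \<bar>cubic a \<eta> x\<bar>"
    using t \<eta> by (intro dist_cubic_root_mult_square_le) auto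
  also have "\<dots> \<le> e * (2 + x)" using \<eta> e by (intro order_trans[OF approx] mult_left_mono) auto
  finally have "\<bar>x - cubic_root a \<eta>\<bar> \<le> e * (2 + x) / x\<^sup>2" using t by (simp add: field_simps)
  also have "\<dots> = e * (2 / x\<^sup>2 + 1 / x)" using t by (simp add: field_simps power2_eq_square)
  also have "\<dots> \<le> e * (2 / t\<^sup>2 + 1 / t\<^sup>2)"
  proof (intro mult_left_mono add_mono e)
    show "2 / x\<^sup>2 \<le> 2 / t\<^sup>2" using t by (intro divide_left_mono power_mono) auto
    have "t\<^sup>2 \<le> t" using t by (simp add: power2_eq_square mult_left_le)
    then show "1 / x \<le> 1 / t\<^sup>2" using t by (intro divide_left_mono) auto
  qed
  also have "\<dots> = e * (48 / \<epsilon>\<^sup>2)" by (simp add: t_def power2_eq_square)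
  finally show ?thesis .
qed

section \<open>Hermitization\<close>

text \<open>The Hermitization of the permutation matrix of \<open>p\<close> is itself the permutation matrix of the
  involution \<open>rho n p\<close> on \<open>2n\<close> points. Throughout, \<open>\<kappa> = 0\<close> and \<open>\<kappa> = n\<close> are the offsets of the two halves
  of the index range.\<close>

definition rho :: "nat \<Rightarrow> (nat \<Rightarrow> nat) \<Rightarrow> nat \<Rightarrow> nat" where
  "rho n p a = (if a < n then n + p a else inv_into UNIV p (a - n))"

lemma rho_low: "i < n \<Longrightarrow> rho n p i = n + p i"
  by (simp add: rho_def)

lemma rho_high: "rho n p (n + i) = inv_into UNIV p i"
  by (simp add: rho_def)

lemma half_index_cases:
  fixes a n :: nat
  assumes "a < 2 * n"
  obtains \<kappa> i where "\<kappa> \<in> {0, n}" "i < n" "a = \<kappa> + i"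
proof (cases "a < n")
  case True
  then show ?thesis by (intro that[of 0 a]) auto
next
  case False
  then show ?thesis using assms by (intro that[of n "a - n"]) auto
qed

lemma
  assumes p: "p permutes {..<n}" and a: "a < 2 * n"
  shows rho_less_half: "rho n p a < n \<longleftrightarrow> \<not> a < n"
    and rho_less: "rho n p a < 2 * n" and rho_rho: "rho n p (rho n p a) = a"
proof -
  have "p i < n \<longleftrightarrow> i < n" "inv_into UNIV p i < n \<longleftrightarrow> i < n" for i
    using permutes_in_image[OF p] permutes_in_image[OF permutes_inv[OF p]] by auto
  then have "a < n \<Longrightarrow> p a < n" "\<not> a < n \<Longrightarrow> inv_into UNIV p (a - n) < n"
    using a by simp_all
  then show "rho n p a < n \<longleftrightarrow> \<not> a < n" "rho n p a < 2 * n" "rho n p (rho n p a) = a"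
    using permutes_inverses[OF p] by (cases "a < n"; simp add: rho_def)+
qed

lemma involutive_on_rho: "p permutes {..<n} \<Longrightarrow> involutive_on {..<2*n} (rho n p)"
  by (simp add: involutive_on_def rho_less rho_rho)

lemma rho_comp_swap:
  assumes p: "p permutes {..<n}" and ij: "i < n" "j < n" and a: "a \<notin> {i, j, n + p i, n + p j}"
  shows "rho n (p \<circ> swap i j) a = rho n p a"
proof (cases "a < n")
  case True
  then show ?thesis using a by (simp add: rho_def Transposition.transpose_def)
next
  case False
  let ?k = "inv_into UNIV p (a - n)"
  have k: "p ?k = a - n" using permutes_inverses(1)[OF p] .
  then have "?k \<noteq> i" "?k \<noteq> j" using a False by auto
  then have "(p \<circ> swap i j) ?k = a - n" using k by (simp add: Transposition.transpose_def)
  moreover have "p \<circ> swap i j permutes {..<n}" using p ij by (intro permutes_swap) auto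
  ultimately have "inv_into UNIV (p \<circ> swap i j) (a - n) = ?k" using permutes_inverses(2) by metis
  then show ?thesis using False by (simp add: rho_def)
qed

lemma rho_eq_iff: "p permutes {..<n} \<Longrightarrow> a < 2*n \<Longrightarrow> b < 2*n \<Longrightarrow> rho n p a = b \<longleftrightarrow> rho n p b = a"
  using rho_rho by metis

definition scalar_hermitization :: "nat \<Rightarrow> complex \<Rightarrow> nat \<Rightarrow> nat \<Rightarrow> complex" where
  "scalar_hermitization n z a b = (if a < n \<and> b = n + a then z else if b < n \<and> a = n + b then cnj z else 0)"

definition hermitization :: "nat \<Rightarrow> nat set \<Rightarrow> real \<Rightarrow> complex \<Rightarrow> (nat \<Rightarrow> nat \<Rightarrow> nat) \<Rightarrow> nat \<Rightarrow> nat \<Rightarrow> complex" where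
  "hermitization n L r z w a b
    = scalar_hermitization n z a b - of_real r * (\<Sum>l\<in>L. of_bool (rho n (w l) a = b))"

lemma cnj_of_bool: "cnj (of_bool Q) = of_bool Q"
  by (cases Q) auto

lemma hermitian_hermitization:
  assumes "\<And>l. l \<in> L \<Longrightarrow> w l permutes {..<n}"
  shows "hermitian (2*n) (hermitization n L r z w)"
  unfolding hermitian_def
proof (intro allI impI)
  fix a b assume ab: "a < 2*n" "b < 2*n"
  have "(\<Sum>l\<in>L. of_bool (rho n (w l) a = b) :: complex) = (\<Sum>l\<in>L. of_bool (rho n (w l) b = a))"
    using assms ab rho_eq_iff by (intro sum.cong) auto
  then show "hermitization n L r z w a b = cnj (hermitization n L r z w b a)"
    by (simp add: hermitization_def scalar_hermitization_def cnj_of_bool)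
qed

lemma chiral_hermitization:
  assumes "\<And>l. l \<in> L \<Longrightarrow> w l permutes {..<n}"
  shows "chiral n (hermitization n L r z w)"
  unfolding chiral_def
proof (intro allI impI)
  fix a b assume ab: "a < 2*n" "b < 2*n" "(a < n) = (b < n)"
  then have "(\<Sum>l\<in>L. of_bool (rho n (w l) a = b) :: complex) = 0"
    using rho_less_half[OF assms ab(1)] by (intro sum.neutral) auto
  then show "hermitization n L r z w a b = 0"
    using ab by (auto simp: hermitization_def scalar_hermitization_def)
qed

lemma hermitization_cong:
  "(\<And>l. l \<in> L \<Longrightarrow> w l = w' l) \<Longrightarrow> hermitization n L r z w = hermitization n L r z w'"
  by (intro ext) (auto simp: hermitization_def intro!: sum.cong)

lemma hermitization_remove:
  assumes "finite L" "l \<in> L"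
  shows "hermitization n L r z w a b = hermitization n (L - {l}) r z w a b - of_real r * of_bool (rho n (w l) a = b)"
  unfolding hermitization_def sum.remove[OF assms] by (simp add: algebra_simps)

lemma sum_scalar_hermitization:
  assumes "a < 2*n"
  shows "(\<Sum>c<2*n. scalar_hermitization n z a c * x c) = (if a < n then z * x (n + a) else cnj z * x (a - n))"
proof -
  have "(\<Sum>c<2*n. scalar_hermitization n z a c * x c)
      = (\<Sum>c<2*n. if c = (if a < n then n + a else a - n) then (if a < n then z else cnj z) * x c else 0)"
    using assms by (intro sum.cong) (auto simp: scalar_hermitization_def)
  then show ?thesis using assms by (auto simp: if_distrib)
qed

lemma sum_hermitization_left:
  assumes w: "\<And>l. l \<in> L \<Longrightarrow> w l permutes {..<n}" and a: "a < 2*n"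
  shows "(\<Sum>c<2*n. hermitization n L r z w a c * x c)
    = (if a < n then z * x (n + a) else cnj z * x (a - n)) - of_real r * (\<Sum>l\<in>L. x (rho n (w l) a))"
proof -
  have "(\<Sum>c<2*n. (\<Sum>l\<in>L. of_bool (rho n (w l) a = c)) * x c)
      = (\<Sum>l\<in>L. \<Sum>c<2*n. of_bool (rho n (w l) a = c) * x c)"
    unfolding sum_distrib_right by (rule sum.swap)
  also have "\<dots> = (\<Sum>l\<in>L. x (rho n (w l) a))"
    using rho_less[OF w a] by (intro sum.cong) auto
  finally show ?thesis
    unfolding hermitization_def left_diff_distrib sum_subtractf sum_scalar_hermitization[OF a]
    by (simp only: mult.assoc sum_distrib_left[symmetric])
qed

lemma herm_mat_eq_hermitization:
  assumes w: "w \<in> perm_space n d" and ab: "a < 2*n" "b < 2*n"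
  shows "herm_mat n d z w $$ (a, b) = hermitization n {..<d} (1 / sqrt (real d)) z w a b"
proof -
  have p: "w l permutes {..<n}" if "l < d" for l
    using w that by (auto simp: perm_space_def PiE_iff)
  have card: "of_nat (card {l. l < d \<and> Q l}) = (\<Sum>l<d. of_bool (Q l) :: complex)" for Q
    by (simp add: Int_def conj_commute)
  consider (diagonal) "(a < n) = (b < n)" | (upper) "a < n" "\<not> b < n" | (lower) "\<not> a < n" "b < n" by blast
  then show ?thesis
  proof cases
    case diagonal
    then show ?thesis
      using ab chiralD[OF chiral_hermitization, of "{..<d}" w n a b] p by (auto simp: herm_mat_def)
  next
    case upper
    have "(\<Sum>l<d. of_bool (w l a = b - n) :: complex) = (\<Sum>l<d. of_bool (rho n (w l) a = b))"
      using upper by (intro sum.cong) (auto simp: rho_def)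
    then show ?thesis
      using upper ab unfolding herm_mat_def hermitization_def scalar_hermitization_def A_mat_def S_mat_def
      by (auto simp: card simp del: sum_of_bool_eq)
  next
    case lower
    have "w l b = a - n \<longleftrightarrow> inv_into UNIV (w l) (a - n) = b" if "l < d" for l
      using permutes_inverses[OF p[OF that]] by metis
    then have "(\<Sum>l<d. of_bool (w l b = a - n) :: complex) = (\<Sum>l<d. of_bool (rho n (w l) a = b))"
      using lower by (intro sum.cong) (auto simp: rho_def)
    then show ?thesis
      using lower ab unfolding herm_mat_def hermitization_def scalar_hermitization_def A_mat_def S_mat_def
      by (auto simp: card cnj_of_bool simp del: sum_of_bool_eq)
  qed
qed

lemma m_n_eq_avg_resolvent:
  assumes w: "w \<in> perm_space n d" and \<xi>: "Im \<xi> > 0"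
  shows "m_n n d z w \<xi> = avg {..<2*n} (\<lambda>a. resolvent (2*n) (hermitization n {..<d} (1 / sqrt (real d)) z w) \<xi> a a)"
proof -
  let ?M = "mat (2*n) (2*n) (\<lambda>(a, b). shifted (hermitization n {..<d} (1 / sqrt (real d)) z w) \<xi> a b)"
  have "hermitian (2*n) (hermitization n {..<d} (1 / sqrt (real d)) z w)"
    using w by (intro hermitian_hermitization) (auto simp: perm_space_def PiE_iff)
  from mat_inverse_shifted(1)[OF this \<xi>] have dim: "dim_row (the (mat_inverse ?M)) = 2*n" by auto
  have "\<xi> \<cdot>\<^sub>m 1\<^sub>m (2*n) - herm_mat n d z w = ?M"
  proof (rule eq_matI)
    fix a b assume "a < dim_row ?M" "b < dim_col ?M"
    then have ab: "a < 2*n" "b < 2*n" by simp_all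
    moreover have "dim_row (herm_mat n d z w) = 2*n" "dim_col (herm_mat n d z w) = 2*n"
      by (simp_all add: herm_mat_def)
    ultimately show "(\<xi> \<cdot>\<^sub>m 1\<^sub>m (2*n) - herm_mat n d z w) $$ (a, b) = ?M $$ (a, b)"
      by (simp add: herm_mat_eq_hermitization[OF w] shifted_def)
  qed (simp_all add: herm_mat_def)
  then show ?thesis by (simp add: m_n_def mat_trace_def avg_def resolvent_def dim)
qed

subsection \<open>Averages over one permutation\<close>

definition block_trace :: "nat \<Rightarrow> nat \<Rightarrow> (nat \<Rightarrow> nat \<Rightarrow> complex) \<Rightarrow> complex" where
  "block_trace n \<kappa> A = avg {..<n} (\<lambda>i. A (\<kappa> + i) i)"

definition rho_trace :: "nat \<Rightarrow> nat \<Rightarrow> (nat \<Rightarrow> nat) \<Rightarrow> (nat \<Rightarrow> nat \<Rightarrow> complex) \<Rightarrow> complex" where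
  "rho_trace n \<kappa> p A = avg {..<n} (\<lambda>i. A (rho n p (\<kappa> + i)) i)"

definition rho_product ::
  "nat \<Rightarrow> (nat \<Rightarrow> nat) \<Rightarrow> (nat \<Rightarrow> nat \<Rightarrow> complex) \<Rightarrow> (nat \<Rightarrow> nat \<Rightarrow> complex) \<Rightarrow> nat \<Rightarrow> nat \<Rightarrow> complex" where
  "rho_product n p A B a b = (\<Sum>e<2*n. A a (rho n p e) * B e b)"

lemma block_trace_diff: "block_trace n \<kappa> A - block_trace n \<kappa> B = block_trace n \<kappa> (\<lambda>a b. A a b - B a b)"
  by (simp add: block_trace_def avg_diff)

lemma cmod_block_trace_le:
  assumes "n > 0" "\<kappa> \<in> {0, n}" "\<And>a b. a < 2*n \<Longrightarrow> b < 2*n \<Longrightarrow> cmod (A a b) \<le> c"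
  shows "cmod (block_trace n \<kappa> A) \<le> c"
  unfolding block_trace_def by (intro norm_avg_le) (use assms in \<open>auto simp: lessThan_empty_iff\<close>)

lemma op_norm_le_block:
  assumes "op_norm_le (2*n) A c" "\<kappa> \<in> {0, n}" "\<kappa>' \<in> {0, n}"
  shows "op_norm_le n (\<lambda>k l. A (\<kappa> + k) (\<kappa>' + l)) c"
  by (rule op_norm_le_submatrix[OF assms(1)]) (use assms(2,3) in auto)

lemma avg_rho:
  assumes \<kappa>: "\<kappa> \<in> {0, n}" and i: "i < n"
  shows "avg (perms {..<n}) (\<lambda>p. f (rho n p (\<kappa> + i))) = avg {..<n} (\<lambda>k. f (n - \<kappa> + k))"
proof (cases "\<kappa> = 0")
  case True
  then show ?thesis using i avg_perms_apply[of "{..<n}" i "\<lambda>k. f (n + k)"] by (simp add: rho_low)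
next
  case False
  then show ?thesis
    using \<kappa> i avg_perms_inv[of "{..<n}" "\<lambda>p. f (p i)"] avg_perms_apply[of "{..<n}" i f] by (simp add: rho_high)
qed

lemma cmod_avg_perms_apply_pair_le:
  assumes n: "n \<ge> 2" and B: "op_norm_le n B c" and ij: "i < n" "j < n" "i \<noteq> j"
  shows "cmod (avg (perms {..<n}) (\<lambda>p. B (p i) (p j))) \<le> 4 * c / n"
proof -
  have c: "c \<ge> 0" using B by (rule op_norm_le_nonneg)
  have "avg (perms {..<n}) (\<lambda>p. B (p i) (p j)) = (\<Sum>k<n. \<Sum>l\<in>{..<n} - {k}. B k l) / of_nat (n * (n - 1))"
    using ij by (subst avg_perms_apply_pair) (simp_all add: avg_def mult.commute flip: sum_divide_distrib)
  also have "(\<Sum>k<n. \<Sum>l\<in>{..<n} - {k}. B k l) = (\<Sum>k<n. \<Sum>l<n. B k l) - (\<Sum>k<n. B k k)"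
    by (simp add: sum_diff1 flip: sum_subtractf)
  also have "cmod (\<dots> / of_nat (n * (n - 1))) \<le> (c * n + c * n) / (real n * (real n - 1))"
  proof -
    have "cmod (\<Sum>k<n. \<Sum>l<n. B k l) \<le> c * n"
      using op_norm_le_block_sum[OF B, of "{..<n}" "{..<n}"] by simp
    moreover have "cmod (\<Sum>k<n. B k k) \<le> c * n"
      using sum_norm_le[of "{..<n}" "\<lambda>k. B k k" "\<lambda>_. c"] op_norm_le_entry[OF B] by (simp add: mult.commute)
    ultimately have "cmod ((\<Sum>k<n. \<Sum>l<n. B k l) - (\<Sum>k<n. B k k)) \<le> c * n + c * n"
      by (intro order_trans[OF norm_triangle_ineq4] add_mono)
    moreover have "cmod (of_nat (n * (n - 1))) = real n * (real n - 1)"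
      using n unfolding norm_of_nat by (simp add: of_nat_diff)
    ultimately show ?thesis using n by (simp only: norm_divide) (rule divide_right_mono, auto)
  qed
  also have "\<dots> \<le> 4 * c / n"
    using n c by (simp add: divide_simps) (simp add: algebra_simps mult_left_mono)
  finally show ?thesis .
qed

lemma cmod_avg_perms_apply_inv_le:
  assumes n: "n \<ge> 2" and B: "op_norm_le n B c" and ij: "i < n" "j < n"
  shows "cmod (avg (perms {..<n}) (\<lambda>p. B (p i) (inv_into UNIV p j))) \<le> 4 * c / n"
proof -
  let ?off = "\<Sum>k\<in>{..<n} - {j}. \<Sum>l\<in>{..<n} - {i}. B k l"
  have c: "c \<ge> 0" using B by (rule op_norm_le_nonneg)
  have "(\<Sum>k<n. if k = j then B j i else avg ({..<n} - {i}) (B k))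
      = B j i + (\<Sum>k\<in>{..<n} - {j}. avg ({..<n} - {i}) (B k))"
    using ij by (subst sum.remove[of _ j]) (auto intro!: sum.cong)
  then have "avg (perms {..<n}) (\<lambda>p. B (p i) (inv_into UNIV p j)) = (B j i + ?off / of_nat (n - 1)) / of_nat n"
    using ij by (subst avg_perms_apply_inv) (simp_all add: avg_def flip: sum_divide_distrib)
  also have "cmod \<dots> \<le> (c + c) / n"
  proof -
    have "cmod ?off \<le> c * real (n - 1)"
      using op_norm_le_block_sum[OF B, of "{..<n} - {j}" "{..<n} - {i}"] ij by simp
    then have "cmod (?off / of_nat (n - 1)) \<le> c"
      using n by (simp add: norm_divide pos_divide_le_eq del: of_nat_diff)
    then have "cmod (B j i + ?off / of_nat (n - 1)) \<le> c + c"
      by (intro order_trans[OF norm_triangle_ineq] add_mono op_norm_le_entry[OF B] ij)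
    then show ?thesis by (simp add: norm_divide divide_right_mono)
  qed
  also have "\<dots> \<le> 4 * c / n" using c by (intro divide_right_mono) auto
  finally show ?thesis .
qed

lemma cmod_avg_rho_offdiag_le:
  assumes n: "n \<ge> 2" and A: "op_norm_le (2*n) A c" and ab: "a < 2*n" "b < 2*n" "a \<noteq> b"
  shows "cmod (avg (perms {..<n}) (\<lambda>p. A (rho n p a) (rho n p b))) \<le> 4 * c / n"
proof -
  obtain \<kappa> i where a: "\<kappa> \<in> {0, n}" "i < n" "a = \<kappa> + i" using half_index_cases[OF ab(1)] .
  obtain \<kappa>' j where b: "\<kappa>' \<in> {0, n}" "j < n" "b = \<kappa>' + j" using half_index_cases[OF ab(2)] .
  define B where "B k l = A (n - \<kappa> + k) (n - \<kappa>' + l)" for k l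
  have "op_norm_le n B c"
    unfolding B_def using a b by (intro op_norm_le_block[OF A]) auto
  note pair = cmod_avg_perms_apply_pair_le[OF n this] and with_inv = cmod_avg_perms_apply_inv_le[OF n this]
  consider (low_low) "\<kappa> = 0" "\<kappa>' = 0" | (high_high) "\<kappa> = n" "\<kappa>' = n"
    | (low_high) "\<kappa> = 0" "\<kappa>' = n" | (high_low) "\<kappa> = n" "\<kappa>' = 0"
    using a b by blast
  then show ?thesis
  proof cases
    case low_low
    then show ?thesis using pair[of i j] a b ab by (simp add: rho_low B_def)
  next
    case high_high
    then have "avg (perms {..<n}) (\<lambda>p. A (rho n p a) (rho n p b)) = avg (perms {..<n}) (\<lambda>p. B (p i) (p j))"
      using avg_perms_inv[of "{..<n}" "\<lambda>p. A (p i) (p j)"] a b by (simp add: rho_high B_def)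
    then show ?thesis using pair[of i j] high_high a b ab by simp
  next
    case low_high
    then show ?thesis using with_inv[of i j] a b by (simp add: rho_low rho_high B_def)
  next
    case high_low
    have "avg (perms {..<n}) (\<lambda>p. A (inv_into UNIV p i) (n + p j))
        = avg (perms {..<n}) (\<lambda>p. A (inv_into UNIV (inv_into UNIV p) i) (n + inv_into UNIV p j))"
      by (rule avg_perms_inv[symmetric])
    also have "\<dots> = avg (perms {..<n}) (\<lambda>p. B (p i) (inv_into UNIV p j))"
      using high_low by (intro avg_cong) (auto simp: B_def permutes_inv_inv)
    finally show ?thesis using with_inv[of i j] high_low a b by (simp add: rho_low rho_high)
  qed
qed

lemma cmod_avg_rho_trace_le:
  assumes A: "op_norm_le (2*n) A c" and \<kappa>: "\<kappa> \<in> {0, n}" and n: "n > 0"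
  shows "cmod (avg (perms {..<n}) (\<lambda>p. rho_trace n \<kappa> p A)) \<le> c / n"
proof -
  have "avg (perms {..<n}) (\<lambda>p. rho_trace n \<kappa> p A) = avg {..<n} (\<lambda>i. avg {..<n} (\<lambda>k. A (n - \<kappa> + k) i))"
    unfolding rho_trace_def avg_swap[of "perms {..<n}"]
    by (intro avg_cong avg_rho[OF \<kappa>, of _ "\<lambda>a. A a _"]) auto
  also have "\<dots> = avg {..<n} (\<lambda>k. avg {..<n} (\<lambda>i. A (n - \<kappa> + k) (0 + i)))"
    unfolding avg_swap[of "{..<n}" "{..<n}" "\<lambda>i k. A (n - \<kappa> + k) i"] by simp
  also have "\<dots> = (\<Sum>k<n. \<Sum>i<n. A (n - \<kappa> + k) (0 + i)) / (of_nat n * of_nat n)"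
    by (simp add: avg_def flip: sum_divide_distrib)
  also have "cmod \<dots> \<le> c * n / (real n * real n)"
  proof -
    have "cmod (\<Sum>k<n. \<Sum>i<n. A (n - \<kappa> + k) (0 + i)) \<le> c * n"
      using op_norm_le_block_sum[OF op_norm_le_block[OF A, of "n - \<kappa>" 0], of "{..<n}" "{..<n}"] \<kappa> by auto
    then show ?thesis by (simp only: norm_divide norm_mult norm_of_nat) (rule divide_right_mono, auto)
  qed
  finally show ?thesis using n by simp
qed

lemma cmod_sum_offdiag_avg_rho_le:
  assumes n: "n \<ge> 2" and A: "op_norm_le (2*n) A c" and B: "op_norm_le (2*n) B c'" and a: "a < 2*n" and b: "b < 2*n"
  shows "cmod (\<Sum>e\<in>{..<2*n} - {a}. avg (perms {..<n}) (\<lambda>p. A (rho n p a) (rho n p e)) * B e b)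
    \<le> 4 * c / n * (c' * sqrt (2 * n))"
proof -
  have "cmod (\<Sum>e\<in>{..<2*n} - {a}. avg (perms {..<n}) (\<lambda>p. A (rho n p a) (rho n p e)) * B e b)
      \<le> 4 * c / n * (c' * sqrt (real (2 * n)))"
  proof (rule op_norm_le_weighted_column_sum[OF B b Diff_subset])
    fix e assume "e \<in> {..<2*n} - {a}"
    then show "cmod (avg (perms {..<n}) (\<lambda>p. A (rho n p a) (rho n p e))) \<le> 4 * c / n"
      using a by (intro cmod_avg_rho_offdiag_le[OF n A]) auto
  qed (use op_norm_le_nonneg[OF A] in simp)
  then show ?thesis by simp
qed

lemma cmod_avg_rho_trace_product_le:
  assumes n: "n \<ge> 2" and A: "op_norm_le (2*n) A c" and B: "op_norm_le (2*n) B c'" and \<kappa>: "\<kappa> \<in> {0, n}"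
    and traces: "avg {..<n} (\<lambda>k. A (n + k) (n + k)) = block_trace n 0 A"
  shows "cmod (avg (perms {..<n}) (\<lambda>p. rho_trace n \<kappa> p (rho_product n p A B))
    - block_trace n 0 A * block_trace n \<kappa> B) \<le> 6 * (c * c') / sqrt n"
proof -
  define E where "E a e = avg (perms {..<n}) (\<lambda>p. A (rho n p a) (rho n p e))" for a e
  define off where "off i = (\<Sum>e\<in>{..<2*n} - {\<kappa> + i}. E (\<kappa> + i) e * B e i)" for i
  have E_diag: "E (\<kappa> + i) (\<kappa> + i) = block_trace n 0 A" if "i < n" for i
    unfolding E_def using avg_rho[OF \<kappa> that, of "\<lambda>a. A a a"] traces \<kappa> by (auto simp: block_trace_def)
  have off_le: "cmod (off i) \<le> 4 * c / n * (c' * sqrt (2 * n))" if "i < n" for i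
    unfolding off_def E_def using that \<kappa> by (intro cmod_sum_offdiag_avg_rho_le[OF n A B]) auto
  have row: "(\<Sum>e<2*n. E (\<kappa> + i) e * B e i) = block_trace n 0 A * B (\<kappa> + i) i + off i" if "i < n" for i
  proof -
    have mem: "\<kappa> + i \<in> {..<2*n}" using \<kappa> that by auto
    show ?thesis by (simp only: sum.remove[OF finite_lessThan mem] off_def E_diag[OF that])
  qed
  have "avg (perms {..<n}) (\<lambda>p. rho_trace n \<kappa> p (rho_product n p A B)) = avg {..<n} (\<lambda>i. \<Sum>e<2*n. E (\<kappa> + i) e * B e i)"
    by (simp only: rho_trace_def rho_product_def E_def avg_swap[of "perms {..<n}"] avg_sum avg_mult_right)
  also have "\<dots> = avg {..<n} (\<lambda>i. block_trace n 0 A * B (\<kappa> + i) i + off i)"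
    by (intro avg_cong row) simp
  also have "\<dots> = block_trace n 0 A * block_trace n \<kappa> B + avg {..<n} off"
    by (simp only: avg_add avg_mult_left block_trace_def)
  finally have "cmod (avg (perms {..<n}) (\<lambda>p. rho_trace n \<kappa> p (rho_product n p A B))
      - block_trace n 0 A * block_trace n \<kappa> B) = cmod (avg {..<n} off)" by simp
  also have "\<dots> \<le> 4 * c / n * (c' * sqrt (2 * n))"
    using off_le n by (intro norm_avg_le) (auto simp: lessThan_empty_iff)
  also have "\<dots> = 4 * sqrt 2 * (c * c') / sqrt n"
    using n by (simp add: real_sqrt_mult field_simps)
  also have "\<dots> \<le> 6 * (c * c') / sqrt n"
  proof -
    have "sqrt 2 \<le> 6 / 4" by (rule real_le_lsqrt) (auto simp: power2_eq_square)
    then show ?thesis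
      using op_norm_le_nonneg[OF A] op_norm_le_nonneg[OF B] by (intro divide_right_mono mult_right_mono) auto
  qed
  finally show ?thesis .
qed

section \<open>The permutation model\<close>

lemma norm_product_diff_le:
  fixes x y x' y' :: "'a::real_normed_field"
  assumes "norm (x - x') \<le> \<delta>" "norm (y - y') \<le> \<delta>" "norm x' \<le> M" "norm y \<le> M"
  shows "norm (x * y - x' * y') \<le> 2 * (\<delta> * M)"
proof -
  have nonneg: "0 \<le> \<delta>" "0 \<le> M" using assms(1,3) norm_ge_zero order_trans by blast+
  have "norm (x * y - x' * y') = norm ((x - x') * y + x' * (y - y'))" by (simp add: algebra_simps)
  also have "\<dots> \<le> norm (x - x') * norm y + norm x' * norm (y - y')"
    unfolding norm_mult[symmetric] by (rule norm_triangle_ineq)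
  also have "\<dots> \<le> \<delta> * M + M * \<delta>" using assms nonneg by (intro add_mono mult_mono) auto
  finally show ?thesis by (simp add: mult.commute)
qed

locale perm_model =
  fixes n d :: nat and z :: complex
  assumes n: "n \<ge> 2" and d: "d \<ge> 1"
begin

definition r :: real where "r = 1 / sqrt (real d)"

abbreviation P :: "(nat \<Rightarrow> nat) set" where "P \<equiv> perms {..<n}"

abbreviation W :: "(nat \<Rightarrow> nat \<Rightarrow> nat) set" where "W \<equiv> PiE {..<d} (\<lambda>_. P)"

abbreviation tr :: "nat \<Rightarrow> (nat \<Rightarrow> nat \<Rightarrow> complex) \<Rightarrow> complex" where "tr \<equiv> block_trace n"

definition H :: "(nat \<Rightarrow> nat \<Rightarrow> nat) \<Rightarrow> nat \<Rightarrow> nat \<Rightarrow> complex" where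
  "H w = hermitization n {..<d} r z w"

definition H_omit :: "nat \<Rightarrow> (nat \<Rightarrow> nat \<Rightarrow> nat) \<Rightarrow> nat \<Rightarrow> nat \<Rightarrow> complex" where
  "H_omit l w = hermitization n ({..<d} - {l}) r z w"

definition G :: "complex \<Rightarrow> (nat \<Rightarrow> nat \<Rightarrow> nat) \<Rightarrow> nat \<Rightarrow> nat \<Rightarrow> complex" where
  "G \<xi> w = resolvent (2*n) (H w) \<xi>"

definition G_omit :: "complex \<Rightarrow> nat \<Rightarrow> (nat \<Rightarrow> nat \<Rightarrow> nat) \<Rightarrow> nat \<Rightarrow> nat \<Rightarrow> complex" where
  "G_omit \<xi> l w = resolvent (2*n) (H_omit l w) \<xi>"

definition mean_tr :: "complex \<Rightarrow> nat \<Rightarrow> complex" where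
  "mean_tr \<xi> \<kappa> = avg W (\<lambda>w. tr \<kappa> (G \<xi> w))"

lemma r_pos: "r > 0"
  using d by (simp add: r_def)

lemma r_square_mult_d: "r\<^sup>2 * d = 1"
  using d by (simp add: r_def power_divide)

lemma r_mult_d: "r * d = sqrt d"
  by (simp add: r_def real_div_sqrt)

lemma finite_P: "finite P"
  by (simp add: finite_permutations)

lemma finite_W: "finite W"
  by (simp add: finite_PiE finite_P)

lemma W_nonempty: "W \<noteq> {}"
  using perms_nonempty by (metis PiE_eq_empty_iff)

lemma W_permutes: "w \<in> W \<Longrightarrow> l < d \<Longrightarrow> w l permutes {..<n}"
  by (auto simp: PiE_iff)

lemma hermitian_H: "w \<in> W \<Longrightarrow> hermitian (2*n) (H w)"
  unfolding H_def by (rule hermitian_hermitization) (auto simp: PiE_iff)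

lemma chiral_H: "w \<in> W \<Longrightarrow> chiral n (H w)"
  unfolding H_def by (rule chiral_hermitization) (auto simp: PiE_iff)

lemma hermitian_H_omit: "w \<in> W \<Longrightarrow> hermitian (2*n) (H_omit l w)"
  unfolding H_omit_def by (rule hermitian_hermitization) (auto simp: PiE_iff)

lemma chiral_H_omit: "w \<in> W \<Longrightarrow> chiral n (H_omit l w)"
  unfolding H_omit_def by (rule chiral_hermitization) (auto simp: PiE_iff)

lemma H_eq_H_omit: "l < d \<Longrightarrow> H w a b = H_omit l w a b - of_real r * of_bool (rho n (w l) a = b)"
  unfolding H_def H_omit_def by (rule hermitization_remove) auto

lemma H_omit_upd: "H_omit l (w(l := p)) = H_omit l w"
  unfolding H_omit_def by (rule hermitization_cong) auto

lemma G_omit_upd: "G_omit \<xi> l (w(l := p)) = G_omit \<xi> l w"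
  by (simp add: G_omit_def H_omit_upd)

context
  fixes \<xi> :: complex
  assumes \<xi>: "Im \<xi> > 0"
begin

lemma op_norm_le_G: "w \<in> W \<Longrightarrow> op_norm_le (2*n) (G \<xi> w) (1 / Im \<xi>)"
  unfolding G_def by (rule op_norm_le_resolvent[OF hermitian_H \<xi>])

lemma op_norm_le_G_omit: "w \<in> W \<Longrightarrow> op_norm_le (2*n) (G_omit \<xi> l w) (1 / Im \<xi>)"
  unfolding G_omit_def by (rule op_norm_le_resolvent[OF hermitian_H_omit \<xi>])

lemma cmod_tr_G_le: "w \<in> W \<Longrightarrow> \<kappa> \<in> {0, n} \<Longrightarrow> cmod (tr \<kappa> (G \<xi> w)) \<le> 1 / Im \<xi>"
  using n by (intro cmod_block_trace_le op_norm_le_entry[OF op_norm_le_G]) auto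

lemma cmod_tr_G_omit_le: "w \<in> W \<Longrightarrow> \<kappa> \<in> {0, n} \<Longrightarrow> cmod (tr \<kappa> (G_omit \<xi> l w)) \<le> 1 / Im \<xi>"
  using n by (intro cmod_block_trace_le op_norm_le_entry[OF op_norm_le_G_omit]) auto

lemma avg_full_diag: "w \<in> W \<Longrightarrow> avg {..<2*n} (\<lambda>a. G \<xi> w a a) = tr 0 (G \<xi> w)"
  using resolvent_block_traces_eq[OF hermitian_H chiral_H \<xi>]
  by (simp add: avg_def block_trace_def G_def sum_lessThan_double)

lemma avg_lower_diag_G_omit: "w \<in> W \<Longrightarrow> avg {..<n} (\<lambda>k. G_omit \<xi> l w (n + k) (n + k)) = tr 0 (G_omit \<xi> l w)"
  using resolvent_block_traces_eq[OF hermitian_H_omit chiral_H_omit \<xi>]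
  by (simp add: avg_def block_trace_def G_omit_def)

text \<open>The \<open>\<kappa>\<close>-block of the identity \<open>(\<xi> - H) G = 1\<close>, traced.\<close>

lemma block_equation:
  assumes w: "w \<in> W" and \<kappa>: "\<kappa> \<in> {0, n}"
  shows "\<xi> * tr \<kappa> (G \<xi> w) - (if \<kappa> = 0 then z else cnj z) * tr (n - \<kappa>) (G \<xi> w)
      + r * (\<Sum>l<d. rho_trace n \<kappa> (w l) (G \<xi> w)) = of_bool (\<kappa> = 0)"
proof -
  let ?z = "if \<kappa> = 0 then z else cnj z"
  have row: "\<xi> * G \<xi> w (\<kappa> + i) i - ?z * G \<xi> w (n - \<kappa> + i) i + r * (\<Sum>l<d. G \<xi> w (rho n (w l) (\<kappa> + i)) i)
      = of_bool (\<kappa> = 0)" if i: "i < n" for i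
  proof -
    have a: "\<kappa> + i < 2*n" "i < 2*n" using \<kappa> i by auto
    have "(\<Sum>c<2*n. H w (\<kappa> + i) c * G \<xi> w c i)
        = ?z * G \<xi> w (n - \<kappa> + i) i - r * (\<Sum>l<d. G \<xi> w (rho n (w l) (\<kappa> + i)) i)"
      unfolding H_def by (subst sum_hermitization_left) (use \<kappa> i W_permutes[OF w] in auto)
    moreover have "\<xi> * G \<xi> w (\<kappa> + i) i - (\<Sum>c<2*n. H w (\<kappa> + i) c * G \<xi> w c i) = of_bool (\<kappa> + i = i)"
      using shifted_resolvent[OF hermitian_H[OF w] \<xi> a] by (simp only: G_def sum_shifted_left[OF a(1)])
    ultimately show ?thesis by (simp add: algebra_simps split del: if_split)
  qed
  have "avg {..<n} (\<lambda>i. \<xi> * G \<xi> w (\<kappa> + i) i - ?z * G \<xi> w (n - \<kappa> + i) i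
      + r * (\<Sum>l<d. G \<xi> w (rho n (w l) (\<kappa> + i)) i)) = avg {..<n} (\<lambda>_. of_bool (\<kappa> = 0))"
    by (intro avg_cong row) simp
  then show ?thesis
    using n by (simp only: avg_add avg_diff avg_mult_left avg_sum block_trace_def rho_trace_def)
      (simp add: avg_const lessThan_empty_iff)
qed

lemma G_dist_G_omit_le:
  assumes "w \<in> W" "l < d" "a < 2*n" "b < 2*n"
  shows "cmod (G \<xi> w a b - G_omit \<xi> l w a b) \<le> r / (Im \<xi>)\<^sup>2"
  unfolding G_def G_omit_def
  using resolvent_perturb_dist[OF hermitian_H_omit[OF assms(1)] hermitian_H[OF assms(1)] \<xi>
      involutive_on_rho[OF W_permutes[OF assms(1,2)]] H_eq_H_omit[OF assms(2)] assms(3,4)] r_pos by simp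

lemma G_second_order:
  assumes "w \<in> W" "l < d" "a < 2*n" "b < 2*n"
  shows "cmod (G \<xi> w a b
      - (G_omit \<xi> l w a b - r * rho_product n (w l) (G_omit \<xi> l w) (G_omit \<xi> l w) a b))
    \<le> r\<^sup>2 / (Im \<xi>)^3"
  unfolding G_def G_omit_def rho_product_def
  using resolvent_perturb_second_order[OF hermitian_H_omit[OF assms(1)] hermitian_H[OF assms(1)] \<xi>
      involutive_on_rho[OF W_permutes[OF assms(1,2)]] H_eq_H_omit[OF assms(2)] assms(3,4)] .

lemma rho_trace_second_order:
  assumes w: "w \<in> W" and l: "l < d" and \<kappa>: "\<kappa> \<in> {0, n}"
  defines "A \<equiv> G_omit \<xi> l w"
  shows "cmod (rho_trace n \<kappa> (w l) (G \<xi> w)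
      - (rho_trace n \<kappa> (w l) A - r * rho_trace n \<kappa> (w l) (rho_product n (w l) A A)))
    \<le> r\<^sup>2 / (Im \<xi>)^3"
proof -
  let ?a = "\<lambda>i. rho n (w l) (\<kappa> + i)"
  have "cmod (avg {..<n} (\<lambda>i. G \<xi> w (?a i) i - (A (?a i) i - r * rho_product n (w l) A A (?a i) i)))
      \<le> r\<^sup>2 / (Im \<xi>)^3"
  proof (rule norm_avg_le)
    fix i assume "i \<in> {..<n}"
    then show "cmod (G \<xi> w (?a i) i - (A (?a i) i - r * rho_product n (w l) A A (?a i) i)) \<le> r\<^sup>2 / (Im \<xi>)^3"
      unfolding A_def using \<kappa> by (intro G_second_order[OF w l] rho_less[OF W_permutes[OF w l]]) auto
  qed (use n in \<open>auto simp: lessThan_empty_iff\<close>)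
  then show ?thesis by (simp only: avg_diff avg_mult_left rho_trace_def)
qed

lemma tr_product_dist_le:
  assumes w: "w \<in> W" and l: "l < d" and \<kappa>: "\<kappa> \<in> {0, n}"
  shows "cmod (tr 0 (G \<xi> w) * tr \<kappa> (G \<xi> w) - tr 0 (G_omit \<xi> l w) * tr \<kappa> (G_omit \<xi> l w)) \<le> 2 * r / (Im \<xi>)^3"
proof -
  let ?G = "G \<xi> w" and ?A = "G_omit \<xi> l w"
  have dist: "cmod (tr k ?G - tr k ?A) \<le> r / (Im \<xi>)\<^sup>2" if "k \<in> {0, n}" for k
    unfolding block_trace_diff
    by (rule cmod_block_trace_le[OF _ that G_dist_G_omit_le[OF w l]]) (use n in auto)
  have "cmod (tr 0 ?G * tr \<kappa> ?G - tr 0 ?A * tr \<kappa> ?A) \<le> 2 * (r / (Im \<xi>)\<^sup>2 * (1 / Im \<xi>))"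
    by (rule norm_product_diff_le[OF dist dist cmod_tr_G_omit_le[OF w] cmod_tr_G_le[OF w]]) (use \<kappa> in auto)
  then show ?thesis by (simp add: power2_eq_square power3_eq_cube mult.assoc)
qed

lemma avg_resampled_rho_trace_dist_le:
  assumes w: "w \<in> W" and l: "l < d" and \<kappa>: "\<kappa> \<in> {0, n}"
  shows "cmod (avg P (\<lambda>p. rho_trace n \<kappa> p (G \<xi> (w(l := p)))) + r * (tr 0 (G_omit \<xi> l w) * tr \<kappa> (G_omit \<xi> l w)))
    \<le> r\<^sup>2 / (Im \<xi>)^3 + 1 / (n * Im \<xi>) + r * (6 / (sqrt n * (Im \<xi>)\<^sup>2))"
proof -
  let ?A = "G_omit \<xi> l w"
  define first where "first p = rho_trace n \<kappa> p ?A" for p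
  define second where "second p = rho_trace n \<kappa> p (rho_product n p ?A ?A)" for p
  define rest where "rest p = rho_trace n \<kappa> p (G \<xi> (w(l := p))) - (first p - r * second p)" for p
  have rest_le: "cmod (avg P rest) \<le> r\<^sup>2 / (Im \<xi>)^3"
  proof (rule norm_avg_le[OF finite_P perms_nonempty])
    fix p assume "p \<in> P"
    then have "w(l := p) \<in> W" using fun_upd_PiE[OF w] l by simp
    from rho_trace_second_order[OF this l \<kappa>] show "cmod (rest p) \<le> r\<^sup>2 / (Im \<xi>)^3"
      by (simp add: rest_def first_def second_def G_omit_upd)
  qed
  have first_le: "cmod (avg P first) \<le> 1 / (n * Im \<xi>)"
    unfolding first_def using cmod_avg_rho_trace_le[OF op_norm_le_G_omit[OF w] \<kappa>] n by (simp add: mult.commute)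
  have "cmod (avg P second - tr 0 ?A * tr \<kappa> ?A) \<le> 6 * (1 / Im \<xi> * (1 / Im \<xi>)) / sqrt n"
    unfolding second_def
    by (rule cmod_avg_rho_trace_product_le[OF n op_norm_le_G_omit[OF w] op_norm_le_G_omit[OF w] \<kappa>
          avg_lower_diag_G_omit[OF w]])
  then have second_le: "cmod (avg P second - tr 0 ?A * tr \<kappa> ?A) \<le> 6 / (sqrt n * (Im \<xi>)\<^sup>2)"
    by (simp add: power2_eq_square mult_ac)
  have "rho_trace n \<kappa> p (G \<xi> (w(l := p))) = rest p + first p - r * second p" for p
    by (simp add: rest_def)
  then have split: "avg P (\<lambda>p. rho_trace n \<kappa> p (G \<xi> (w(l := p)))) + r * (tr 0 ?A * tr \<kappa> ?A)
      = avg P rest + avg P first - r * (avg P second - tr 0 ?A * tr \<kappa> ?A)"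
    by (simp only: avg_add avg_diff avg_mult_left) (simp add: algebra_simps)
  have "cmod (r * (avg P second - tr 0 ?A * tr \<kappa> ?A)) \<le> r * (6 / (sqrt n * (Im \<xi>)\<^sup>2))"
    using r_pos second_le by (simp only: norm_mult norm_of_real abs_of_pos mult_left_mono less_imp_le)
  then show ?thesis
    unfolding split by (intro norm_triangle_le_diff add_mono norm_triangle_mono rest_le first_le)
qed

lemma avg_resampled_tr_product_dist_le:
  assumes w: "w \<in> W" and l: "l < d" and \<kappa>: "\<kappa> \<in> {0, n}"
  shows "cmod (avg P (\<lambda>p. tr 0 (G \<xi> (w(l := p))) * tr \<kappa> (G \<xi> (w(l := p))))
      - tr 0 (G_omit \<xi> l w) * tr \<kappa> (G_omit \<xi> l w))
    \<le> 2 * r / (Im \<xi>)^3"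
proof -
  let ?TT = "\<lambda>p. tr 0 (G \<xi> (w(l := p))) * tr \<kappa> (G \<xi> (w(l := p)))"
  let ?AA = "tr 0 (G_omit \<xi> l w) * tr \<kappa> (G_omit \<xi> l w)"
  have "cmod (avg P (\<lambda>p. ?TT p - ?AA)) \<le> 2 * r / (Im \<xi>)^3"
  proof (rule norm_avg_le[OF finite_P perms_nonempty])
    fix p assume "p \<in> P"
    then have "w(l := p) \<in> W" using fun_upd_PiE[OF w] l by simp
    from tr_product_dist_le[OF this l \<kappa>] show "cmod (?TT p - ?AA) \<le> 2 * r / (Im \<xi>)^3"
      by (simp add: G_omit_upd)
  qed
  then show ?thesis by (simp only: avg_diff avg_const[OF finite_P perms_nonempty])
qed

lemma avg_resampled_interaction_le:
  assumes w: "w \<in> W" and l: "l < d" and \<kappa>: "\<kappa> \<in> {0, n}"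
  shows "cmod (avg P (\<lambda>p. rho_trace n \<kappa> p (G \<xi> (w(l := p))) + r * (tr 0 (G \<xi> (w(l := p))) * tr \<kappa> (G \<xi> (w(l := p))))))
    \<le> 1 / (n * Im \<xi>) + r * (6 / (sqrt n * (Im \<xi>)\<^sup>2)) + 3 * r\<^sup>2 / (Im \<xi>)^3"
proof -
  let ?T = "avg P (\<lambda>p. rho_trace n \<kappa> p (G \<xi> (w(l := p))))"
  let ?TT = "avg P (\<lambda>p. tr 0 (G \<xi> (w(l := p))) * tr \<kappa> (G \<xi> (w(l := p))))"
  let ?AA = "tr 0 (G_omit \<xi> l w) * tr \<kappa> (G_omit \<xi> l w)"
  have "cmod (r * (?TT - ?AA)) \<le> r * (2 * r / (Im \<xi>)^3)"
    using r_pos avg_resampled_tr_product_dist_le[OF w l \<kappa>]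
    by (simp only: norm_mult norm_of_real abs_of_pos mult_left_mono less_imp_le)
  then have "cmod ((?T + r * ?AA) + r * (?TT - ?AA))
      \<le> r\<^sup>2 / (Im \<xi>)^3 + 1 / (n * Im \<xi>) + r * (6 / (sqrt n * (Im \<xi>)\<^sup>2)) + r * (2 * r / (Im \<xi>)^3)"
    by (rule norm_triangle_mono[OF avg_resampled_rho_trace_dist_le[OF w l \<kappa>]])
  moreover have "(?T + r * ?AA) + r * (?TT - ?AA) = ?T + r * ?TT" by (simp add: algebra_simps)
  ultimately show ?thesis by (simp only: avg_add avg_mult_left) (simp add: power2_eq_square)
qed

lemma avg_interaction_le:
  assumes \<kappa>: "\<kappa> \<in> {0, n}"
  shows "cmod (r * (\<Sum>l<d. avg W (\<lambda>w. rho_trace n \<kappa> (w l) (G \<xi> w))) + avg W (\<lambda>w. tr 0 (G \<xi> w) * tr \<kappa> (G \<xi> w)))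
    \<le> sqrt d / (n * Im \<xi>) + 6 / (sqrt n * (Im \<xi>)\<^sup>2) + 3 / (sqrt d * (Im \<xi>)^3)"
proof -
  let ?TT = "\<lambda>w. tr 0 (G \<xi> w) * tr \<kappa> (G \<xi> w)"
  let ?b = "1 / (n * Im \<xi>) + r * (6 / (sqrt n * (Im \<xi>)\<^sup>2)) + 3 * r\<^sup>2 / (Im \<xi>)^3"
  have single: "cmod (avg W (\<lambda>w. rho_trace n \<kappa> (w l) (G \<xi> w) + r * ?TT w)) \<le> ?b" if l: "l < d" for l
  proof -
    let ?f = "\<lambda>w. rho_trace n \<kappa> (w l) (G \<xi> w) + r * ?TT w"
    have "avg W ?f = avg W (\<lambda>w. avg P (\<lambda>p. ?f (w(l := p))))"
      using l finite_P by (intro avg_PiE_resample perms_nonempty) auto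
    then show ?thesis
      by (simp only: fun_upd_same) (rule norm_avg_le[OF finite_W W_nonempty avg_resampled_interaction_le[OF _ l \<kappa>]])
  qed
  have "complex_of_real r * of_real r * of_nat d = 1"
    using arg_cong[OF r_square_mult_d, of complex_of_real] by (simp add: power2_eq_square)
  then have "r * (\<Sum>l<d. avg W (\<lambda>w. rho_trace n \<kappa> (w l) (G \<xi> w))) + avg W ?TT
      = r * (\<Sum>l<d. avg W (\<lambda>w. rho_trace n \<kappa> (w l) (G \<xi> w) + r * ?TT w))"
    by (simp add: avg_add avg_mult_left sum.distrib distrib_left mult_ac)
  also have "cmod \<dots> \<le> r * (d * ?b)"
    unfolding norm_mult using r_pos single
      sum_norm_bound[of "{..<d}" "\<lambda>l. avg W (\<lambda>w. rho_trace n \<kappa> (w l) (G \<xi> w) + r * ?TT w)" ?b]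
    by (intro mult_mono) auto
  also have "\<dots> = (r * d) / (n * Im \<xi>) + (r\<^sup>2 * d) * (6 / (sqrt n * (Im \<xi>)\<^sup>2)) + (r\<^sup>2 * d) * (3 * r / (Im \<xi>)^3)"
    by (simp add: power2_eq_square distrib_left mult_ac)
  also have "\<dots> = sqrt d / (n * Im \<xi>) + 6 / (sqrt n * (Im \<xi>)\<^sup>2) + 3 / (sqrt d * (Im \<xi>)^3)"
    unfolding r_square_mult_d r_mult_d by (simp add: r_def)
  finally show ?thesis .
qed

lemma mean_block_equation:
  assumes \<kappa>: "\<kappa> \<in> {0, n}"
  shows "cmod (\<xi> * mean_tr \<xi> \<kappa> - (if \<kappa> = 0 then z else cnj z) * mean_tr \<xi> (n - \<kappa>)
      - avg W (\<lambda>w. tr 0 (G \<xi> w) * tr \<kappa> (G \<xi> w)) - of_bool (\<kappa> = 0))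
    \<le> sqrt d / (n * Im \<xi>) + 6 / (sqrt n * (Im \<xi>)\<^sup>2) + 3 / (sqrt d * (Im \<xi>)^3)"
proof -
  let ?z = "if \<kappa> = 0 then z else cnj z"
  have "avg W (\<lambda>w. \<xi> * tr \<kappa> (G \<xi> w) - ?z * tr (n - \<kappa>) (G \<xi> w) + r * (\<Sum>l<d. rho_trace n \<kappa> (w l) (G \<xi> w)))
      = avg W (\<lambda>_. of_bool (\<kappa> = 0))"
    by (intro avg_cong block_equation \<kappa>)
  then have "\<xi> * mean_tr \<xi> \<kappa> - ?z * mean_tr \<xi> (n - \<kappa>)
      + r * (\<Sum>l<d. avg W (\<lambda>w. rho_trace n \<kappa> (w l) (G \<xi> w))) = of_bool (\<kappa> = 0)"
    by (simp only: avg_add avg_diff avg_mult_left avg_sum mean_tr_def avg_const[OF finite_W W_nonempty])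
  then have "\<xi> * mean_tr \<xi> \<kappa> - ?z * mean_tr \<xi> (n - \<kappa>) - avg W (\<lambda>w. tr 0 (G \<xi> w) * tr \<kappa> (G \<xi> w)) - of_bool (\<kappa> = 0)
      = - (r * (\<Sum>l<d. avg W (\<lambda>w. rho_trace n \<kappa> (w l) (G \<xi> w))) + avg W (\<lambda>w. tr 0 (G \<xi> w) * tr \<kappa> (G \<xi> w)))"
    by (simp add: algebra_simps)
  then show ?thesis using avg_interaction_le[OF \<kappa>] by (simp only: norm_minus_cancel)
qed

end

subsection \<open>Concentration on the imaginary axis\<close>

definition g :: "real \<Rightarrow> (nat \<Rightarrow> nat \<Rightarrow> nat) \<Rightarrow> real" where
  "g \<eta> w = - Im (tr 0 (G (\<i> * of_real \<eta>) w))"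

definition gbar :: "real \<Rightarrow> real" where
  "gbar \<eta> = avg W (g \<eta>)"

lemma perm_space_eq_W: "perm_space n d = W"
  by (simp add: perm_space_def)

lemma g_lipschitz:
  assumes "\<eta> > 0" "\<eta>' > 0" and w: "w \<in> W"
  shows "\<bar>g \<eta> w - g \<eta>' w\<bar> \<le> \<bar>\<eta> - \<eta>'\<bar> / (\<eta> * \<eta>')"
proof -
  let ?\<xi> = "\<i> * complex_of_real \<eta>" and ?\<xi>' = "\<i> * complex_of_real \<eta>'"
  have "\<bar>g \<eta> w - g \<eta>' w\<bar> \<le> cmod (tr 0 (G ?\<xi> w) - tr 0 (G ?\<xi>' w))"
    using abs_Im_le_cmod[of "tr 0 (G ?\<xi> w) - tr 0 (G ?\<xi>' w)"] by (simp add: g_def)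
  also have "\<dots> \<le> cmod (?\<xi> - ?\<xi>') / (Im ?\<xi> * Im ?\<xi>')"
    unfolding block_trace_diff G_def
    by (intro cmod_block_trace_le resolvent_lipschitz hermitian_H w) (use assms n in auto)
  also have "cmod (?\<xi> - ?\<xi>') = \<bar>\<eta> - \<eta>'\<bar>"
    by (simp only: norm_mult norm_ii norm_of_real mult_1_left flip: right_diff_distrib of_real_diff)
  finally show ?thesis by simp
qed

lemma gbar_lipschitz:
  assumes "\<eta> > 0" "\<eta>' > 0"
  shows "\<bar>gbar \<eta> - gbar \<eta>'\<bar> \<le> \<bar>\<eta> - \<eta>'\<bar> / (\<eta> * \<eta>')"
proof -
  have "norm (avg W (\<lambda>w. g \<eta> w - g \<eta>' w)) \<le> \<bar>\<eta> - \<eta>'\<bar> / (\<eta> * \<eta>')"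
    by (rule norm_avg_le[OF finite_W W_nonempty]) (use g_lipschitz[OF assms] in auto)
  then show ?thesis by (simp add: avg_diff gbar_def)
qed

context
  fixes \<eta> :: real
  assumes \<eta>: "\<eta> > 0"
begin

lemma tr_G_imaginary:
  assumes w: "w \<in> W"
  shows "tr 0 (G (\<i> * of_real \<eta>) w) = - (\<i> * g \<eta> w)"
proof -
  have "Re (G (\<i> * of_real \<eta>) w i i) = 0" if "i < n" for i
    unfolding G_def by (rule Re_resolvent_diag[OF hermitian_H[OF w] chiral_H[OF w] \<eta>]) (use that in auto)
  then have "Re (tr 0 (G (\<i> * of_real \<eta>) w)) = 0" by (simp add: block_trace_def avg_def)
  then show ?thesis by (simp add: g_def complex_eq_iff)
qed

lemma m_n_imaginary:
  assumes w: "w \<in> W"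
  shows "m_n n d z w (\<i> * of_real \<eta>) = - (\<i> * g \<eta> w)"
  using m_n_eq_avg_resolvent[of w n d "\<i> * of_real \<eta>" z] avg_full_diag[of "\<i> * of_real \<eta>" w] tr_G_imaginary[OF w] w \<eta>
  by (simp add: perm_space_eq_W G_def H_def r_def)

lemma g_nonneg:
  assumes w: "w \<in> W"
  shows "g \<eta> w \<ge> 0"
proof -
  have "Im (G (\<i> * of_real \<eta>) w i i) \<le> 0" if "i < n" for i
    unfolding G_def by (rule Im_resolvent_diag_nonpos[OF hermitian_H[OF w]]) (use \<eta> that in auto)
  then have "(\<Sum>i<n. Im (G (\<i> * of_real \<eta>) w i i)) \<le> 0" by (intro sum_nonpos) auto
  then show ?thesis by (simp add: g_def block_trace_def avg_def divide_le_0_iff)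
qed

lemma g_le: "w \<in> W \<Longrightarrow> g \<eta> w \<le> 1 / \<eta>"
  using cmod_tr_G_le[of "\<i> * of_real \<eta>" w 0] g_nonneg \<eta> by (simp add: tr_G_imaginary norm_mult)

lemma gbar_nonneg: "gbar \<eta> \<ge> 0"
  unfolding gbar_def avg_def using g_nonneg by (simp add: sum_nonneg)

lemma gbar_le: "gbar \<eta> \<le> 1 / \<eta>"
  using avg_mono[of W "g \<eta>" "\<lambda>_. 1 / \<eta>"] g_le avg_const[OF finite_W W_nonempty, of "1 / \<eta>"] by (simp add: gbar_def)

lemma mean_tr_imaginary: "mean_tr (\<i> * of_real \<eta>) 0 = - (\<i> * gbar \<eta>)"
proof -
  have "mean_tr (\<i> * of_real \<eta>) 0 = avg W (\<lambda>w. (- \<i>) * of_real (g \<eta> w))"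
    unfolding mean_tr_def by (intro avg_cong) (simp add: tr_G_imaginary)
  then show ?thesis by (simp only: avg_mult_left avg_of_real gbar_def) simp
qed

text \<open>A transposition alters at most four rows of \<open>H\<close>.\<close>

lemma g_transpose_dist_le:
  assumes w: "w \<in> W" and l: "l < d" and ij: "i < n" "j < n"
  shows "\<bar>g \<eta> (w(l := w l \<circ> swap i j)) - g \<eta> w\<bar> \<le> 4 * r / (n * \<eta>\<^sup>2)"
proof -
  let ?\<xi> = "\<i> * complex_of_real \<eta>"
  define w' where "w' = w(l := w l \<circ> swap i j)"
  define D where "D = {i, j, n + w l i, n + w l j}"
  have p: "w l permutes {..<n}" and p': "w l \<circ> swap i j permutes {..<n}"
    using W_permutes[OF w l] ij by (auto intro: permutes_swap)
  have w': "w' \<in> W" using fun_upd_PiE[OF w, of l] l p' by (simp add: w'_def)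
  have D: "D \<subseteq> {..<2*n}" using ij permutes_in_image[OF p] by (auto simp: D_def)
  have rho_eq: "rho n (w' l) c = rho n (w l) c" if "c \<notin> D" for c
    using rho_comp_swap[OF p ij] that by (simp add: w'_def D_def)
  have H_diff: "H w a b - H w' a b = of_real r * (of_bool (rho n (w' l) a = b) - of_bool (rho n (w l) a = b))" for a b
    unfolding H_eq_H_omit[OF l] by (simp add: w'_def H_omit_upd algebra_simps)
  have "cmod ((\<Sum>a<2*n. G ?\<xi> w a a) - (\<Sum>a<2*n. G ?\<xi> w' a a)) \<le> card D * (2 * \<bar>r\<bar> / (Im ?\<xi>)\<^sup>2)"
    unfolding G_def
    by (rule resolvent_trace_perturb[OF hermitian_H[OF w] hermitian_H[OF w'] _ _ _ D rho_eq H_diff])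
       (use \<eta> rho_less[OF p] rho_less[OF p'] in \<open>auto simp: w'_def\<close>)
  also have "\<dots> \<le> 4 * (2 * r / \<eta>\<^sup>2)"
  proof -
    have "card D \<le> 4" unfolding D_def by (intro order_trans[OF card_insert_le_m1]) auto
    then show ?thesis using r_pos by (simp add: divide_right_mono)
  qed
  finally have "cmod (avg {..<2*n} (\<lambda>a. G ?\<xi> w a a) - avg {..<2*n} (\<lambda>a. G ?\<xi> w' a a)) \<le> 4 * (2 * r / \<eta>\<^sup>2) / (2 * n)"
    unfolding avg_def diff_divide_distrib[symmetric]
    by (simp only: norm_divide norm_of_nat card_lessThan) (rule divide_right_mono, auto)
  then have "cmod (tr 0 (G ?\<xi> w) - tr 0 (G ?\<xi> w')) \<le> 4 * r / (n * \<eta>\<^sup>2)"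
    using avg_full_diag[of ?\<xi>] w w' \<eta> by (simp add: mult_ac)
  then show ?thesis
    using abs_Im_le_cmod[of "tr 0 (G ?\<xi> w) - tr 0 (G ?\<xi> w')"] by (simp add: g_def w'_def)
qed

lemma subgaussian_g: "subgaussian W (g \<eta>) (16 / (n * \<eta>^4))"
proof -
  let ?s = "4 * r / (n * \<eta>\<^sup>2)"
  have "subgaussian W (g \<eta>) (of_nat (card {..<d}) * (of_nat (card {..<n}) * ?s\<^sup>2))"
  proof (rule subgaussian_PiE)
    fix w l assume w: "w \<in> W" and "l \<in> {..<d}"
    then have l: "l < d" by simp
    show "subgaussian P (\<lambda>p. g \<eta> (w(l := p))) (of_nat (card {..<n}) * ?s\<^sup>2)"
    proof (rule subgaussian_perms)
      fix p i j assume "p permutes {..<n}" "i \<in> {..<n}" "j \<in> {..<n}"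
      then show "\<bar>g \<eta> (w(l := p \<circ> swap i j)) - g \<eta> (w(l := p))\<bar> \<le> ?s"
        using g_transpose_dist_le[of "w(l := p)" l i j] fun_upd_PiE[OF w, of l p] l by simp
    qed simp
  qed (use finite_P perms_nonempty in auto)
  also have "of_nat (card {..<d}) * (of_nat (card {..<n}) * ?s\<^sup>2) = 16 * (r\<^sup>2 * d) / (n * \<eta>^4)"
    using n by (simp add: power_divide power_mult_distrib field_simps power2_eq_square numeral_eq_Suc)
  finally show ?thesis unfolding r_square_mult_d by simp
qed

lemma avg_g_abs_dev_le: "avg W (\<lambda>w. \<bar>g \<eta> w - gbar \<eta>\<bar>) \<le> 16 / (sqrt n * \<eta>\<^sup>2)"
proof -
  have "16 / (n * \<eta>^4) = (4 / (sqrt n * \<eta>\<^sup>2))\<^sup>2"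
    by (simp add: power_divide power_mult_distrib)
  then have "sqrt (16 / (n * \<eta>^4)) = 4 / (sqrt n * \<eta>\<^sup>2)" by (simp only: real_sqrt_abs) simp
  then show ?thesis
    using avg_abs_dev_le[OF subgaussian_g] n \<eta> by (simp add: gbar_def)
qed

lemma g_tail:
  assumes "u > 0"
  shows "avg W (\<lambda>w. of_bool (u \<le> \<bar>g \<eta> w - gbar \<eta>\<bar>)) \<le> 2 * exp (- (u\<^sup>2 * n * \<eta>^4 / 32))"
  using subgaussian_tail[OF subgaussian_g _ assms] n \<eta> by (simp add: gbar_def mult.assoc)

lemma cmod_tr_product_decouple_le:
  assumes \<kappa>: "\<kappa> \<in> {0, n}"
  defines "\<xi> \<equiv> \<i> * complex_of_real \<eta>"
  shows "cmod (avg W (\<lambda>w. tr 0 (G \<xi> w) * tr \<kappa> (G \<xi> w)) - mean_tr \<xi> 0 * mean_tr \<xi> \<kappa>) \<le> 16 / (sqrt n * \<eta>^3)"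
proof -
  have \<xi>: "Im \<xi> = \<eta>" by (simp add: \<xi>_def)
  have covariance: "avg W (\<lambda>w. tr 0 (G \<xi> w) * tr \<kappa> (G \<xi> w)) - mean_tr \<xi> 0 * mean_tr \<xi> \<kappa>
      = avg W (\<lambda>w. (tr 0 (G \<xi> w) - mean_tr \<xi> 0) * tr \<kappa> (G \<xi> w))"
    unfolding left_diff_distrib avg_diff avg_mult_left mean_tr_def ..
  have "cmod (avg W (\<lambda>w. (tr 0 (G \<xi> w) - mean_tr \<xi> 0) * tr \<kappa> (G \<xi> w)))
      \<le> avg W (\<lambda>w. \<bar>g \<eta> w - gbar \<eta>\<bar> * (1 / \<eta>))"
  proof (rule order_trans[OF norm_avg avg_mono])
    fix w assume w: "w \<in> W"
    have "tr 0 (G \<xi> w) - mean_tr \<xi> 0 = - (\<i> * of_real (g \<eta> w - gbar \<eta>))"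
      by (simp add: \<xi>_def tr_G_imaginary[OF w] mean_tr_imaginary algebra_simps)
    then have "cmod (tr 0 (G \<xi> w) - mean_tr \<xi> 0) = \<bar>g \<eta> w - gbar \<eta>\<bar>"
      by (simp only: norm_minus_cancel norm_mult norm_ii norm_of_real mult_1_left)
    moreover have "cmod (tr \<kappa> (G \<xi> w)) \<le> 1 / \<eta>" using cmod_tr_G_le[of \<xi>] w \<kappa> \<eta> by (simp add: \<xi>)
    ultimately show "cmod ((tr 0 (G \<xi> w) - mean_tr \<xi> 0) * tr \<kappa> (G \<xi> w)) \<le> \<bar>g \<eta> w - gbar \<eta>\<bar> * (1 / \<eta>)"
      unfolding norm_mult by (intro mult_mono) auto
  qed
  also have "\<dots> \<le> 16 / (sqrt n * \<eta>\<^sup>2) * (1 / \<eta>)"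
    unfolding avg_mult_right using avg_g_abs_dev_le \<eta> by (intro mult_right_mono) auto
  finally show ?thesis unfolding covariance by (simp add: power2_eq_square power3_eq_cube mult.assoc)
qed

definition cubic_error :: real where
  "cubic_error = sqrt d / (n * \<eta>) + 6 / (sqrt n * \<eta>\<^sup>2) + 3 / (sqrt d * \<eta>^3) + 16 / (sqrt n * \<eta>^3)"

lemma decoupled_block_equation:
  assumes \<kappa>: "\<kappa> \<in> {0, n}"
  defines "\<xi> \<equiv> \<i> * complex_of_real \<eta>"
  shows "cmod (\<xi> * mean_tr \<xi> \<kappa> - (if \<kappa> = 0 then z else cnj z) * mean_tr \<xi> (n - \<kappa>)
    - mean_tr \<xi> 0 * mean_tr \<xi> \<kappa> - of_bool (\<kappa> = 0)) \<le> cubic_error"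
proof -
  let ?z = "if \<kappa> = 0 then z else cnj z"
  let ?E = "avg W (\<lambda>w. tr 0 (G \<xi> w) * tr \<kappa> (G \<xi> w))"
  have \<xi>: "Im \<xi> = \<eta>" by (simp add: \<xi>_def)
  have split: "\<xi> * mean_tr \<xi> \<kappa> - ?z * mean_tr \<xi> (n - \<kappa>) - mean_tr \<xi> 0 * mean_tr \<xi> \<kappa> - of_bool (\<kappa> = 0)
      = (\<xi> * mean_tr \<xi> \<kappa> - ?z * mean_tr \<xi> (n - \<kappa>) - ?E - of_bool (\<kappa> = 0)) + (?E - mean_tr \<xi> 0 * mean_tr \<xi> \<kappa>)"
    by simp
  show ?thesis
    unfolding split cubic_error_def
    by (intro norm_triangle_mono mean_block_equation[of \<xi>, OF _ \<kappa>, unfolded \<xi>] \<eta>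
        cmod_tr_product_decouple_le[OF \<kappa>, folded \<xi>_def])
qed

lemma abs_cubic_gbar_le:
  "\<bar>cubic (1 - (cmod z)\<^sup>2) \<eta> (gbar \<eta>)\<bar> \<le> cubic_error * (\<eta> + gbar \<eta> + cmod z)"
proof -
  define \<xi> where "\<xi> = \<i> * complex_of_real \<eta>"
  define m where "m = mean_tr \<xi> 0"
  define m' where "m' = mean_tr \<xi> n"
  define err where "err = \<xi> * m - z * m' - m * m - 1"
  define err' where "err' = \<xi> * m' - cnj z * m - m * m'"
  have err_le: "cmod err \<le> cubic_error" and err'_le: "cmod err' \<le> cubic_error"
    using decoupled_block_equation[of 0] decoupled_block_equation[of n] n
    by (simp_all add: err_def err'_def m_def m'_def \<xi>_def)
  have m: "m = - (\<i> * gbar \<eta>)" by (simp add: m_def \<xi>_def mean_tr_imaginary)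
  have "\<xi> - m = \<i> * of_real (\<eta> + gbar \<eta>)" by (simp add: m \<xi>_def algebra_simps)
  then have norm_diff: "cmod (\<xi> - m) = \<eta> + gbar \<eta>"
    using \<eta> gbar_nonneg by (simp only: norm_mult norm_ii norm_of_real) simp
  have combine: "self_consistent z \<xi> m = err * (\<xi> - m) + z * err'"
    unfolding self_consistent_def complex_norm_square err_def err'_def
    by (simp add: algebra_simps power2_eq_square)
  have "\<bar>cubic (1 - (cmod z)\<^sup>2) \<eta> (gbar \<eta>)\<bar> = cmod (self_consistent z \<xi> m)"
    unfolding m \<xi>_def self_consistent_imaginary by (simp only: norm_mult norm_ii norm_of_real mult_1_left)
  also have "\<dots> = cmod (err * (\<xi> - m) + z * err')" by (simp only: combine)
  also have "\<dots> \<le> cmod err * (\<eta> + gbar \<eta>) + cmod z * cmod err'"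
    unfolding norm_diff[symmetric] norm_mult[symmetric] by (rule norm_triangle_ineq)
  also have "\<dots> \<le> cubic_error * (\<eta> + gbar \<eta>) + cmod z * cubic_error"
    by (intro add_mono mult_right_mono[OF err_le] mult_left_mono[OF err'_le]) (use \<eta> gbar_nonneg in auto)
  finally show ?thesis by (simp add: algebra_simps)
qed

end

end

section \<open>Symmetric laws and their Stieltjes transforms\<close>

definition poisson :: "real \<Rightarrow> real \<Rightarrow> real" where
  "poisson \<eta> x = \<eta> / (\<eta>\<^sup>2 + x\<^sup>2)"

lemma poisson_measurable [measurable]: "poisson \<eta> \<in> borel_measurable borel"
  unfolding poisson_def by measurable

lemma poisson_minus: "poisson \<eta> (- x) = poisson \<eta> x"
  by (simp add: poisson_def)

lemma poisson_bounds:
  assumes "\<eta> > 0"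
  shows "0 < poisson \<eta> x" "poisson \<eta> x \<le> 1 / \<eta>"
  using assms unfolding poisson_def by (auto simp: field_simps power2_eq_square add_pos_nonneg)

lemma isCont_poisson:
  assumes "\<eta> > 0"
  shows "isCont (poisson \<eta>) x"
proof -
  have "\<eta>\<^sup>2 + x\<^sup>2 \<noteq> 0" using assms by (simp add: add_pos_nonneg less_imp_neq[THEN not_sym])
  then show ?thesis unfolding poisson_def by (intro continuous_intros)
qed

lemma integrable_real_distribution:
  fixes f :: "real \<Rightarrow> 'b::{banach, second_countable_topology}"
  assumes "real_distribution \<nu>" "f \<in> borel_measurable borel" "\<And>x. norm (f x) \<le> B"
  shows "integrable \<nu> f"
proof -
  interpret real_distribution \<nu> by fact
  show ?thesis by (rule integrable_const_bound[of _ B]) (use assms in auto)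
qed

lemma integrable_poisson: "real_distribution \<nu> \<Longrightarrow> \<eta> > 0 \<Longrightarrow> integrable \<nu> (poisson \<eta>)"
  by (rule integrable_real_distribution[where B = "1 / \<eta>"]) (use poisson_bounds[of \<eta>] in \<open>auto simp: abs_of_pos\<close>)

lemma integral_poisson_nonneg: "\<eta> > 0 \<Longrightarrow> 0 \<le> integral\<^sup>L \<nu> (poisson \<eta>)"
  using poisson_bounds(1) by (intro integral_nonneg_AE) (auto simp: less_imp_le)

lemma char_cos_sin:
  assumes "real_distribution \<nu>"
  shows "char \<nu> t = Complex (integral\<^sup>L \<nu> (\<lambda>x. cos (t * x))) (integral\<^sup>L \<nu> (\<lambda>x. sin (t * x)))"
proof -
  have "integrable \<nu> (\<lambda>x. iexp (t * x))"
    by (rule integrable_real_distribution[OF assms, where B = 1]) auto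
  then have "Re (char \<nu> t) = integral\<^sup>L \<nu> (\<lambda>x. Re (iexp (t * x)))"
    and "Im (char \<nu> t) = integral\<^sup>L \<nu> (\<lambda>x. Im (iexp (t * x)))"
    unfolding char_def by (simp_all only: integral_Re integral_Im)
  then show ?thesis by (simp add: complex_eq_iff Re_exp Im_exp)
qed

definition symmetric_law :: "real measure \<Rightarrow> bool" where
  "symmetric_law \<nu> \<longleftrightarrow> real_distribution \<nu> \<and> distr \<nu> borel uminus = \<nu>"

lemma symmetric_law_real_distribution: "symmetric_law \<nu> \<Longrightarrow> real_distribution \<nu>"
  by (simp add: symmetric_law_def)

lemma symmetric_law_integral_odd:
  fixes f :: "real \<Rightarrow> real"
  assumes \<nu>: "symmetric_law \<nu>" and [measurable]: "f \<in> borel_measurable borel" and odd: "\<And>x. f (- x) = - f x"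
  shows "integral\<^sup>L \<nu> f = 0"
proof -
  interpret real_distribution \<nu> using \<nu> by (rule symmetric_law_real_distribution)
  have "integral\<^sup>L \<nu> f = integral\<^sup>L (distr \<nu> borel uminus) f" using \<nu> by (simp add: symmetric_law_def)
  also have "\<dots> = integral\<^sup>L \<nu> (\<lambda>x. f (- x))" by (rule integral_distr) auto
  finally show ?thesis by (simp add: odd)
qed

lemma symmetric_lawI:
  assumes M: "real_distribution M" and sin: "\<And>t. integral\<^sup>L M (\<lambda>x. sin (t * x)) = 0"
  shows "symmetric_law M"
proof -
  interpret real_distribution M by fact
  have rd: "real_distribution (distr M borel uminus)" by (rule real_distribution_distr) simp
  have "distr M borel uminus = M"
  proof (rule Levy_uniqueness[OF rd M], rule ext)
    fix t
    show "char (distr M borel uminus) t = char M t"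
      unfolding char_cos_sin[OF rd] char_cos_sin[OF M] by (simp add: integral_distr sin)
  qed
  with M show ?thesis by (simp add: symmetric_law_def)
qed

lemma cmod_stieltjes_kernel_le:
  assumes "Im \<xi> > 0"
  shows "cmod (1 / (\<xi> - of_real x)) \<le> 1 / Im \<xi>"
proof -
  have "Im \<xi> \<le> cmod (\<xi> - of_real x)" using abs_Im_le_cmod[of "\<xi> - of_real x"] by simp
  then show ?thesis using assms by (simp add: norm_divide divide_left_mono frac_le)
qed

lemma stieltjes_kernel_imaginary:
  "Re (1 / (\<i> * of_real \<eta> - of_real x)) = - (x / (\<eta>\<^sup>2 + x\<^sup>2))"
  "Im (1 / (\<i> * of_real \<eta> - of_real x)) = - poisson \<eta> x"
  by (simp_all add: poisson_def Re_divide Im_divide power2_eq_square add.commute)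

lemma stieltjes_imaginary:
  assumes \<nu>: "symmetric_law \<nu>" and \<eta>: "\<eta> > 0"
  shows "stieltjes \<nu> (\<i> * of_real \<eta>) = - (\<i> * of_real (integral\<^sup>L \<nu> (poisson \<eta>)))"
proof -
  have "integrable \<nu> (\<lambda>x. 1 / (\<i> * of_real \<eta> - complex_of_real x))"
    by (rule integrable_real_distribution[OF symmetric_law_real_distribution[OF \<nu>], where B = "1 / \<eta>"])
       (use \<eta> cmod_stieltjes_kernel_le[of "\<i> * of_real \<eta>"] in auto)
  then have "Re (stieltjes \<nu> (\<i> * of_real \<eta>)) = integral\<^sup>L \<nu> (\<lambda>x. - (x / (\<eta>\<^sup>2 + x\<^sup>2)))"
    and "Im (stieltjes \<nu> (\<i> * of_real \<eta>)) = integral\<^sup>L \<nu> (\<lambda>x. - poisson \<eta> x)"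
    unfolding stieltjes_def stieltjes_kernel_imaginary[symmetric] by (simp_all only: integral_Re integral_Im)
  moreover have "integral\<^sup>L \<nu> (\<lambda>x. - (x / (\<eta>\<^sup>2 + x\<^sup>2))) = 0"
    by (rule symmetric_law_integral_odd[OF \<nu>]) auto
  ultimately show ?thesis by (simp add: complex_eq_iff)
qed

lemma (in prob_space) sums_integral_bounded:
  fixes f :: "nat \<Rightarrow> 'a \<Rightarrow> 'b::{banach, second_countable_topology}"
  assumes f: "\<And>k. random_variable borel (f k)" "\<And>k x. norm (f k x) \<le> b k" and b: "summable b"
    and F: "\<And>x. (\<lambda>k. f k x) sums F x"
  shows "(\<lambda>k. expectation (f k)) sums expectation F"
proof -
  have int: "integrable M (f k)" for k
    by (rule integrable_const_bound[of _ "b k"]) (use f in auto)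
  have "summable (\<lambda>k. norm (f k x))" for x
    by (rule summable_comparison_test'[OF b]) (use f in simp)
  moreover have "summable (\<lambda>k. expectation (\<lambda>x. norm (f k x)))"
  proof (rule summable_comparison_test'[OF b])
    fix k :: nat
    have "expectation (\<lambda>x. norm (f k x)) \<le> b k"
      by (rule integral_le_const) (use int f in auto)
    then show "norm (expectation (\<lambda>x. norm (f k x))) \<le> b k" by (simp add: integral_nonneg_AE)
  qed
  ultimately have "(\<lambda>k. expectation (f k)) sums expectation (\<lambda>x. \<Sum>k. f k x)"
    using int by (intro sums_integral) auto
  then show ?thesis using F by (simp add: sums_iff)
qed

lemma char_distr_moment_series:
  assumes "prob_space M" and [measurable]: "X \<in> borel_measurable M" and X: "\<And>x. \<bar>X x\<bar> \<le> 1"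
  shows "(\<lambda>k. (\<i> * of_real t) ^ k /\<^sub>R fact k * of_real (integral\<^sup>L M (\<lambda>x. X x ^ k))) sums char (distr M borel X) t"
proof -
  interpret prob_space M by fact
  have "(\<lambda>k. expectation (\<lambda>x. (\<i> * of_real (t * X x)) ^ k /\<^sub>R fact k)) sums expectation (\<lambda>x. iexp (t * X x))"
  proof (rule sums_integral_bounded[where b = "\<lambda>k. norm (t ^ k /\<^sub>R fact k)"])
    fix k x
    have "\<bar>t\<bar> ^ k * \<bar>X x\<bar> ^ k \<le> \<bar>t\<bar> ^ k * 1" by (intro mult_left_mono power_le_one X) auto
    then show "norm ((\<i> * complex_of_real (t * X x)) ^ k /\<^sub>R fact k) \<le> norm (t ^ k /\<^sub>R fact k)"
      by (simp add: norm_mult norm_power power_mult_distrib abs_mult divide_right_mono power_abs)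
    show "summable (\<lambda>k. norm (t ^ k /\<^sub>R fact k))" by (rule summable_norm_exp)
  qed (auto intro: exp_converges)
  moreover have "expectation (\<lambda>x. (\<i> * of_real (t * X x)) ^ k /\<^sub>R fact k)
      = (\<i> * of_real t) ^ k /\<^sub>R fact k * of_real (expectation (\<lambda>x. X x ^ k))" for k
  proof -
    have "(\<i> * of_real (t * X x)) ^ k /\<^sub>R fact k = (\<i> * of_real t) ^ k /\<^sub>R fact k * complex_of_real (X x ^ k)" for x
      by (simp add: power_mult_distrib)
    then show ?thesis by (simp del: of_real_power)
  qed
  moreover have "char (distr M borel X) t = expectation (\<lambda>x. iexp (t * X x))"
    unfolding char_def by (rule integral_distr) auto
  ultimately show ?thesis by simp
qed

lemma distr_eqI_moments:
  fixes X :: "'a \<Rightarrow> real" and X' :: "'b \<Rightarrow> real"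
  assumes M: "prob_space M" "prob_space M'" and meas: "X \<in> borel_measurable M" "X' \<in> borel_measurable M'"
    and bounded: "\<And>x. \<bar>X x\<bar> \<le> 1" "\<And>x. \<bar>X' x\<bar> \<le> 1"
    and moments: "\<And>k. integral\<^sup>L M (\<lambda>x. X x ^ k) = integral\<^sup>L M' (\<lambda>x. X' x ^ k)"
  shows "distr M borel X = distr M' borel X'"
proof (rule Levy_uniqueness)
  show "char (distr M borel X) = char (distr M' borel X')"
    using char_distr_moment_series[OF M(1) meas(1) bounded(1)] char_distr_moment_series[OF M(2) meas(2) bounded(2)]
    unfolding moments by (intro ext) (rule sums_unique2)
qed (use prob_space.real_distribution_distr M meas in auto)

text \<open>In the variable \<open>u = poisson 1 x = 1 / (1 + x\<^sup>2)\<close> the Poisson kernel at height \<open>sqrt (1 + s)\<close> becomes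
  \<open>u / (1 + s u)\<close> up to a factor, so the Poisson integrals are a generating function of the moments of \<open>u\<close>.\<close>

lemma moment_series_poisson:
  assumes \<nu>: "real_distribution \<nu>" and s: "\<bar>s\<bar> < 1"
  defines "\<eta> \<equiv> sqrt (1 + s)"
  shows "(\<lambda>k. (- s) ^ k * integral\<^sup>L \<nu> (\<lambda>x. poisson 1 x ^ k)) sums (1 - s / \<eta> * integral\<^sup>L \<nu> (poisson \<eta>))"
proof -
  interpret real_distribution \<nu> by fact
  have \<eta>: "\<eta> > 0" "\<eta>\<^sup>2 = 1 + s" using s by (auto simp: \<eta>_def)
  have s_poisson: "\<bar>s * poisson 1 x\<bar> \<le> \<bar>s\<bar>" for x
    using poisson_bounds[of 1 x] by (simp add: abs_mult mult_left_le)
  have "(\<lambda>k. expectation (\<lambda>x. (- (s * poisson 1 x)) ^ k)) sums expectation (\<lambda>x. 1 - s / \<eta> * poisson \<eta> x)"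
  proof (rule sums_integral_bounded[where b = "\<lambda>k. \<bar>s\<bar> ^ k"])
    show "norm ((- (s * poisson 1 x)) ^ k) \<le> \<bar>s\<bar> ^ k" for k x
      using s_poisson by (simp add: power_abs power_mono)
    show "summable (\<lambda>k. \<bar>s\<bar> ^ k)" using s by (simp add: summable_geometric)
    fix x
    have pos: "1 + x\<^sup>2 > 0" "1 + s + x\<^sup>2 > 0" using s by (auto simp: add_pos_nonneg abs_if split: if_splits)
    have "1 / (1 - - (s * poisson 1 x)) = 1 - s / \<eta> * poisson \<eta> x"
      using pos \<eta> by (simp add: poisson_def divide_simps)
    moreover have "\<bar>- (s * poisson 1 x)\<bar> < 1" using s_poisson[of x] s by simp
    ultimately show "(\<lambda>k. (- (s * poisson 1 x)) ^ k) sums (1 - s / \<eta> * poisson \<eta> x)"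
      using geometric_sums[of "- (s * poisson 1 x)"] by simp
  qed measurable
  moreover have "(- (s * poisson 1 x)) ^ k = (- s) ^ k * poisson 1 x ^ k" for k x
    by (simp flip: power_mult_distrib)
  ultimately show ?thesis
    using integrable_poisson[OF \<nu> \<eta>(1)] prob_space by simp
qed

lemma poisson_moments_eq:
  assumes \<nu>: "real_distribution \<nu>" "real_distribution \<nu>'"
    and eq: "\<And>\<eta>. \<eta> > 0 \<Longrightarrow> integral\<^sup>L \<nu> (poisson \<eta>) = integral\<^sup>L \<nu>' (poisson \<eta>)"
  shows "integral\<^sup>L \<nu> (\<lambda>x. poisson 1 x ^ k) = integral\<^sup>L \<nu>' (\<lambda>x. poisson 1 x ^ k)"
proof (cases "k = 0")
  case True
  interpret N: real_distribution \<nu> by fact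
  interpret N': real_distribution \<nu>' by fact
  show ?thesis using True N.prob_space N'.prob_space by simp
next
  case False
  define a where "a k = (-1) ^ k * (integral\<^sup>L \<nu> (\<lambda>x. poisson 1 x ^ k) - integral\<^sup>L \<nu>' (\<lambda>x. poisson 1 x ^ k))" for k
  have "(\<lambda>k. a k * (s - 0) ^ k) sums 0" if s: "norm (s - 0) < 1" for s :: real
  proof -
    have "sqrt (1 + s) > 0" using s by auto
    with sums_diff[OF moment_series_poisson[OF \<nu>(1)] moment_series_poisson[OF \<nu>(2)], of s s] s eq
    have "(\<lambda>k. (- s) ^ k * integral\<^sup>L \<nu> (\<lambda>x. poisson 1 x ^ k)
        - (- s) ^ k * integral\<^sup>L \<nu>' (\<lambda>x. poisson 1 x ^ k)) sums 0"
      by simp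
    moreover have "(- s) ^ k * c - (- s) ^ k * c' = (- 1) ^ k * (c - c') * (s - 0) ^ k" for k c c'
      using power_mult_distrib[of "-1" s k] by (simp add: algebra_simps)
    ultimately show ?thesis by (simp only: a_def)
  qed
  note series = this
  have "a k = 0"
  proof (rule ccontr)
    assume ak: "a k \<noteq> 0"
    show False
    proof (rule powser_0_nonzero[of 1 0 a "\<lambda>_. 0" k])
      fix s :: real assume "s > 0" "\<And>z::real. z \<in> cball 0 s - {0} \<Longrightarrow> (0::real) \<noteq> 0"
      from this(2)[of s] this(1) show False by simp
    qed (use series ak False in auto)
  qed
  then show ?thesis by (simp add: a_def)
qed

lemma symmetric_law_eqI:
  assumes \<nu>: "symmetric_law \<nu>" "symmetric_law \<nu>'"
    and eq: "\<And>\<eta>. \<eta> > 0 \<Longrightarrow> integral\<^sup>L \<nu> (poisson \<eta>) = integral\<^sup>L \<nu>' (poisson \<eta>)"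
  shows "\<nu> = \<nu>'"
proof -
  note rd = \<nu>[THEN symmetric_law_real_distribution]
  interpret N: real_distribution \<nu> by (rule rd)
  interpret N': real_distribution \<nu>' by (rule rd)
  have bounded: "\<bar>poisson 1 x\<bar> \<le> 1" for x using poisson_bounds[of 1 x] by simp
  have distr_eq: "distr \<nu> borel (poisson 1) = distr \<nu>' borel (poisson 1)"
    by (rule distr_eqI_moments[OF N.prob_space_axioms N'.prob_space_axioms _ _ bounded bounded])
       (use poisson_moments_eq[OF rd eq] in auto)
  show ?thesis
  proof (rule Levy_uniqueness[OF rd], rule ext)
    fix t
    define f where "f u = cos (t * sqrt (1 / u - 1))" for u :: real
    have [measurable]: "f \<in> borel_measurable borel" unfolding f_def by measurable
    have f: "f (poisson 1 x) = cos (t * x)" for x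
    proof -
      have "sqrt (1 / poisson 1 x - 1) = \<bar>x\<bar>" by (simp add: poisson_def)
      then show ?thesis by (cases "x \<ge> 0") (auto simp: f_def)
    qed
    have "integral\<^sup>L \<nu> (\<lambda>x. cos (t * x)) = integral\<^sup>L (distr \<nu> borel (poisson 1)) f"
      by (subst integral_distr) (auto simp: f)
    also have "\<dots> = integral\<^sup>L \<nu>' (\<lambda>x. cos (t * x))"
      unfolding distr_eq by (subst integral_distr) (auto simp: f)
    finally have cos: "integral\<^sup>L \<nu> (\<lambda>x. cos (t * x)) = integral\<^sup>L \<nu>' (\<lambda>x. cos (t * x))" .
    have "integral\<^sup>L \<nu> (\<lambda>x. sin (t * x)) = 0" "integral\<^sup>L \<nu>' (\<lambda>x. sin (t * x)) = 0"
      by (auto intro!: symmetric_law_integral_odd \<nu>)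
    then show "char \<nu> t = char \<nu>' t" unfolding char_cos_sin[OF rd(1)] char_cos_sin[OF rd(2)] by (simp add: cos)
  qed
qed

lemma stieltjes_power_series:
  assumes \<nu>: "real_distribution \<nu>" and \<xi>: "Im \<xi> > 0" and \<zeta>: "cmod (\<zeta> - \<xi>) < Im \<xi>"
  shows "(\<lambda>k. (-1) ^ k * integral\<^sup>L \<nu> (\<lambda>x. (1 / (\<xi> - of_real x)) ^ Suc k) * (\<zeta> - \<xi>) ^ k) sums stieltjes \<nu> \<zeta>"
proof -
  interpret real_distribution \<nu> by fact
  define q where "q x = (\<xi> - \<zeta>) * (1 / (\<xi> - complex_of_real x))" for x
  have q_le: "cmod (q x) \<le> cmod (\<zeta> - \<xi>) / Im \<xi>" for x
  proof -
    have "cmod (q x) = cmod (\<zeta> - \<xi>) * cmod (1 / (\<xi> - of_real x))"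
      by (simp only: q_def norm_mult norm_minus_commute)
    also have "\<dots> \<le> cmod (\<zeta> - \<xi>) * (1 / Im \<xi>)" by (intro mult_left_mono cmod_stieltjes_kernel_le \<xi>) simp
    finally show ?thesis by simp
  qed
  have "(\<lambda>k. expectation (\<lambda>x. 1 / (\<xi> - of_real x) * q x ^ k)) sums expectation (\<lambda>x. 1 / (\<zeta> - of_real x))"
  proof (rule sums_integral_bounded[where b = "\<lambda>k. 1 / Im \<xi> * (cmod (\<zeta> - \<xi>) / Im \<xi>) ^ k"])
    show "norm (1 / (\<xi> - of_real x) * q x ^ k) \<le> 1 / Im \<xi> * (cmod (\<zeta> - \<xi>) / Im \<xi>) ^ k" for k x
      unfolding norm_mult norm_power
      by (intro mult_mono power_mono cmod_stieltjes_kernel_le q_le) (use \<xi> in auto)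
    show "summable (\<lambda>k. 1 / Im \<xi> * (cmod (\<zeta> - \<xi>) / Im \<xi>) ^ k)"
      using \<zeta> \<xi> by (intro summable_mult summable_geometric) simp
    fix x
    have nz: "\<xi> - of_real x \<noteq> 0" using \<xi> by (auto simp: complex_eq_iff)
    have "1 - q x = (\<zeta> - of_real x) / (\<xi> - of_real x)"
      using nz by (simp add: q_def field_simps)
    moreover have "cmod (q x) < 1" using q_le[of x] \<zeta> \<xi> by (auto elim: le_less_trans)
    ultimately show "(\<lambda>k. 1 / (\<xi> - of_real x) * q x ^ k) sums (1 / (\<zeta> - of_real x))"
      using sums_mult[OF geometric_sums, of "q x" "1 / (\<xi> - of_real x)"] nz by simp
  qed (simp add: q_def)
  moreover have "expectation (\<lambda>x. 1 / (\<xi> - of_real x) * q x ^ k)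
      = (-1) ^ k * expectation (\<lambda>x. (1 / (\<xi> - of_real x)) ^ Suc k) * (\<zeta> - \<xi>) ^ k" for k
  proof -
    have "1 / (\<xi> - of_real x) * q x ^ k = (-1) ^ k * (\<zeta> - \<xi>) ^ k * (1 / (\<xi> - of_real x)) ^ Suc k" for x
      unfolding q_def power_mult_distrib power_Suc using power_mult_distrib[of "-1" "\<zeta> - \<xi>" k] by simp
    then show ?thesis by (simp only: Bochner_Integration.integral_mult_right_zero mult_ac)
  qed
  ultimately show ?thesis
    by (simp only: stieltjes_def)
qed

lemma holomorphic_stieltjes:
  assumes \<nu>: "real_distribution \<nu>"
  shows "stieltjes \<nu> holomorphic_on {\<xi>. Im \<xi> > 0}"
proof -
  have "stieltjes \<nu> holomorphic_on ball \<xi> (Im \<xi>)" if "Im \<xi> > 0" for \<xi>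
    by (rule power_series_holomorphic, rule stieltjes_power_series[OF \<nu> that])
      (simp add: dist_norm norm_minus_commute)
  then have "stieltjes \<nu> field_differentiable at \<xi>" if "Im \<xi> > 0" for \<xi>
    using that by (intro holomorphic_on_imp_differentiable_at[of _ "ball \<xi> (Im \<xi>)"]) auto
  then show ?thesis by (intro holomorphic_onI) (auto intro: field_differentiable_at_within)
qed

lemma self_consistent_stieltjes_iff:
  assumes "symmetric_law \<nu>" "\<eta> > 0"
  shows "self_consistent z (\<i> * of_real \<eta>) (stieltjes \<nu> (\<i> * of_real \<eta>)) = 0
    \<longleftrightarrow> integral\<^sup>L \<nu> (poisson \<eta>) = cubic_root (1 - (cmod z)\<^sup>2) \<eta>"
proof -
  let ?h = "integral\<^sup>L \<nu> (poisson \<eta>)"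
  have "self_consistent z (\<i> * of_real \<eta>) (stieltjes \<nu> (\<i> * of_real \<eta>)) = 0 \<longleftrightarrow> cubic (1 - (cmod z)\<^sup>2) \<eta> ?h = 0"
    by (simp add: stieltjes_imaginary[OF assms] self_consistent_imaginary)
  then show ?thesis
    using cubic_root(2)[OF assms(2)] cubic_root_unique[OF assms(2) integral_poisson_nonneg[OF assms(2)]] by metis
qed

lemma self_consistent_upper_half_plane:
  assumes \<nu>: "symmetric_law \<nu>"
    and root: "\<And>\<eta>. \<eta> > 0 \<Longrightarrow> integral\<^sup>L \<nu> (poisson \<eta>) = cubic_root (1 - (cmod z)\<^sup>2) \<eta>"
    and \<xi>: "Im \<xi> > 0"
  shows "self_consistent z \<xi> (stieltjes \<nu> \<xi>) = 0"
proof (rule analytic_continuation[where w = \<xi> and f = "\<lambda>\<xi>. self_consistent z \<xi> (stieltjes \<nu> \<xi>)" and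
      S = "{\<xi>. Im \<xi> > 0}" and U = "(\<lambda>t. \<i> * of_real t) ` {0<..}" and \<xi> = \<i>])
  show "(\<lambda>\<xi>. self_consistent z \<xi> (stieltjes \<nu> \<xi>)) holomorphic_on {\<xi>. Im \<xi> > 0}"
    unfolding self_consistent_def
    by (intro holomorphic_intros holomorphic_stieltjes symmetric_law_real_distribution[OF \<nu>])
  show "open {\<xi>. 0 < Im \<xi>}" by (rule open_halfspace_Im_gt)
  show "connected {\<xi>. 0 < Im \<xi>}" by (intro convex_connected convex_halfspace_Im_gt)
  show "\<i> islimpt (\<lambda>t. \<i> * of_real t) ` {0<..}"
    unfolding islimpt_approachable
  proof (intro allI impI)
    fix e :: real assume e: "e > 0"
    have "dist (\<i> * of_real (1 + e / 2)) \<i> = cmod (\<i> * of_real (e / 2))"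
      by (simp add: dist_norm algebra_simps)
    also have "\<dots> = e / 2" using e by (simp only: norm_mult norm_of_real norm_ii)
    finally show "\<exists>x'\<in>(\<lambda>t. \<i> * of_real t) ` {0<..}. x' \<noteq> \<i> \<and> dist x' \<i> < e"
      using e by (intro bexI[of _ "\<i> * of_real (1 + e / 2)"] conjI imageI) (auto simp: complex_eq_iff)
  qed
  show "self_consistent z \<zeta> (stieltjes \<nu> \<zeta>) = 0" if "\<zeta> \<in> (\<lambda>t. \<i> * of_real t) ` {0<..}" for \<zeta>
    using that self_consistent_stieltjes_iff[OF \<nu>] root by auto
qed (use \<xi> in auto)

lemma m_inf_eqI:
  assumes \<nu>: "symmetric_law \<nu>"
    and root: "\<And>\<eta>. \<eta> > 0 \<Longrightarrow> integral\<^sup>L \<nu> (poisson \<eta>) = cubic_root (1 - (cmod z)\<^sup>2) \<eta>"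
  shows "m_inf z = stieltjes \<nu>"
  unfolding m_inf_def self_consistent_def[symmetric]
proof (rule the_equality)
  interpret real_distribution \<nu> using \<nu> by (rule symmetric_law_real_distribution)
  show "\<exists>\<nu>'. prob_space \<nu>' \<and> sets \<nu>' = sets borel \<and> distr \<nu>' borel uminus = \<nu>' \<and> stieltjes \<nu> = stieltjes \<nu>' \<and>
      (\<forall>\<xi>. Im \<xi> > 0 \<longrightarrow> self_consistent z \<xi> (stieltjes \<nu> \<xi>) = 0)"
    using self_consistent_upper_half_plane[OF \<nu> root] prob_space_axioms \<nu>
    by (intro exI[of _ \<nu>]) (auto simp: symmetric_law_def)
  fix m
  assume "\<exists>\<nu>. prob_space \<nu> \<and> sets \<nu> = sets borel \<and> distr \<nu> borel uminus = \<nu> \<and> m = stieltjes \<nu> \<and>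
      (\<forall>\<xi>. Im \<xi> > 0 \<longrightarrow> self_consistent z \<xi> (m \<xi>) = 0)"
  then obtain \<nu>' where \<nu>': "symmetric_law \<nu>'" "m = stieltjes \<nu>'"
    and eqn: "\<And>\<xi>. Im \<xi> > 0 \<Longrightarrow> self_consistent z \<xi> (stieltjes \<nu>' \<xi>) = 0"
    by (auto simp: symmetric_law_def real_distribution_def real_distribution_axioms_def)
  have "integral\<^sup>L \<nu>' (poisson \<eta>) = cubic_root (1 - (cmod z)\<^sup>2) \<eta>" if "\<eta> > 0" for \<eta>
    using eqn[of "\<i> * of_real \<eta>"] self_consistent_stieltjes_iff[OF \<nu>'(1) that] that by simp
  then have "\<nu>' = \<nu>" using root by (intro symmetric_law_eqI[OF \<nu>'(1) \<nu>]) simp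
  then show "m = stieltjes \<nu>" using \<nu>'(2) by simp
qed

section \<open>Existence of the limiting law\<close>

lemma mat_trace_mult_comm:
  assumes "A \<in> carrier_mat N N" "B \<in> carrier_mat N N"
  shows "mat_trace (A * B) = mat_trace (B * A)"
proof -
  have "mat_trace (A * B) = (\<Sum>i<N. \<Sum>j<N. A $$ (i, j) * B $$ (j, i))"
    using assms by (simp add: mat_trace_def scalar_prod_def atLeast0LessThan)
  also have "\<dots> = (\<Sum>j<N. \<Sum>i<N. B $$ (j, i) * A $$ (i, j))"
    by (subst sum.swap) (simp add: mult.commute)
  also have "\<dots> = mat_trace (B * A)"
    using assms by (simp add: mat_trace_def scalar_prod_def atLeast0LessThan)
  finally show ?thesis .
qed

lemma upper_triangular_left_inverse_diag:
  fixes K T :: "'a::field mat"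
  assumes K: "K \<in> carrier_mat N N" and T: "T \<in> carrier_mat N N" "upper_triangular T"
    and diag: "\<And>i. i < N \<Longrightarrow> T $$ (i, i) \<noteq> 0" and inv: "K * T = 1\<^sub>m N" and i: "i < N"
  shows "K $$ (i, i) = 1 / T $$ (i, i)"
proof -
  have product: "K $$ (i, j) * T $$ (j, j) = of_bool (i = j)"
    if j: "j < N" and below: "\<And>c. c < j \<Longrightarrow> K $$ (i, c) = 0" for j
  proof -
    have "of_bool (i = j) = (K * T) $$ (i, j)" using i j by (simp add: inv)
    also have "\<dots> = (\<Sum>c<N. K $$ (i, c) * T $$ (c, j))"
      using K T(1) i j by (simp add: scalar_prod_def atLeast0LessThan)
    also have "\<dots> = (\<Sum>c<N. if c = j then K $$ (i, j) * T $$ (j, j) else 0)"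
    proof (intro sum.cong refl)
      fix c assume "c \<in> {..<N}"
      then have "j < c \<Longrightarrow> T $$ (c, j) = 0" using T by (auto dest: upper_triangularD)
      then show "K $$ (i, c) * T $$ (c, j) = (if c = j then K $$ (i, j) * T $$ (j, j) else 0)"
        using below[of c] by (cases c j rule: linorder_cases) auto
    qed
    finally show ?thesis using j by simp
  qed
  have "K $$ (i, j) = 0" if "j < i" for j
    using that
  proof (induction j rule: less_induct)
    case (less j)
    then show ?case using product[of j] diag[of j] i by auto
  qed
  then show ?thesis using product[OF i] diag[OF i] by (simp add: field_simps)
qed

lemma mat_trace_inverse_of_triangularizable:
  assumes carrier: "R \<in> carrier_mat N N" "S \<in> carrier_mat N N" "T \<in> carrier_mat N N"
      "P \<in> carrier_mat N N" "Q \<in> carrier_mat N N"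
    and inv: "R * S = 1\<^sub>m N" and similar: "S * P = P * T" "P * Q = 1\<^sub>m N" "Q * P = 1\<^sub>m N"
    and T: "upper_triangular T" "\<And>i. i < N \<Longrightarrow> T $$ (i, i) \<noteq> 0"
  shows "mat_trace R = (\<Sum>i<N. 1 / T $$ (i, i))"
proof -
  let ?K = "Q * (R * P)"
  have RP: "R * P \<in> carrier_mat N N" and K: "?K \<in> carrier_mat N N"
    using carrier by (meson mult_carrier_mat)+
  have "?K * T = Q * (R * (P * T))"
    unfolding assoc_mult_mat[OF carrier(5) RP carrier(3)] assoc_mult_mat[OF carrier(1,4,3)] ..
  also have "\<dots> = Q * (R * S * P)" unfolding similar(1)[symmetric] assoc_mult_mat[OF carrier(1,2,4)] ..
  also have "\<dots> = 1\<^sub>m N" unfolding inv using carrier similar(3) by (simp add: left_mult_one_mat[of _ N N])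
  finally have K_inv: "?K * T = 1\<^sub>m N" .
  have "R = (R * P) * Q"
    unfolding assoc_mult_mat[OF carrier(1,4,5)] similar(2) right_mult_one_mat[OF carrier(1)] ..
  then have "mat_trace R = mat_trace ?K" using mat_trace_mult_comm[OF RP carrier(5)] by simp
  also have "\<dots> = (\<Sum>i<N. 1 / T $$ (i, i))"
    using carrier(5) upper_triangular_left_inverse_diag[OF K carrier(3) T K_inv] by (simp add: mat_trace_def)
  finally show ?thesis .
qed

lemma hermitian_eigenvalue_real:
  assumes H: "hermitian N H" and e: "eigenvalue (mat N N (\<lambda>(a, b). H a b)) e"
  shows "Im e = 0"
proof (rule ccontr)
  let ?M = "mat N N (\<lambda>(a, b). H a b)"
  assume "Im e \<noteq> 0"
  obtain v where v: "v \<in> carrier_vec N" "v \<noteq> 0\<^sub>v N" "?M *\<^sub>v v = e \<cdot>\<^sub>v v"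
    using e by (auto simp: eigenvalue_def eigenvector_def)
  have "(\<Sum>c<N. shifted H e a c * v $ c) = 0" if a: "a < N" for a
  proof -
    have "(\<Sum>c<N. H a c * v $ c) = (?M *\<^sub>v v) $ a"
      using a v(1) by (simp add: scalar_prod_def atLeast0LessThan)
    also have "\<dots> = e * v $ a" unfolding v(3) using a v(1) by simp
    finally show ?thesis by (simp add: sum_shifted_left[OF a])
  qed
  then have "v $ a = 0" if "a < N" for a
    using that by (rule shifted_kernel_trivial[OF H \<open>Im e \<noteq> 0\<close>, of "($) v"])
  then have "v = 0\<^sub>v N" using v(1) by auto
  with v(2) show False by simp
qed

lemma hermitian_schur:
  assumes H: "hermitian N H"
  obtains B P Q ev where "similar_mat_wit (mat N N (\<lambda>(a, b). H a b)) B P Q" "upper_triangular B"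
    "\<And>k. k < N \<Longrightarrow> B $$ (k, k) = complex_of_real (ev k)"
proof -
  let ?M = "mat N N (\<lambda>(a, b). H a b)"
  have M: "?M \<in> carrier_mat N N" by simp
  obtain es where es: "char_poly ?M = (\<Prod>e\<leftarrow>es. [:- e, 1:])" "length es = N"
    using char_poly_factorized[OF M] by blast
  obtain B P Q where "schur_decomposition ?M es = (B, P, Q)" by (metis prod_cases3)
  from schur_decomposition[OF M es(1) this]
  have B: "similar_mat_wit ?M B P Q" "upper_triangular B" "diag_mat B = es" by auto
  have "B $$ (k, k) = complex_of_real (Re (B $$ (k, k)))" if k: "k < N" for k
  proof -
    have "B \<in> carrier_mat N N" using similar_mat_witD2(5)[OF M B(1)] .
    then have "B $$ (k, k) = es ! k" using B(3) k by (auto simp: diag_mat_def)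
    then have "B $$ (k, k) \<in> set es" using k es(2) by simp
    then have "poly (char_poly ?M) (B $$ (k, k)) = 0"
      unfolding es(1) by (induction es) auto
    then have "eigenvalue ?M (B $$ (k, k))" using eigenvalue_root_char_poly[OF M] by simp
    then have "Im (B $$ (k, k)) = 0" by (rule hermitian_eigenvalue_real[OF H])
    then show ?thesis by (simp add: complex_eq_iff)
  qed
  with B(1,2) show ?thesis by (rule that)
qed

lemma similar_mat_wit_shifted:
  fixes M :: "'a::field mat"
  assumes M: "M \<in> carrier_mat N N" and sim: "similar_mat_wit M B P Q"
  shows "(\<xi> \<cdot>\<^sub>m 1\<^sub>m N - M) * P = P * (\<xi> \<cdot>\<^sub>m 1\<^sub>m N - B)"
proof -
  note wit = similar_mat_witD2[OF M sim]
  have "M * P = P * B * (Q * P)"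
    unfolding wit(3) by (rule assoc_mult_mat[OF mult_carrier_mat[OF wit(6,5)] wit(7,6)])
  then have MP: "M * P = P * B" unfolding wit(2) using wit(5,6) by (simp add: right_mult_one_mat[of _ N N])
  have "(\<xi> \<cdot>\<^sub>m 1\<^sub>m N - M) * P = (\<xi> \<cdot>\<^sub>m 1\<^sub>m N) * P - M * P"
    using M wit(6) by (simp add: minus_mult_distrib_mat[of _ N N])
  also have "(\<xi> \<cdot>\<^sub>m 1\<^sub>m N) * P = P * (\<xi> \<cdot>\<^sub>m 1\<^sub>m N)"
    using wit(6) by (simp add: mult_smult_distrib[of _ N N _ N] mult_smult_assoc_mat[of _ N N _ N])
  also have "P * (\<xi> \<cdot>\<^sub>m 1\<^sub>m N) - M * P = P * (\<xi> \<cdot>\<^sub>m 1\<^sub>m N - B)"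
    unfolding MP using wit(5,6) by (intro mult_minus_distrib_mat[symmetric]) auto
  finally show ?thesis .
qed

lemma hermitian_resolvent_trace:
  assumes H: "hermitian N H"
  obtains ev :: "nat \<Rightarrow> real" where
    "\<And>\<xi>. Im \<xi> > 0 \<Longrightarrow> (\<Sum>a<N. resolvent N H \<xi> a a) = (\<Sum>k<N. 1 / (\<xi> - of_real (ev k)))"
proof -
  let ?M = "mat N N (\<lambda>(a, b). H a b)"
  obtain B P Q ev where sim: "similar_mat_wit ?M B P Q" and B: "upper_triangular B"
    "\<And>k. k < N \<Longrightarrow> B $$ (k, k) = complex_of_real (ev k)" using hermitian_schur[OF H] by blast
  have M: "?M \<in> carrier_mat N N" by simp
  note wit = similar_mat_witD2[OF M sim]
  have "(\<Sum>a<N. resolvent N H \<xi> a a) = (\<Sum>k<N. 1 / (\<xi> - of_real (ev k)))" if \<xi>: "Im \<xi> > 0" for \<xi>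
  proof -
    let ?S = "mat N N (\<lambda>(a, b). shifted H \<xi> a b)" and ?T = "\<xi> \<cdot>\<^sub>m 1\<^sub>m N - B"
    note inv = mat_inverse_shifted[OF H \<xi>]
    have T: "?T \<in> carrier_mat N N" using wit(5) by auto
    have T_diag: "?T $$ (k, k) = \<xi> - of_real (ev k)" if "k < N" for k
      using that B(2) wit(5) by simp
    have S: "?S = \<xi> \<cdot>\<^sub>m 1\<^sub>m N - ?M" by (rule eq_matI) (auto simp: shifted_def)
    have "mat_trace (the (mat_inverse ?S)) = (\<Sum>k<N. 1 / ?T $$ (k, k))"
    proof (rule mat_trace_inverse_of_triangularizable[OF inv(1) _ T wit(6,7) inv(3) _ wit(1,2)])
      show "?S * P = P * ?T" unfolding S by (rule similar_mat_wit_shifted[OF M sim])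
      show "upper_triangular ?T" using B(1) wit(5) by (auto simp: upper_triangular_def)
      show "?T $$ (k, k) \<noteq> 0" if "k < N" for k
        unfolding T_diag[OF that] using \<xi> by (auto simp: complex_eq_iff)
    qed simp
    then show ?thesis using inv(1) by (simp add: mat_trace_def resolvent_def T_diag)
  qed
  then show ?thesis by (rule that)
qed

lemma (in perm_model) g_spectral:
  assumes w: "w \<in> W"
  shows "\<exists>ev :: nat \<Rightarrow> real. \<forall>\<eta>>0. g \<eta> w = avg {..<2*n} (\<lambda>k. poisson \<eta> (ev k))"
proof -
  obtain ev :: "nat \<Rightarrow> real" where ev: "\<And>\<xi>. Im \<xi> > 0 \<Longrightarrow>
      (\<Sum>a<2*n. resolvent (2*n) (H w) \<xi> a a) = (\<Sum>k<2*n. 1 / (\<xi> - of_real (ev k)))"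
    using hermitian_resolvent_trace[OF hermitian_H[OF w]] by blast
  have "g \<eta> w = avg {..<2*n} (\<lambda>k. poisson \<eta> (ev k))" if \<eta>: "\<eta> > 0" for \<eta>
  proof -
    let ?\<xi> = "\<i> * complex_of_real \<eta>"
    have "tr 0 (G ?\<xi> w) = avg {..<2*n} (\<lambda>a. G ?\<xi> w a a)" using avg_full_diag[of ?\<xi> w] w \<eta> by simp
    also have "\<dots> = avg {..<2*n} (\<lambda>k. 1 / (?\<xi> - of_real (ev k)))"
      unfolding avg_def G_def by (subst ev) (use \<eta> in auto)
    finally show ?thesis
      unfolding g_def by (simp only: Im_avg stieltjes_kernel_imaginary avg_minus minus_minus)
  qed
  then show ?thesis by blast
qed

lemma ex_symmetrized_law:
  fixes X :: "'a \<Rightarrow> real"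
  assumes \<Omega>: "finite \<Omega>" "\<Omega> \<noteq> {}"
  shows "\<exists>\<mu>. symmetric_law \<mu> \<and>
    (\<forall>f::real \<Rightarrow> real. f \<in> borel_measurable borel \<longrightarrow> (\<forall>x. f (- x) = f x) \<longrightarrow> integral\<^sup>L \<mu> f = avg \<Omega> (\<lambda>\<omega>. f (X \<omega>)))"
proof -
  define Y where "Y = (\<lambda>(\<omega>, s). if s then X \<omega> else - X \<omega>)"
  define \<mu> where "\<mu> = distr (measure_pmf (pmf_of_set (\<Omega> \<times> UNIV))) borel Y"
  have int: "integral\<^sup>L \<mu> f = avg \<Omega> (\<lambda>\<omega>. (f (X \<omega>) + f (- X \<omega>)) / 2)"
    if [measurable]: "f \<in> borel_measurable borel" for f :: "real \<Rightarrow> real"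
  proof -
    have "integral\<^sup>L \<mu> f = avg (\<Omega> \<times> UNIV) (\<lambda>x. f (Y x))"
      unfolding \<mu>_def by (subst integral_distr) (use \<Omega> in \<open>auto intro: expectation_pmf_of_set\<close>)
    also have "\<dots> = avg \<Omega> (\<lambda>\<omega>. avg UNIV (\<lambda>s. f (Y (\<omega>, s))))" by (rule avg_Times)
    also have "\<dots> = avg \<Omega> (\<lambda>\<omega>. (f (X \<omega>) + f (- X \<omega>)) / 2)"
      by (simp add: avg_def Y_def UNIV_bool add.commute)
    finally show ?thesis .
  qed
  have "real_distribution \<mu>"
    unfolding \<mu>_def by (rule prob_space.real_distribution_distr[OF measure_pmf.prob_space_axioms]) simp
  then have "symmetric_law \<mu>"
    by (rule symmetric_lawI) (simp add: int avg_def)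
  moreover have "integral\<^sup>L \<mu> f = avg \<Omega> (\<lambda>\<omega>. f (X \<omega>))"
    if "f \<in> borel_measurable borel" "\<And>x. f (- x) = f x" for f :: "real \<Rightarrow> real"
    using that by (simp add: int)
  ultimately show ?thesis by blast
qed

lemma (in perm_model) averaged_spectral_law:
  "\<exists>\<mu>. symmetric_law \<mu> \<and> (\<forall>\<eta>>0. integral\<^sup>L \<mu> (poisson \<eta>) = gbar \<eta>)"
proof -
  obtain ev where ev: "\<And>w \<eta>. w \<in> W \<Longrightarrow> \<eta> > 0 \<Longrightarrow> g \<eta> w = avg {..<2*n} (\<lambda>k. poisson \<eta> (ev w k))"
    using g_spectral by metis
  have "finite (W \<times> {..<2*n})" "W \<times> {..<2*n} \<noteq> {}"
    using finite_W W_nonempty n by (auto simp: lessThan_empty_iff)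
  from ex_symmetrized_law[OF this, of "\<lambda>p. ev (fst p) (snd p)"] obtain \<mu> where \<mu>: "symmetric_law \<mu>"
    and int: "\<And>f :: real \<Rightarrow> real. f \<in> borel_measurable borel \<Longrightarrow> (\<And>x. f (- x) = f x) \<Longrightarrow>
      integral\<^sup>L \<mu> f = avg (W \<times> {..<2*n}) (\<lambda>p. f (ev (fst p) (snd p)))" by blast
  have "integral\<^sup>L \<mu> (poisson \<eta>) = gbar \<eta>" if \<eta>: "\<eta> > 0" for \<eta>
  proof -
    have "integral\<^sup>L \<mu> (poisson \<eta>) = avg W (\<lambda>w. avg {..<2*n} (\<lambda>k. poisson \<eta> (ev w k)))"
      by (subst int) (simp_all add: poisson_minus avg_Times)
    also have "\<dots> = gbar \<eta>" unfolding gbar_def by (intro avg_cong) (simp add: ev \<eta>)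
    finally show ?thesis .
  qed
  with \<mu> show ?thesis by blast
qed

lemma measure_interval_ge_poisson:
  assumes \<mu>: "real_distribution \<mu>" and b: "b > 0"
  shows "measure \<mu> {-b<..b} \<ge> 2 * (b * integral\<^sup>L \<mu> (poisson b)) - 1"
proof -
  interpret real_distribution \<mu> by fact
  have le: "2 * (b * poisson b x) - 1 \<le> indicator {-b<..b} x" for x
  proof (cases "x \<in> {-b<..b}")
    case True
    have "b * poisson b x \<le> b * (1 / b)" using poisson_bounds[OF b, of x] b by (intro mult_left_mono) auto
    then show ?thesis using True b by simp
  next
    case False
    then have "b \<le> \<bar>x\<bar>" by auto
    then have "b\<^sup>2 \<le> x\<^sup>2" using b by (metis abs_of_pos abs_le_square_iff)
    moreover have "b * poisson b x = b\<^sup>2 / (b\<^sup>2 + x\<^sup>2)" by (simp add: poisson_def power2_eq_square)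
    ultimately have "b * poisson b x \<le> 1 / 2"
      using b by (simp add: pos_divide_le_eq add_pos_nonneg)
    then show ?thesis using False by (simp add: mult.commute)
  qed
  have "2 * (b * integral\<^sup>L \<mu> (poisson b)) - 1 = integral\<^sup>L \<mu> (\<lambda>x. 2 * (b * poisson b x) - 1)"
    using integrable_poisson[OF \<mu> b] prob_space by simp
  also have "\<dots> \<le> integral\<^sup>L \<mu> (indicator {-b<..b})"
    using integrable_poisson[OF \<mu> b] le
    by (intro integral_mono integrable_real_distribution[OF \<mu>, of "indicator _ :: real \<Rightarrow> real" 1])
      (auto simp: indicator_def)
  finally show ?thesis by simp
qed

lemma tight_poissonI:
  assumes \<mu>: "\<And>k. real_distribution (\<mu> k)"
    and mass: "\<And>k b. b \<ge> 1 \<Longrightarrow> b * integral\<^sup>L (\<mu> k) (poisson b) \<ge> 1 - C / b"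
  shows "tight \<mu>"
  unfolding tight_def
proof (intro conjI allI impI \<mu>)
  fix e :: real assume e: "e > 0"
  define b where "b = max 1 ((2 * C + 1) / e)"
  have b: "b \<ge> 1" "(2 * C + 1) / e \<le> b" by (auto simp: b_def)
  then have "2 * C / b < e" using e by (simp add: pos_divide_le_eq pos_divide_less_eq mult.commute)
  then have "measure (\<mu> k) {-b<..b} > 1 - e" for k
    using measure_interval_ge_poisson[OF \<mu>, of b k] mass[OF b(1), of k] b(1) by simp
  then show "\<exists>a b. a < b \<and> (\<forall>k. 1 - e < measure (\<mu> k) {a<..b})"
    using b(1) by (intro exI[of _ "- b"] exI[of _ b]) simp
qed

lemma tight_symmetric_law_limit:
  assumes \<mu>: "\<And>k. symmetric_law (\<mu> k)" and "tight \<mu>"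
    and lim: "\<And>\<eta>. \<eta> > 0 \<Longrightarrow> (\<lambda>k. integral\<^sup>L (\<mu> k) (poisson \<eta>)) \<longlonglongrightarrow> h \<eta>"
  obtains \<nu> where "symmetric_law \<nu>" "\<And>\<eta>. \<eta> > 0 \<Longrightarrow> integral\<^sup>L \<nu> (poisson \<eta>) = h \<eta>"
proof -
  obtain s \<nu> where s: "strict_mono (s :: nat \<Rightarrow> nat)" and \<nu>: "real_distribution \<nu>"
    and weak: "weak_conv_m (\<mu> \<circ> id \<circ> s) \<nu>"
    using tight_imp_convergent_subsubsequence[OF \<open>tight \<mu>\<close> strict_mono_id] by blast
  have conv: "(\<lambda>k. integral\<^sup>L (\<mu> (s k)) f) \<longlonglongrightarrow> integral\<^sup>L \<nu> f"
    if "\<And>x. isCont f x" "\<And>x. norm (f x) \<le> B" for f :: "real \<Rightarrow> real" and B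
    using weak_conv_imp_integral_bdd_continuous_conv[of "\<mu> \<circ> id \<circ> s" \<nu> f B]
      symmetric_law_real_distribution[OF \<mu>] \<nu> weak that by simp
  have "symmetric_law \<nu>"
  proof (rule symmetric_lawI[OF \<nu>])
    fix t
    have "integral\<^sup>L (\<mu> (s k)) (\<lambda>x. sin (t * x)) = 0" for k
      by (rule symmetric_law_integral_odd[OF \<mu>]) auto
    moreover have "(\<lambda>k. integral\<^sup>L (\<mu> (s k)) (\<lambda>x. sin (t * x))) \<longlonglongrightarrow> integral\<^sup>L \<nu> (\<lambda>x. sin (t * x))"
      by (rule conv[where B = 1]) (auto intro!: continuous_intros)
    ultimately show "integral\<^sup>L \<nu> (\<lambda>x. sin (t * x)) = 0" by (simp add: LIMSEQ_const_iff)
  qed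
  moreover have "integral\<^sup>L \<nu> (poisson \<eta>) = h \<eta>" if \<eta>: "\<eta> > 0" for \<eta>
  proof (rule LIMSEQ_unique)
    show "(\<lambda>k. integral\<^sup>L (\<mu> (s k)) (poisson \<eta>)) \<longlonglongrightarrow> integral\<^sup>L \<nu> (poisson \<eta>)"
      by (rule conv[where B = "1 / \<eta>"]) (use isCont_poisson[OF \<eta>] poisson_bounds[OF \<eta>] in \<open>auto simp: abs_of_pos\<close>)
    show "(\<lambda>k. integral\<^sup>L (\<mu> (s k)) (poisson \<eta>)) \<longlonglongrightarrow> h \<eta>"
      using LIMSEQ_subseq_LIMSEQ[OF lim[OF \<eta>] s] by (simp add: o_def)
  qed
  ultimately show ?thesis by (rule that)
qed

text \<open>The limiting law is found along \<open>d = n\<close>, where all error terms are of order \<open>1 / sqrt n\<close>.\<close>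

locale square_perm_model = perm_model n n z for n :: nat and z :: complex +
  assumes z: "cmod z \<le> 1"
begin

lemma abs_cubic_gbar_le_inverse_sqrt:
  assumes \<eta>: "\<eta> > 0"
  shows "\<bar>cubic (1 - (cmod z)\<^sup>2) \<eta> (gbar \<eta>)\<bar> \<le> (1 / \<eta> + 6 / \<eta>\<^sup>2 + 19 / \<eta>^3) * (\<eta> + 1 / \<eta> + 1) / sqrt n"
proof -
  have split_error: "c / (sqrt n * y) = c / y / sqrt n" "sqrt n / (n * y) = 1 / y / sqrt n" for c y :: real
    using n by (simp_all add: divide_simps mult.commute)
  have error: "cubic_error \<eta> = (1 / \<eta> + 6 / \<eta>\<^sup>2 + 19 / \<eta>^3) / sqrt n"
    unfolding cubic_error_def[OF \<eta>] split_error by (simp add: add_divide_distrib)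
  have "\<bar>cubic (1 - (cmod z)\<^sup>2) \<eta> (gbar \<eta>)\<bar> \<le> cubic_error \<eta> * (\<eta> + gbar \<eta> + cmod z)"
    by (rule abs_cubic_gbar_le[OF \<eta>])
  also have "\<dots> \<le> cubic_error \<eta> * (\<eta> + 1 / \<eta> + 1)"
    using \<eta> gbar_le[OF \<eta>] z by (intro mult_left_mono) (auto simp: error)
  finally show ?thesis by (simp add: error)
qed

lemma gbar_dist_cubic_root_le:
  assumes \<eta>: "\<eta> > 0"
  defines "h \<equiv> cubic_root (1 - (cmod z)\<^sup>2) \<eta>"
  shows "\<bar>gbar \<eta> - h\<bar> \<le> (1 / \<eta> + 6 / \<eta>\<^sup>2 + 19 / \<eta>^3) * (\<eta> + 1 / \<eta> + 1) * h / \<eta> / sqrt n"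
proof -
  let ?A = "(1 / \<eta> + 6 / \<eta>\<^sup>2 + 19 / \<eta>^3) * (\<eta> + 1 / \<eta> + 1)"
  have h: "h > 0" unfolding h_def by (rule cubic_root(1)[OF \<eta>])
  have "\<bar>gbar \<eta> - h\<bar> * (\<eta> / h) \<le> ?A / sqrt n"
    unfolding h_def
    by (rule order_trans[OF dist_cubic_root_mult_ratio_le[OF \<eta> gbar_nonneg[OF \<eta>]]
          abs_cubic_gbar_le_inverse_sqrt[OF \<eta>]])
  then have "\<bar>gbar \<eta> - h\<bar> \<le> ?A / sqrt n / (\<eta> / h)"
    using \<eta> h by (simp only: pos_le_divide_eq divide_pos_pos)
  then show ?thesis by (simp add: mult_ac)
qed

lemma gbar_large_height:
  assumes b: "b \<ge> 1"
  shows "b * gbar b \<ge> 1 - 81 / b"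
proof -
  let ?x = "gbar b"
  have x: "0 \<le> ?x" "?x \<le> 1 / b" using gbar_nonneg gbar_le b by auto
  have inv: "1 / b \<le> 1" "1 / b^2 \<le> 1 / b" "1 / b^3 \<le> 1 / b"
    using b by (auto simp: divide_simps power2_eq_square power3_eq_cube mult_le_cancel_left1 intro: order_trans)
  have "1 / b + 6 / b\<^sup>2 + 19 / b^3 \<le> 26 / b" using inv(2,3) by simp
  moreover have "b + 1 / b + 1 \<le> 3 * b" using inv(1) b by linarith
  ultimately have "(1 / b + 6 / b\<^sup>2 + 19 / b^3) * (b + 1 / b + 1) \<le> 26 / b * (3 * b)"
    using b by (intro mult_mono) auto
  then have "(1 / b + 6 / b\<^sup>2 + 19 / b^3) * (b + 1 / b + 1) / sqrt n \<le> 78 / sqrt n"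
    using b by (intro divide_right_mono) auto
  also have "\<dots> \<le> 78" using n by (simp add: divide_simps)
  finally have "\<bar>cubic (1 - (cmod z)\<^sup>2) b ?x\<bar> \<le> 78"
    using abs_cubic_gbar_le_inverse_sqrt[of b] b by simp
  moreover have "cubic (1 - (cmod z)\<^sup>2) b ?x \<le> ?x * (b + ?x)\<^sup>2 - b"
    using z x by (simp add: cubic_def power_le_one)
  ultimately have "b - 78 \<le> ?x * (b + ?x)\<^sup>2" by linarith
  also have "\<dots> \<le> ?x * (b\<^sup>2 + 3)"
  proof (intro mult_left_mono x(1))
    have "(b + ?x)\<^sup>2 \<le> (b + 1 / b)\<^sup>2" using x b by (intro power_mono) auto
    also have "\<dots> = b\<^sup>2 + 2 + (1 / b)\<^sup>2" using b by (simp add: power2_eq_square field_simps)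
    also have "\<dots> \<le> b\<^sup>2 + 3" using power_le_one[of "1 / b" 2] b by simp
    finally show "(b + ?x)\<^sup>2 \<le> b\<^sup>2 + 3" .
  qed
  also have "\<dots> = (b * ?x) * b + 3 * ?x" by (simp add: power2_eq_square algebra_simps)
  finally have "b - 81 \<le> (b * ?x) * b" using x inv(1) by linarith
  then have "(b - 81) / b \<le> b * ?x" using b by (simp add: pos_divide_le_eq)
  then show ?thesis using b by (simp add: diff_divide_distrib)
qed

end

lemma gbar_tendsto_cubic_root:
  assumes \<eta>: "\<eta> > 0" and z: "cmod z \<le> 1"
  shows "(\<lambda>k. perm_model.gbar (k + 2) (k + 2) z \<eta>) \<longlonglongrightarrow> cubic_root (1 - (cmod z)\<^sup>2) \<eta>"
proof -
  define h where "h = cubic_root (1 - (cmod z)\<^sup>2) \<eta>"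
  define A where "A = (1 / \<eta> + 6 / \<eta>\<^sup>2 + 19 / \<eta>^3) * (\<eta> + 1 / \<eta> + 1) * h / \<eta>"
  have bound: "norm (perm_model.gbar (k + 2) (k + 2) z \<eta> - h) \<le> A / sqrt (real (k + 2))" for k
  proof -
    interpret square_perm_model "k + 2" z by unfold_locales (use z in auto)
    show ?thesis using gbar_dist_cubic_root_le[OF \<eta>] by (simp add: A_def h_def)
  qed
  have "(\<lambda>k. A / sqrt (real (k + 2))) \<longlonglongrightarrow> 0"
    by (intro tendsto_divide_0[OF tendsto_const] filterlim_at_top_imp_at_infinity
        filterlim_compose[OF sqrt_at_top] filterlim_compose[OF filterlim_real_sequentially]
        filterlim_add_const_nat_at_top)
  then have "(\<lambda>k. perm_model.gbar (k + 2) (k + 2) z \<eta> - h) \<longlonglongrightarrow> 0"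
    by (rule Lim_null_comparison[OF always_eventually[OF allI[OF bound]]])
  then show ?thesis unfolding h_def by (rule LIM_zero_cancel)
qed

lemma limiting_law_exists:
  assumes z: "cmod z \<le> 1"
  obtains \<nu> where "symmetric_law \<nu>"
    "\<And>\<eta>. \<eta> > 0 \<Longrightarrow> integral\<^sup>L \<nu> (poisson \<eta>) = cubic_root (1 - (cmod z)\<^sup>2) \<eta>"
proof -
  have model: "square_perm_model (k + 2) z" for k by unfold_locales (use z in auto)
  then have "\<exists>\<mu>. symmetric_law \<mu> \<and> (\<forall>\<eta>>0. integral\<^sup>L \<mu> (poisson \<eta>) = perm_model.gbar (k + 2) (k + 2) z \<eta>)" for k
    by (intro perm_model.averaged_spectral_law square_perm_model.axioms(1))
  then obtain \<mu> where \<mu>: "\<And>k. symmetric_law (\<mu> k)"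
    and int: "\<And>k \<eta>. \<eta> > 0 \<Longrightarrow> integral\<^sup>L (\<mu> k) (poisson \<eta>) = perm_model.gbar (k + 2) (k + 2) z \<eta>" by metis
  have tight: "tight \<mu>"
  proof (rule tight_poissonI[OF symmetric_law_real_distribution[OF \<mu>]])
    show "b * integral\<^sup>L (\<mu> k) (poisson b) \<ge> 1 - 81 / b" if "b \<ge> 1" for k b
      using square_perm_model.gbar_large_height[OF model that] that by (simp add: int)
  qed
  have lim: "(\<lambda>k. integral\<^sup>L (\<mu> k) (poisson \<eta>)) \<longlonglongrightarrow> cubic_root (1 - (cmod z)\<^sup>2) \<eta>" if "\<eta> > 0" for \<eta>
    using gbar_tendsto_cubic_root[OF that z] by (simp add: int that)
  show ?thesis by (rule tight_symmetric_law_limit[OF \<mu> tight lim that])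
qed

lemma m_inf_imaginary:
  assumes z: "cmod z \<le> 1" and \<eta>: "\<eta> > 0"
  shows "m_inf z (\<i> * of_real \<eta>) = - (\<i> * of_real (cubic_root (1 - (cmod z)\<^sup>2) \<eta>))"
proof -
  obtain \<nu> where \<nu>: "symmetric_law \<nu>"
    "\<And>\<eta>. \<eta> > 0 \<Longrightarrow> integral\<^sup>L \<nu> (poisson \<eta>) = cubic_root (1 - (cmod z)\<^sup>2) \<eta>"
    using limiting_law_exists[OF z] by blast
  have "m_inf z = stieltjes \<nu>" by (rule m_inf_eqI[OF \<nu>])
  then show ?thesis by (simp add: stieltjes_imaginary[OF \<nu>(1) \<eta>] \<nu>(2)[OF \<eta>])
qed

section \<open>The local law\<close>

definition local_law_rate :: "nat \<Rightarrow> nat \<Rightarrow> real" where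
  "local_law_rate n d = max (1 / sqrt (real d)) (ln (real n) / real n powr (1/4))"

lemma
  assumes n: "n \<ge> 3"
  shows inverse_sqrt_d_le_rate: "1 / sqrt (real d) \<le> local_law_rate n d"
    and ln_over_sqrt_le_rate: "ln (real n) / sqrt n \<le> local_law_rate n d"
    and inverse_sqrt_n_le_rate: "1 / sqrt (real n) \<le> local_law_rate n d"
    and inverse_n_le_rate: "1 / real n \<le> local_law_rate n d"
proof -
  show "1 / sqrt (real d) \<le> local_law_rate n d" by (simp add: local_law_rate_def)
  have "exp 1 \<le> real n" using exp_le n by linarith
  then have ln_ge_1: "1 \<le> ln (real n)" using n by (subst ln_ge_iff) auto
  have "real n powr (1/4) \<le> real n powr (1/2)" using n by (intro powr_mono) auto
  then have "ln (real n) / sqrt n \<le> ln (real n) / real n powr (1/4)"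
    using ln_ge_1 n by (intro divide_left_mono) (auto simp: powr_half_sqrt)
  then show ln_le: "ln (real n) / sqrt n \<le> local_law_rate n d" by (simp add: local_law_rate_def)
  then show sqrt_le: "1 / sqrt (real n) \<le> local_law_rate n d"
    using divide_right_mono[OF ln_ge_1, of "sqrt n"] by simp
  have "1 / real n \<le> 1 / sqrt n"
    using n by (intro divide_left_mono) (auto simp: real_le_lsqrt power2_eq_square)
  then show "1 / real n \<le> local_law_rate n d" using sqrt_le by linarith
qed

lemma local_law_rate_pos: "n \<ge> 3 \<Longrightarrow> 0 < local_law_rate n d"
  using inverse_n_le_rate[of n d] by (auto intro: less_le_trans[of _ "1 / real n"])

lemma mult_local_law_rate_le:
  assumes n: "n \<ge> 3" and d: "d \<ge> 1"
    and window: "x * min (sqrt (real d)) (real n powr (1/4) / ln (real n)) \<ge> y" and x: "x \<ge> 0"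
  shows "y * local_law_rate n d \<le> x"
proof -
  have "1 < ln (real n) + 1" and powr: "real n powr (1/4) > 0" using n by auto
  then have ln: "ln (real n) > 0" by simp
  have "y \<le> x * sqrt d" and "y \<le> x * (real n powr (1/4) / ln (real n))"
    by (rule order_trans[OF window mult_left_mono[OF _ x]], simp)+
  then have "y * (1 / sqrt d) \<le> x" and "y * (ln (real n) / real n powr (1/4)) \<le> x"
    using d ln powr by (simp_all add: field_simps)
  then show ?thesis by (auto simp: local_law_rate_def max_def)
qed

context perm_model
begin

lemma cubic_error_le:
  fixes D :: real
  assumes D: "real d \<le> D * n" and \<eta>: "0 < \<eta>" "\<eta> \<le> 1" and \<delta>: "1 / sqrt d \<le> \<delta>" "1 / sqrt n \<le> \<delta>"
  shows "cubic_error \<eta> \<le> (sqrt D + 25) * \<delta> / \<eta>^3"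
proof -
  have \<delta>_nonneg: "\<delta> \<ge> 0" using \<delta>(2) by (rule order_trans[rotated]) simp
  have D_nonneg: "D \<ge> 0"
  proof (rule ccontr)
    assume "\<not> D \<ge> 0"
    then have "D * n \<le> 0" by (simp add: mult_nonpos_nonneg)
    then show False using D d by linarith
  qed
  have inv: "1 / \<eta> \<le> 1 / \<eta>^3" "1 / \<eta>\<^sup>2 \<le> 1 / \<eta>^3"
    using \<eta> power_decreasing[of 1 3 \<eta>] power_decreasing[of 2 3 \<eta>] by (auto intro!: divide_left_mono)
  have "sqrt d \<le> sqrt D * sqrt n" using D by (simp flip: real_sqrt_mult)
  then have "sqrt d / n \<le> sqrt D * sqrt n / n" by (rule divide_right_mono) simp
  also have "\<dots> = sqrt D * (1 / sqrt n)" using n by (simp add: field_simps)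
  also have "\<dots> \<le> sqrt D * \<delta>" using \<delta>(2) D_nonneg by (intro mult_left_mono) auto
  finally have sqrt_ratio: "sqrt d / n \<le> sqrt D * \<delta>" .
  have "cubic_error \<eta> = sqrt d / n * (1 / \<eta>) + 6 * (1 / sqrt n * (1 / \<eta>\<^sup>2))
      + 3 * (1 / sqrt d * (1 / \<eta>^3)) + 16 * (1 / sqrt n * (1 / \<eta>^3))"
    by (simp add: cubic_error_def[OF \<eta>(1)])
  also have "\<dots> \<le> sqrt D * \<delta> * (1 / \<eta>^3) + 6 * (\<delta> * (1 / \<eta>^3)) + 3 * (\<delta> * (1 / \<eta>^3)) + 16 * (\<delta> * (1 / \<eta>^3))"
    using \<eta>(1) \<delta>_nonneg D_nonneg by (intro add_mono mult_mono mult_left_mono inv \<delta> sqrt_ratio order_refl) auto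
  also have "\<dots> = (sqrt D + 25) * \<delta> / \<eta>^3" by (simp add: algebra_simps add_divide_distrib)
  finally show ?thesis .
qed

lemma continuous_on_gbar:
  assumes "\<eta> > 0"
  shows "continuous_on {\<eta>..b} gbar"
proof (rule lipschitz_on_continuous_on[of "1 / (\<eta> * \<eta>)"], rule lipschitz_onI)
  fix s t assume st: "s \<in> {\<eta>..b}" "t \<in> {\<eta>..b}"
  have "\<bar>gbar s - gbar t\<bar> \<le> \<bar>s - t\<bar> / (s * t)" by (rule gbar_lipschitz) (use st assms in auto)
  also have "\<dots> \<le> \<bar>s - t\<bar> / (\<eta> * \<eta>)"
    using st assms by (intro divide_left_mono mult_mono mult_pos_pos) auto
  finally show "dist (gbar s) (gbar t) \<le> 1 / (\<eta> * \<eta>) * dist s t" by (simp add: dist_real_def)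
qed (use assms in auto)

lemma gbar_close_to_cubic_root:
  fixes D :: real
  assumes D: "real d \<le> D * n" and \<epsilon>: "0 < \<epsilon>" "\<epsilon> \<le> 1" "cmod z \<le> 1 - \<epsilon>" and \<eta>: "0 < \<eta>" "\<eta> \<le> 1"
    and \<delta>: "1 / sqrt d \<le> \<delta>" "1 / sqrt n \<le> \<delta>" and D_nonneg: "D \<ge> 0"
    and small: "(sqrt D + 25) * \<delta> / \<eta>^3 < \<epsilon>\<^sup>2 / 32"
  shows "\<bar>gbar \<eta> - cubic_root (1 - (cmod z)\<^sup>2) \<eta>\<bar> \<le> (sqrt D + 25) * \<delta> / \<eta>^3 * (48 / \<epsilon>\<^sup>2)"
proof -
  define e where "e s = (sqrt D + 25) * \<delta> / s^3" for s
  have "0 < 1 / sqrt (real n)" using n by simp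
  then have "\<delta> > 0" using \<delta>(2) by linarith
  then have K: "0 \<le> (sqrt D + 25) * \<delta>" using D_nonneg by simp
  have e: "0 \<le> e s \<and> e s < \<epsilon>\<^sup>2 / 32" if s: "s \<in> {\<eta>..1}" for s
  proof -
    have "e s \<le> e \<eta>"
      unfolding e_def using K s \<eta> by (intro divide_left_mono power_mono mult_pos_pos zero_less_power) auto
    moreover have "0 \<le> e s" using K s \<eta> by (simp add: e_def)
    moreover have "e \<eta> < \<epsilon>\<^sup>2 / 32" using small by (simp only: e_def)
    ultimately show ?thesis by linarith
  qed
  have approx: "\<bar>cubic (1 - (cmod z)\<^sup>2) s (gbar s)\<bar> \<le> e s * (s + gbar s + 1)" if s: "s \<in> {\<eta>..1}" for s
  proof -
    have s': "0 < s" "s \<le> 1" using s \<eta> by auto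
    have "\<bar>cubic (1 - (cmod z)\<^sup>2) s (gbar s)\<bar> \<le> cubic_error s * (s + gbar s + cmod z)"
      by (rule abs_cubic_gbar_le[OF s'(1)])
    also have "\<dots> \<le> e s * (s + gbar s + 1)"
      using cubic_error_le[OF D s' \<delta>] e[OF s] gbar_nonneg[OF s'(1)] s' \<epsilon>
      by (intro mult_mono) (auto simp: e_def)
    finally show ?thesis .
  qed
  have "(cmod z)\<^sup>2 \<le> cmod z" using \<epsilon> by (simp add: power2_eq_square mult_left_le)
  then have gap: "\<epsilon> \<le> 1 - (cmod z)\<^sup>2" using \<epsilon>(3) by linarith
  have "gbar \<eta> > \<epsilon> / 4"
    by (rule approx_cubic_root_gt_threshold[OF \<eta> \<epsilon>(1,2) gap continuous_on_gbar[OF \<eta>(1)] _ approx e])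
       (use gbar_nonneg \<eta> in auto)
  then have "\<bar>gbar \<eta> - cubic_root (1 - (cmod z)\<^sup>2) \<eta>\<bar> \<le> e \<eta> * (48 / \<epsilon>\<^sup>2)"
    by (rule approx_cubic_root_dist_le[OF \<eta> \<epsilon>(1,2)]) (use e[of \<eta>] approx[of \<eta>] \<eta> in auto)
  then show ?thesis by (simp add: e_def)
qed

definition grid_dev :: "nat \<Rightarrow> real" where
  "grid_dev k = 8 * ln (real n) / (sqrt n * (real k / real n)\<^sup>2)"

definition good_event :: "(nat \<Rightarrow> nat \<Rightarrow> nat) set" where
  "good_event = {w. \<forall>k\<in>{1..n}. \<bar>g (real k / real n) w - gbar (real k / real n)\<bar> < grid_dev k}"

lemma grid_tail:
  assumes k: "k \<in> {1..n}"
  shows "avg W (\<lambda>w. of_bool (grid_dev k \<le> \<bar>g (real k / real n) w - gbar (real k / real n)\<bar>))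
    \<le> 2 * exp (- (2 * (ln (real n))\<^sup>2))"
proof -
  define q where "q = real k / real n"
  have q: "q > 0" using k n by (auto simp: q_def)
  have dev: "grid_dev k = 8 * ln (real n) / (sqrt n * q\<^sup>2)" by (simp add: grid_dev_def q_def)
  have "avg W (\<lambda>w. of_bool (grid_dev k \<le> \<bar>g q w - gbar q\<bar>)) \<le> 2 * exp (- ((grid_dev k)\<^sup>2 * n * q^4 / 32))"
    by (rule g_tail[OF q]) (use q n in \<open>simp add: dev\<close>)
  also have "(grid_dev k)\<^sup>2 * n * q^4 / 32 = 2 * (ln (real n))\<^sup>2"
    using q n by (simp add: dev power_divide power_mult_distrib)
  finally show ?thesis by (simp only: q_def)
qed

lemma good_event_prob:
  "measure_pmf.prob (perm_pmf n d) (perm_space n d - good_event) \<le> 2 * exp 1 * exp (- (ln (real n))\<^sup>2)"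
proof -
  let ?bad = "\<lambda>k w. grid_dev k \<le> \<bar>g (real k / real n) w - gbar (real k / real n)\<bar>"
  have "measure_pmf.prob (perm_pmf n d) (perm_space n d - good_event) = avg W (\<lambda>w. of_bool (w \<in> W - good_event))"
    unfolding perm_pmf_def perm_space_eq_W by (rule prob_pmf_of_set[OF finite_W W_nonempty])
  also have "\<dots> \<le> avg W (\<lambda>w. \<Sum>k\<in>{1..n}. of_bool (?bad k w))"
  proof (rule avg_mono)
    fix w
    show "of_bool (w \<in> W - good_event) \<le> (\<Sum>k\<in>{1..n}. of_bool (?bad k w) :: real)"
    proof (cases "w \<in> good_event")
      case False
      then obtain k where k: "k \<in> {1..n}" "?bad k w" by (auto simp: good_event_def not_less)
      have "(1::real) = of_bool (?bad k w)" using k(2) by simp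
      also have "\<dots> \<le> (\<Sum>k\<in>{1..n}. of_bool (?bad k w))" using k(1) by (intro member_le_sum) auto
      finally show ?thesis by (auto simp: of_bool_def)
    qed (simp add: sum_nonneg)
  qed
  also have "\<dots> = (\<Sum>k\<in>{1..n}. avg W (\<lambda>w. of_bool (?bad k w)))" by (rule avg_sum)
  also have "\<dots> \<le> (\<Sum>k\<in>{1..n}. 2 * exp (- (2 * (ln (real n))\<^sup>2)))" by (intro sum_mono grid_tail)
  also have "\<dots> = 2 * exp (ln (real n) - 2 * (ln (real n))\<^sup>2)" using n by (simp add: exp_diff exp_minus divide_inverse)
  also have "\<dots> \<le> 2 * exp (1 - (ln (real n))\<^sup>2)"
  proof -
    have "0 \<le> (2 * ln (real n) - 1)\<^sup>2" by simp
    then have "ln (real n) - 2 * (ln (real n))\<^sup>2 \<le> 1 - (ln (real n))\<^sup>2"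
      by (simp add: power2_eq_square algebra_simps)
    then show ?thesis by simp
  qed
  also have "\<dots> = 2 * exp 1 * exp (- (ln (real n))\<^sup>2)" by (simp add: exp_diff exp_minus divide_inverse)
  finally show ?thesis .
qed

text \<open>Between grid points the deviation is controlled by the Lipschitz bound, at the next larger grid point.\<close>

lemma good_event_dev_le:
  assumes w: "w \<in> good_event" "w \<in> W" and \<eta>: "0 < \<eta>" "\<eta> \<le> 1"
  shows "\<bar>g \<eta> w - gbar \<eta>\<bar> \<le> (2 / n + 8 * ln (real n) / sqrt n) / \<eta>^3"
proof -
  define k where "k = nat \<lceil>\<eta> * n\<rceil>"
  define s where "s = real k / real n"
  have "\<eta> * n > 0" using \<eta> n by simp
  then have k_eq: "real k = of_int \<lceil>\<eta> * n\<rceil>" and k_pos: "k \<ge> 1" by (simp_all add: k_def Suc_le_eq)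
  have "\<eta> * n \<le> n" using \<eta> by (simp add: mult_left_le_one_le)
  then have "k \<le> n" by (simp add: k_def ceiling_le_iff nat_le_iff)
  then have k: "k \<in> {1..n}" using k_pos by simp
  have "\<eta> * n \<le> k" "k \<le> \<eta> * n + 1" unfolding k_eq by linarith+
  then have "\<eta> \<le> s" "s \<le> (\<eta> * n + 1) / n"
    using n by (simp_all add: s_def pos_le_divide_eq divide_right_mono)
  then have s: "\<eta> \<le> s" "s - \<eta> \<le> 1 / n" using n by (simp_all add: add_divide_distrib)
  then have s_pos: "s > 0" using \<eta> by linarith
  have lip: "\<bar>\<eta> - s\<bar> / (\<eta> * s) \<le> 1 / n / \<eta>\<^sup>2"
    unfolding power2_eq_square using s \<eta> s_pos by (intro frac_le mult_mono mult_pos_pos) auto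
  have "\<bar>g s w - gbar s\<bar> < 8 * ln (real n) / (sqrt n * s\<^sup>2)"
    using w(1) k by (simp add: good_event_def grid_dev_def s_def)
  also have "\<dots> \<le> 8 * ln (real n) / (sqrt n * \<eta>\<^sup>2)"
    using s(1) \<eta> n s_pos by (intro divide_left_mono mult_left_mono power_mono mult_pos_pos) auto
  finally have "\<bar>g \<eta> w - gbar \<eta>\<bar> \<le> 2 * (1 / n / \<eta>\<^sup>2) + 8 * ln (real n) / (sqrt n * \<eta>\<^sup>2)"
    using g_lipschitz[OF \<eta>(1) s_pos w(2)] gbar_lipschitz[OF \<eta>(1) s_pos] lip by linarith
  also have "\<dots> = (2 / n + 8 * ln (real n) / sqrt n) / \<eta>\<^sup>2" by (simp add: add_divide_distrib)
  also have "\<dots> \<le> (2 / n + 8 * ln (real n) / sqrt n) / \<eta>^3"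
    using n \<eta> power_decreasing[of 2 3 \<eta>] by (intro divide_left_mono) auto
  finally show ?thesis .
qed

lemma local_law:
  fixes D :: real
  assumes n3: "n \<ge> 3" and D: "real d \<le> D * n" "D \<ge> 0" and \<epsilon>: "0 < \<epsilon>" "\<epsilon> \<le> 1" "cmod z \<le> 1 - \<epsilon>"
    and w: "w \<in> good_event" "w \<in> W" and \<eta>: "0 < \<eta>" "\<eta> \<le> 1"
    and small: "(sqrt D + 25) * local_law_rate n d / \<eta>^3 < \<epsilon>\<^sup>2 / 32"
  shows "cmod (m_n n d z w (\<i> * of_real \<eta>) - m_inf z (\<i> * of_real \<eta>))
    \<le> ((sqrt D + 25) * (48 / \<epsilon>\<^sup>2) + 10) * local_law_rate n d / \<eta>^3"
proof -
  let ?h = "cubic_root (1 - (cmod z)\<^sup>2) \<eta>" and ?\<delta> = "local_law_rate n d"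
  have mean: "\<bar>gbar \<eta> - ?h\<bar> \<le> (sqrt D + 25) * ?\<delta> / \<eta>^3 * (48 / \<epsilon>\<^sup>2)"
    by (rule gbar_close_to_cubic_root[OF D(1) \<epsilon> \<eta> inverse_sqrt_d_le_rate[OF n3]
          inverse_sqrt_n_le_rate[OF n3] D(2) small])
  have "\<bar>g \<eta> w - gbar \<eta>\<bar> \<le> (2 / n + 8 * ln (real n) / sqrt n) / \<eta>^3"
    by (rule good_event_dev_le[OF w \<eta>])
  also have "\<dots> \<le> 10 * ?\<delta> / \<eta>^3"
    using inverse_n_le_rate[OF n3, of d] ln_over_sqrt_le_rate[OF n3, of d] \<eta> by (intro divide_right_mono) auto
  finally have deviation: "\<bar>g \<eta> w - gbar \<eta>\<bar> \<le> 10 * ?\<delta> / \<eta>^3" .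
  have "m_n n d z w (\<i> * of_real \<eta>) - m_inf z (\<i> * of_real \<eta>) = - (\<i> * of_real (g \<eta> w - ?h))"
    using m_n_imaginary[OF \<eta>(1) w(2)] m_inf_imaginary[OF _ \<eta>(1), of z] \<epsilon> by (simp add: algebra_simps)
  then have "cmod (m_n n d z w (\<i> * of_real \<eta>) - m_inf z (\<i> * of_real \<eta>)) = \<bar>g \<eta> w - ?h\<bar>"
    by (simp only: norm_minus_cancel norm_mult norm_ii norm_of_real mult_1_left)
  also have "\<dots> \<le> (sqrt D + 25) * ?\<delta> / \<eta>^3 * (48 / \<epsilon>\<^sup>2) + 10 * ?\<delta> / \<eta>^3"
    using mean deviation by linarith
  also have "\<dots> = ((sqrt D + 25) * (48 / \<epsilon>\<^sup>2) + 10) * ?\<delta> / \<eta>^3"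
    by (simp add: algebra_simps add_divide_distrib)
  finally show ?thesis .
qed

end

lemma good_event_prob_le:
  assumes "n \<ge> 1" "d \<ge> 1"
  shows "measure_pmf.prob (perm_pmf n d) (perm_space n d - perm_model.good_event n d z)
    \<le> 2 * exp 1 * exp (- 1 * (ln (real n))\<^sup>2) + exp (- 1 * real d)"
proof (cases "n = 1")
  case True
  have "measure_pmf.prob (perm_pmf n d) (perm_space n d - perm_model.good_event n d z) \<le> 2 * exp 1"
    by (rule order_trans[OF measure_pmf.prob_le_1]) (use exp_ge_add_one_self[of "1::real"] in simp)
  then show ?thesis using True by (intro add_increasing2) simp_all
next
  case False
  interpret perm_model n d z by unfold_locales (use assms False in auto)
  show ?thesis using good_event_prob by (intro add_increasing2) simp_all
qed

lemma eventually_local_law: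
  fixes D \<epsilon> :: real and d :: "nat \<Rightarrow> nat" and w :: "nat \<Rightarrow> real"
  assumes D: "D > 0" and \<epsilon>: "0 < \<epsilon>" "\<epsilon> < 1" and z: "cmod z \<le> 1 - \<epsilon>"
    and d: "\<And>n. n \<ge> 1 \<Longrightarrow> 1 \<le> d n \<and> real (d n) \<le> D * real n" and w: "filterlim w at_top sequentially"
  shows "\<forall>\<^sub>F n in sequentially. \<forall>\<omega> \<in> perm_model.good_event n (d n) z \<inter> perm_space n (d n). \<forall>\<eta>.
    0 < \<eta> \<and> \<eta> \<le> 1 \<and> \<eta>^3 * min (sqrt (real (d n))) (real n powr (1/4) / ln (real n)) \<ge> w n \<longrightarrow>
    cmod (m_n n (d n) z \<omega> (\<i> * of_real \<eta>) - m_inf z (\<i> * of_real \<eta>))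
      \<le> ((sqrt D + 25) * (48 / \<epsilon>\<^sup>2) + 10) * local_law_rate n (d n) / \<eta>^3"
proof -
  let ?K = "sqrt D + 25"
  have K: "?K > 0" using D by (simp add: add_pos_pos)
  have "\<forall>\<^sub>F n in sequentially. w n \<ge> 32 * ?K / \<epsilon>\<^sup>2 + 1" using w by (simp add: filterlim_at_top)
  with eventually_ge_at_top[of 3] show ?thesis
  proof eventually_elim
    case (elim n)
    then have dn: "1 \<le> d n" "real (d n) \<le> D * n" using d[of n] by auto
    interpret perm_model n "d n" z by unfold_locales (use elim dn in auto)
    let ?\<delta> = "local_law_rate n (d n)"
    show ?case
    proof (intro ballI allI impI, elim conjE)
      fix \<omega> \<eta>
      assume \<omega>: "\<omega> \<in> good_event \<inter> perm_space n (d n)" and \<eta>: "0 < \<eta>" "\<eta> \<le> (1::real)"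
        and window: "w n \<le> \<eta>^3 * min (sqrt (real (d n))) (real n powr (1/4) / ln (real n))"
      have "32 * ?K / \<epsilon>\<^sup>2 * ?\<delta> < w n * ?\<delta>"
        using elim(2) local_law_rate_pos[OF elim(1)] by (intro mult_strict_right_mono) auto
      also have "\<dots> \<le> \<eta>^3"
        by (rule mult_local_law_rate_le[OF elim(1) dn(1) window]) (use \<eta> in simp)
      finally have "?K * ?\<delta> / \<eta>^3 < \<epsilon>\<^sup>2 / 32" using \<epsilon> \<eta> by (simp add: field_simps)
      then show "cmod (m_n n (d n) z \<omega> (\<i> * of_real \<eta>) - m_inf z (\<i> * of_real \<eta>))
          \<le> (?K * (48 / \<epsilon>\<^sup>2) + 10) * ?\<delta> / \<eta>^3"
        using elim(1) dn(2) D \<epsilon> z \<omega> \<eta> by (intro local_law) (auto simp: perm_space_eq_W)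
    qed
  qed
qed

theorem theorem2p6:
  "\<exists>\<epsilon>0::real. \<epsilon>0 > 0 \<and>
   (\<forall>D::real. D > 0 \<longrightarrow>
    (\<exists>c Cbar C :: real. c > 0 \<and> Cbar > 0 \<and> C > 0 \<and>
     (\<forall>\<epsilon>. 0 < \<epsilon> \<and> \<epsilon> < \<epsilon>0 \<longrightarrow>
      (\<exists>Ct::real. Ct > 0 \<and>
       (\<forall>z::complex. cmod z \<le> 1 - \<epsilon> \<longrightarrow>
        (\<forall>(d::nat \<Rightarrow> nat) (w::nat \<Rightarrow> real).
          (\<forall>n\<ge>1. 1 \<le> d n \<and> real (d n) \<le> D * real n) \<longrightarrow>
          filterlim w at_top sequentially \<longrightarrow>
          (\<exists>\<Omega> :: nat \<Rightarrow> (nat \<Rightarrow> nat \<Rightarrow> nat) set.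
             (\<forall>n\<ge>1. measure_pmf.prob (perm_pmf n (d n)) (perm_space n (d n) - \<Omega> n)
                 \<le> C * exp (- c * (ln (real n))^2) + exp (- c * real (d n))) \<and>
             (\<forall>\<^sub>F n in sequentially.
                \<forall>\<omega> \<in> \<Omega> n \<inter> perm_space n (d n). \<forall>\<eta>::real.
                  (0 < \<eta> \<and> \<eta> \<le> Cbar \<and>
                   \<eta>^3 * min (sqrt (real (d n))) (real n powr (1/4) / ln (real n)) \<ge> w n) \<longrightarrow>
                  cmod (m_n n (d n) z \<omega> (\<i> * complex_of_real \<eta>) - m_inf z (\<i> * complex_of_real \<eta>))
                    \<le> Ct * max (1 / sqrt (real (d n))) (ln (real n) / real n powr (1/4)) / \<eta>^3))))))))"
proof (rule exI[of _ 1], intro conjI allI impI, simp, rule exI[of _ 1], rule exI[of _ 1], rule exI[of _ "2 * exp 1"],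
    intro conjI allI impI, goal_cases c_pos Cbar_pos C_pos uniform_law)
  case (uniform_law D \<epsilon>)
  define Ct where "Ct = (sqrt D + 25) * (48 / \<epsilon>\<^sup>2) + 10"
  show ?case
  proof (rule exI[of _ Ct], intro conjI allI impI, goal_cases Ct_pos local_law)
    case Ct_pos
    show ?case using \<open>D > 0\<close> by (simp add: Ct_def add_nonneg_pos)
  next
    case (local_law z d w)
    show ?case
    proof (rule exI[of _ "\<lambda>n. perm_model.good_event n (d n) z"], rule conjI)
      show "\<forall>n\<ge>1. measure_pmf.prob (perm_pmf n (d n)) (perm_space n (d n) - perm_model.good_event n (d n) z)
          \<le> 2 * exp 1 * exp (- 1 * (ln (real n))\<^sup>2) + exp (- 1 * real (d n))"
        using local_law by (intro allI impI good_event_prob_le) auto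
    qed (use eventually_local_law[of D \<epsilon> z d w] local_law uniform_law in \<open>simp add: Ct_def local_law_rate_def\<close>)
  qed
qed simp_all

end
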